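(* Let $n\ge 3$ and $0\le i\le n-3$ be fixed. As $q\to\infty$ through prime powers, the spectrum of the signed up-down walk operator $\Delta_i^+$ on the spherical building $X_{n-2,q}$ converges, as a set (i.e. disregarding multiplicities, in Hausdorff distance), to $\{0,\,n-i-2,\,n-i-1,\dots,n-1\}$.
   Context: For $n\ge 3$ and a prime power $q$, the spherical building $X_{n-2,q}$ is the simplicial complex whose vertices are the linear subspaces of $\mathbb{F}_q^n$ other than $0$ and $\mathbb{F}_q^n$, and whose simplices are the sets of vertices that are pairwise comparable under inclusion (flags). It is pure of dimension $n-2$. Write $X(i)$ for the set of $i$-simplices (those with $i+1$ vertices) and $C^i$ for the space of functions $X(i)\to\mathbb{R}$. The weight $w(s)$ of a simplex $s$ is the number of $(n-2)$-simplices containing $s$, and $\langle f,g\rangle=\sum_{s\in X(i)}w(s)f(s)g(s)$ on $C^i$. Fix a total order on the vertices in which subspaces of smaller dimension precede subspaces of larger dimension. For $s=\{x_0<\dots<x_{i+1}\}\in X(i+1)$ and $f\in C^i$ put $(d_if)(s)=\sum_{k=0}^{i+1}(-1)^kf(s\setminus\{x_k\})$. Let $\delta_i:C^{i+1}\to C^i$ be the adjoint of $d_i$, i.e. $\langle d_if,g\rangle=\langle f,\delta_ig\rangle$. The signed up-down walk operator is $\Delta_i^+=\delta_id_i:C^i\to C^i$. *)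

theory Defs
  imports
    "HOL-Analysis.Elementary_Metric_Spaces"
    "HOL-Number_Theory.Prime_Powers"
    "Jordan_Normal_Form.Missing_VectorSpace"
begin

text \<open>
  The ground field is a record \<open>K\<close> of HOL-Algebra rather than a type of class \<open>field\<close>, so that
  statements can quantify over fields of varying order. Every finite field is isomorphic to one
  whose carrier is a set of naturals, so with \<open>K :: nat ring\<close> all finite fields are covered.
\<close>

abbreviation coord_space :: "('a, 'b) ring_scheme \<Rightarrow> nat \<Rightarrow> ('a, nat \<Rightarrow> 'a) module" where
  "coord_space K n \<equiv> ring.func_space K {..<n}"

definition building_vertices :: "('a, 'b) ring_scheme \<Rightarrow> nat \<Rightarrow> (nat \<Rightarrow> 'a) set set" where
  "building_vertices K n =
     {W. VectorSpace.subspace K W (coord_space K n) \<and>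
         W \<noteq> {\<zero>\<^bsub>coord_space K n\<^esub>} \<and> W \<noteq> carrier (coord_space K n)}"

definition subspace_dim :: "('a, 'b) ring_scheme \<Rightarrow> nat \<Rightarrow> (nat \<Rightarrow> 'a) set \<Rightarrow> nat" where
  "subspace_dim K n W = vectorspace.dim K ((coord_space K n)\<lparr>carrier := W\<rparr>)"

definition building_simplices :: "('a, 'b) ring_scheme \<Rightarrow> nat \<Rightarrow> nat \<Rightarrow> (nat \<Rightarrow> 'a) set set set" where
  "building_simplices K n i =
     {s. s \<subseteq> building_vertices K n \<and> finite s \<and> card s = i + 1 \<and>
         (\<forall>U\<in>s. \<forall>W\<in>s. U \<subseteq> W \<or> W \<subseteq> U)}"

text \<open>Functions on \<open>X(i)\<close> are represented by functions on all sets of vertices that vanish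
  outside \<open>X(i)\<close>.\<close>

definition cochains :: "('a, 'b) ring_scheme \<Rightarrow> nat \<Rightarrow> nat \<Rightarrow> ((nat \<Rightarrow> 'a) set set \<Rightarrow> real) set" where
  "cochains K n i = {f. \<forall>s. s \<notin> building_simplices K n i \<longrightarrow> f s = 0}"

definition weight :: "('a, 'b) ring_scheme \<Rightarrow> nat \<Rightarrow> (nat \<Rightarrow> 'a) set set \<Rightarrow> nat" where
  "weight K n s = card {t \<in> building_simplices K n (n - 2). s \<subseteq> t}"

definition cochain_inner ::
  "('a, 'b) ring_scheme \<Rightarrow> nat \<Rightarrow> nat \<Rightarrow>
     ((nat \<Rightarrow> 'a) set set \<Rightarrow> real) \<Rightarrow> ((nat \<Rightarrow> 'a) set set \<Rightarrow> real) \<Rightarrow> real" where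
  "cochain_inner K n i f g =
     (\<Sum>s\<in>building_simplices K n i. real (weight K n s) * f s * g s)"

definition dim_compatible_order ::
  "('a, 'b) ring_scheme \<Rightarrow> nat \<Rightarrow> ((nat \<Rightarrow> 'a) set \<times> (nat \<Rightarrow> 'a) set) set \<Rightarrow> bool" where
  "dim_compatible_order K n r \<longleftrightarrow>
     linear_order_on (building_vertices K n) r \<and>
     (\<forall>U\<in>building_vertices K n. \<forall>W\<in>building_vertices K n.
        subspace_dim K n U < subspace_dim K n W \<longrightarrow> (U, W) \<in> r)"

text \<open>If \<open>s = {x\<^sub>0 < \<dots> < x\<^sub>i\<^sub>+\<^sub>1}\<close> with respect to \<open>r\<close>, then the index \<open>k\<close> of \<open>x = x\<^sub>k\<close> is the
  number of elements of \<open>s\<close> strictly below \<open>x\<close>.\<close>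

definition coboundary ::
  "('a, 'b) ring_scheme \<Rightarrow> nat \<Rightarrow> ((nat \<Rightarrow> 'a) set \<times> (nat \<Rightarrow> 'a) set) set \<Rightarrow> nat \<Rightarrow>
     ((nat \<Rightarrow> 'a) set set \<Rightarrow> real) \<Rightarrow> (nat \<Rightarrow> 'a) set set \<Rightarrow> real" where
  "coboundary K n r i f =
     (\<lambda>s. if s \<in> building_simplices K n (i + 1)
          then \<Sum>x\<in>s. (-1) ^ card {y \<in> s. y \<noteq> x \<and> (y, x) \<in> r} * f (s - {x})
          else 0)"

text \<open>The value of the adjoint at \<open>g\<close> is determined uniquely: for finite \<open>K\<close> the space of
  \<open>i\<close>-cochains is finite-dimensional, and all weights on \<open>X(i)\<close> are positive because every flag
  extends to a complete one.\<close>

definition coboundary_adjoint ::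
  "('a, 'b) ring_scheme \<Rightarrow> nat \<Rightarrow> ((nat \<Rightarrow> 'a) set \<times> (nat \<Rightarrow> 'a) set) set \<Rightarrow> nat \<Rightarrow>
     ((nat \<Rightarrow> 'a) set set \<Rightarrow> real) \<Rightarrow> (nat \<Rightarrow> 'a) set set \<Rightarrow> real" where
  "coboundary_adjoint K n r i g =
     (THE h. h \<in> cochains K n i \<and>
        (\<forall>f\<in>cochains K n i.
           cochain_inner K n (i + 1) (coboundary K n r i f) g = cochain_inner K n i f h))"

definition signed_up_down_walk ::
  "('a, 'b) ring_scheme \<Rightarrow> nat \<Rightarrow> ((nat \<Rightarrow> 'a) set \<times> (nat \<Rightarrow> 'a) set) set \<Rightarrow> nat \<Rightarrow>
     ((nat \<Rightarrow> 'a) set set \<Rightarrow> real) \<Rightarrow> (nat \<Rightarrow> 'a) set set \<Rightarrow> real" where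
  "signed_up_down_walk K n r i f = coboundary_adjoint K n r i (coboundary K n r i f)"

text \<open>The operator is self-adjoint on a finite-dimensional real inner product space, so its
  spectrum is the set of its real eigenvalues.\<close>

definition signed_up_down_spectrum ::
  "('a, 'b) ring_scheme \<Rightarrow> nat \<Rightarrow> ((nat \<Rightarrow> 'a) set \<times> (nat \<Rightarrow> 'a) set) set \<Rightarrow> nat \<Rightarrow> real set" where
  "signed_up_down_spectrum K n r i =
     {\<mu>. \<exists>f\<in>cochains K n i. f \<noteq> (\<lambda>_. 0) \<and> signed_up_down_walk K n r i f = (\<lambda>s. \<mu> * f s)}"

text \<open>Only meaningful for nonempty bounded sets.\<close>

definition hausdorff_distance :: "'m::metric_space set \<Rightarrow> 'm set \<Rightarrow> real" where
  "hausdorff_distance A B = max (SUP a\<in>A. infdist a B) (SUP b\<in>B. infdist b A)"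

end

theory Submission
  imports Defs "HOL-Analysis.L2_Norm" "HOL-Analysis.Function_Topology"
begin

text \<open>
  Let \<open>m = n - 1\<close> and let \<open>\<Omega>\<close> be the set of complete flags. The weight of a flag is the number of
  complete flags through it, so lifting a cochain \<open>f\<close> to the functions \<open>f\<^sub>I(c) = f(c\<^sub>I)\<close> on \<open>\<Omega>\<close>, where
  \<open>c\<^sub>I\<close> consists of the members of \<open>c\<close> with dimension in \<open>I\<close> and \<open>|I| = i + 1\<close>, embeds \<open>C\<^sup>i\<close> isometrically
  into a sum of copies of \<open>L\<^sup>2(\<Omega>)\<close>. The vertices are ordered by dimension, hence the signs in \<open>d\<close> depend on
  dimensions only, and \<open>(\<Delta>f)\<^sub>I = E\<^sub>I (\<Sum>t\<notin>I. \<plusminus> (df)\<^sub>I\<^sub>t)\<close>, where \<open>E\<^sub>I\<close> is the conditional expectation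
  given \<open>c\<^sub>I\<close> (lemma \<open>walk_part\<close>). Everything is thus expressed by the operators \<open>E\<^sub>I\<close>.

  If \<open>E\<^sub>I E\<^sub>J = E\<^sub>I\<^sub>\<inter>\<^sub>J\<close> held exactly, \<open>L\<^sup>2(\<Omega>)\<close> would split into joint eigenspaces \<open>V\<^sub>A\<close>, on which \<open>E\<^sub>I\<close> is \<open>1\<close>
  if \<open>A \<subseteq> I\<close> and \<open>0\<close> otherwise. On \<open>V\<^sub>A\<close> the walk would be the up Laplacian \<open>L\<close> of a full simplex on
  \<open>{1..m} - A\<close>, which satisfies \<open>L\<^sup>2 = (m - |A|) L\<close> (lemma \<open>up_laplacian_square\<close>). As \<open>|A|\<close> ranges from \<open>0\<close>
  to \<open>i + 1\<close>, this gives the limit set.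

  The product formula does hold up to \<open>O(q\<^sup>-\<^sup>1\<^sup>/\<^sup>2)\<close> in operator norm (lemma \<open>E_E_close\<close>). All cases follow
  from one estimate, \<open>close_base\<close>, about points and lines of a projective space: two points lie on exactly
  one line and a line has \<open>q + 1\<close> points, so the walk from a point to a random line through it and on to a
  random point of that line forgets its start, except for a return probability of \<open>1/(q + 1)\<close>.

  An eigenvector is then split by approximate projections \<open>D A\<close> onto the \<open>V\<^sub>A\<close>, which forces its eigenvalue
  to be close to \<open>0\<close> or to some \<open>m - |A|\<close> (lemma \<open>eigenvalue_near_integer\<close>). Conversely, the indicator of one
  flag of type \<open>A\<close> lies almost in \<open>V\<^sub>A\<close> and yields an approximate eigenvector (lemma
  \<open>approximate_eigenvector\<close>); since the walk is self-adjoint, a true eigenvalue is nearby (lemma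
  \<open>eigenvalue_near_approximate_eigenvalue\<close>). The value \<open>0\<close> is always attained, because \<open>d d = 0\<close>.
\<close>

section \<open>Conditional expectations on complete flags\<close>

text \<open>Only the combinatorics of complete flags enters the analysis: a flag has exactly one member of each
  level \<open>1, \<dots>, m\<close>. For the building the level is the dimension.\<close>

locale flags =
  fixes \<Omega> :: "'v set set" and level :: "'v \<Rightarrow> nat" and m :: nat
  assumes finite_flags: "finite \<Omega>" and flags_nonempty: "\<Omega> \<noteq> {}"
    and level_bij: "c \<in> \<Omega> \<Longrightarrow> bij_betw level c {1..m}"
begin

definition part :: "nat set \<Rightarrow> 'v set \<Rightarrow> 'v set" where
  "part I c = {x \<in> c. level x \<in> I}"

definition cell :: "nat set \<Rightarrow> 'v set \<Rightarrow> 'v set set" where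
  "cell I c = {d \<in> \<Omega>. part I d = part I c}"

definition E :: "nat set \<Rightarrow> ('v set \<Rightarrow> real) \<Rightarrow> 'v set \<Rightarrow> real" where
  "E I \<phi> c = (\<Sum>d\<in>cell I c. \<phi> d) / card (cell I c)"

definition ip :: "('v set \<Rightarrow> real) \<Rightarrow> ('v set \<Rightarrow> real) \<Rightarrow> real" where
  "ip \<phi> \<psi> = (\<Sum>c\<in>\<Omega>. \<phi> c * \<psi> c)"

text \<open>Replacing the member at level \<open>a\<close> moves between adjacent flags. The walk that averages over \<open>cell I c\<close>
  and then makes such a move is described by the number of \<open>pairs\<close> that lead to each cell.\<close>

abbreviation adjacent :: "nat \<Rightarrow> 'v set \<Rightarrow> 'v set \<Rightarrow> bool" where
  "adjacent a x y \<equiv> part ({1..m} - {a}) y = part ({1..m} - {a}) x"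

abbreviation pairs :: "nat \<Rightarrow> nat set \<Rightarrow> 'v set \<Rightarrow> 'v set \<Rightarrow> ('v set \<times> 'v set) set" where
  "pairs a I c d \<equiv> {(x, y). x \<in> \<Omega> \<and> y \<in> \<Omega> \<and> part I x = part I c \<and> adjacent a x y \<and> part I y = part I d}"

abbreviation sources :: "nat \<Rightarrow> nat set \<Rightarrow> 'v set \<Rightarrow> 'v set \<Rightarrow> 'v set set" where
  "sources a I c d \<equiv> {x \<in> \<Omega>. part I x = part I c \<and> (\<exists>y\<in>\<Omega>. adjacent a x y \<and> part I y = part I d)}"

abbreviation nrm :: "('v set \<Rightarrow> real) \<Rightarrow> real" where
  "nrm \<phi> \<equiv> L2_set \<phi> \<Omega>"

definition depends_on :: "nat set \<Rightarrow> ('v set \<Rightarrow> real) \<Rightarrow> bool" where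
  "depends_on I \<phi> \<longleftrightarrow> (\<forall>c\<in>\<Omega>. \<forall>d\<in>\<Omega>. part I c = part I d \<longrightarrow> \<phi> c = \<phi> d)"

lemma part_part: "part I (part J c) = part (I \<inter> J) c"
  by (auto simp: part_def)

lemma part_eq_mono: "part J c = part J d \<Longrightarrow> I \<subseteq> J \<Longrightarrow> part I c = part I d"
  by (metis inf.absorb_iff1 part_part)

lemma finite_cell [simp]: "finite (cell I c)"
  using finite_flags by (auto simp: cell_def)

lemma self_in_cell: "c \<in> \<Omega> \<Longrightarrow> c \<in> cell I c"
  by (auto simp: cell_def)

lemma card_cell_pos: "c \<in> \<Omega> \<Longrightarrow> card (cell I c) > 0"
  using self_in_cell by (auto simp: card_gt_0_iff)

lemma cell_eq: "part I c = part I d \<Longrightarrow> cell I c = cell I d"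
  by (auto simp: cell_def)

lemma part_full: "c \<in> \<Omega> \<Longrightarrow> part {1..m} c = c"
  using level_bij by (fastforce simp: part_def bij_betw_def)

lemma nrm_eq_ip: "(nrm \<phi>)\<^sup>2 = ip \<phi> \<phi>"
  unfolding L2_set_def ip_def by (simp add: sum_nonneg power2_eq_square)

lemma nrm_nonneg [simp]: "0 \<le> nrm \<phi>"
  by (simp add: L2_set_nonneg)

lemma nrm_add: "nrm (\<lambda>c. \<phi> c + \<psi> c) \<le> nrm \<phi> + nrm \<psi>"
  by (rule L2_set_triangle_ineq)

lemma nrm_scale: "nrm (\<lambda>c. a * \<phi> c) = \<bar>a\<bar> * nrm \<phi>"
proof -
  have "(nrm (\<lambda>c. a * \<phi> c))\<^sup>2 = (\<bar>a\<bar> * nrm \<phi>)\<^sup>2"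
    unfolding power_mult_distrib nrm_eq_ip
    by (simp add: ip_def sum_distrib_left power2_eq_square ac_simps)
  then show ?thesis by (simp add: power2_eq_iff_nonneg)
qed

lemma nrm_cong: "(\<And>c. c \<in> \<Omega> \<Longrightarrow> \<phi> c = \<psi> c) \<Longrightarrow> nrm \<phi> = nrm \<psi>"
  by (rule L2_set_cong) auto

lemma nrm_diff_triangle: "nrm (\<lambda>c. \<phi> c - \<chi> c) \<le> nrm (\<lambda>c. \<phi> c - \<psi> c) + nrm (\<lambda>c. \<psi> c - \<chi> c)"
  using nrm_add[of "\<lambda>c. \<phi> c - \<psi> c" "\<lambda>c. \<psi> c - \<chi> c"] by simp

lemma nrm_zero [simp]: "nrm (\<lambda>c. 0) = 0"
  by (simp add: L2_set_def)

lemma nrm_sum_le: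
  fixes B :: real
  assumes "finite X" "\<And>t. t \<in> X \<Longrightarrow> \<bar>a t\<bar> \<le> 1" "\<And>t. t \<in> X \<Longrightarrow> nrm (\<phi> t) \<le> B"
  shows "nrm (\<lambda>c. \<Sum>t\<in>X. a t * \<phi> t c) \<le> card X * B"
  using assms
proof (induction X rule: finite_induct)
  case (insert t X)
  have "nrm (\<lambda>c. \<Sum>t\<in>insert t X. a t * \<phi> t c) = nrm (\<lambda>c. a t * \<phi> t c + (\<Sum>t\<in>X. a t * \<phi> t c))"
    using insert.hyps by simp
  also have "\<dots> \<le> nrm (\<lambda>c. a t * \<phi> t c) + nrm (\<lambda>c. \<Sum>t\<in>X. a t * \<phi> t c)"
    by (rule nrm_add)
  also have "nrm (\<lambda>c. a t * \<phi> t c) \<le> B"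
    using insert.prems[of t] mult_mono[of "\<bar>a t\<bar>" 1 "nrm (\<phi> t)" B] by (simp add: nrm_scale)
  finally show ?case using insert by (simp add: algebra_simps)
qed simp

lemma ip_Cauchy_Schwarz: "\<bar>ip \<phi> \<psi>\<bar> \<le> nrm \<phi> * nrm \<psi>"
proof -
  have "\<bar>ip \<phi> \<psi>\<bar> \<le> (\<Sum>c\<in>\<Omega>. \<bar>\<phi> c\<bar> * \<bar>\<psi> c\<bar>)"
    unfolding ip_def by (rule order.trans[OF sum_abs]) (simp add: abs_mult)
  also have "\<dots> \<le> nrm \<phi> * nrm \<psi>" by (rule L2_set_mult_ineq)
  finally show ?thesis .
qed

lemma ip_commute: "ip \<phi> \<psi> = ip \<psi> \<phi>"
  by (simp add: ip_def mult.commute)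

lemma ip_diff_left: "ip (\<lambda>c. \<phi> c - \<psi> c) \<chi> = ip \<phi> \<chi> - ip \<psi> \<chi>"
  by (simp add: ip_def algebra_simps sum_subtractf)

lemma ip_diff_right: "ip \<chi> (\<lambda>c. \<phi> c - \<psi> c) = ip \<chi> \<phi> - ip \<chi> \<psi>"
  by (simp add: ip_def algebra_simps sum_subtractf)

lemma ip_cong:
  "(\<And>c. c \<in> \<Omega> \<Longrightarrow> \<phi> c = \<phi>' c) \<Longrightarrow> (\<And>c. c \<in> \<Omega> \<Longrightarrow> \<psi> c = \<psi>' c) \<Longrightarrow> ip \<phi> \<psi> = ip \<phi>' \<psi>'"
  unfolding ip_def by (intro sum.cong refl arg_cong2[where f="(*)"]) auto

lemma depends_on_mono: "depends_on I \<phi> \<Longrightarrow> I \<subseteq> J \<Longrightarrow> depends_on J \<phi>"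
  using part_eq_mono unfolding depends_on_def by metis

lemma depends_on_E: "depends_on I (E I \<phi>)"
  unfolding depends_on_def E_def by (metis cell_eq)

lemma E_of_depends_on:
  assumes "depends_on I \<phi>" "c \<in> \<Omega>"
  shows "E I \<phi> c = \<phi> c"
proof -
  have "(\<Sum>d\<in>cell I c. \<phi> d) = (\<Sum>d\<in>cell I c. \<phi> c)"
  proof (rule sum.cong[OF refl])
    fix d assume "d \<in> cell I c"
    then have "d \<in> \<Omega>" "part I d = part I c" by (auto simp: cell_def)
    then show "\<phi> d = \<phi> c" using assms unfolding depends_on_def by blast
  qed
  then show ?thesis using card_cell_pos[OF assms(2), of I] by (auto simp: E_def card_gt_0_iff)
qed

lemma E_cong: "(\<And>c. c \<in> \<Omega> \<Longrightarrow> \<phi> c = \<psi> c) \<Longrightarrow> E I \<phi> c = E I \<psi> c"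
  unfolding E_def by (rule arg_cong[where f="\<lambda>x. x / _"], rule sum.cong) (auto simp: cell_def)

lemma E_diff: "E I (\<lambda>c. \<phi> c - \<psi> c) c = E I \<phi> c - E I \<psi> c"
  by (simp add: E_def sum_subtractf diff_divide_distrib)

lemma E_scale: "E I (\<lambda>c. a * \<phi> c) c = a * E I \<phi> c"
  by (simp add: E_def sum_distrib_left)

lemma E_sum: "E I (\<lambda>c. \<Sum>t\<in>X. \<phi> t c) c = (\<Sum>t\<in>X. E I (\<phi> t) c)"
  unfolding E_def sum_divide_distrib by (rule sum.swap)

lemma E_selfadjoint: "ip (E I \<phi>) \<psi> = ip \<phi> (E I \<psi>)"
proof -
  have *: "ip (E I \<phi>) \<psi> =
    (\<Sum>c\<in>\<Omega>. \<Sum>d\<in>\<Omega>. if part I d = part I c then \<phi> d * \<psi> c / card (cell I c) else 0)" for \<phi> \<psi>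
    unfolding ip_def
  proof (rule sum.cong[OF refl])
    fix c assume "c \<in> \<Omega>"
    have "E I \<phi> c * \<psi> c = (\<Sum>d\<in>cell I c. \<phi> d * \<psi> c / card (cell I c))"
      by (simp add: E_def sum_distrib_right sum_divide_distrib)
    also have "\<dots> = (\<Sum>d\<in>\<Omega>. if part I d = part I c then \<phi> d * \<psi> c / card (cell I c) else 0)"
      unfolding cell_def by (rule sum.inter_filter[OF finite_flags])
    finally show "E I \<phi> c * \<psi> c = \<dots>" .
  qed
  have "ip (E I \<phi>) \<psi> =
      (\<Sum>d\<in>\<Omega>. \<Sum>c\<in>\<Omega>. if part I d = part I c then \<phi> d * \<psi> c / card (cell I c) else 0)"
    unfolding * by (rule sum.swap)
  also have "\<dots> = (\<Sum>d\<in>\<Omega>. \<Sum>c\<in>\<Omega>. if part I c = part I d then \<psi> c * \<phi> d / card (cell I d) else 0)"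
  proof (intro sum.cong refl)
    fix d c :: "'v set"
    have "cell I d = cell I c" if "part I d = part I c" using that by (rule cell_eq)
    then show "(if part I d = part I c then \<phi> d * \<psi> c / card (cell I c) else 0)
        = (if part I c = part I d then \<psi> c * \<phi> d / card (cell I d) else 0)"
      by (simp add: mult.commute eq_commute[of "part I d"])
  qed
  also have "\<dots> = ip (E I \<psi>) \<phi>" by (simp add: *)
  finally show ?thesis by (simp add: ip_commute)
qed

text \<open>Averages over a cell are inner products with its indicator, which already depends on \<open>J\<close> only;
  self-adjointness of \<open>E J\<close> therefore removes \<open>E J\<close>.\<close>

lemma E_tower:
  assumes "I \<subseteq> J" "c \<in> \<Omega>"
  shows "E I (E J \<phi>) c = E I \<phi> c"
proof -
  define \<chi> :: "'v set \<Rightarrow> real" where "\<chi> d = of_bool (d \<in> cell I c)" for d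
  have E: "E I \<psi> c = ip \<psi> \<chi> / card (cell I c)" for \<psi>
  proof -
    have "ip \<psi> \<chi> = (\<Sum>d\<in>\<Omega>. if d \<in> cell I c then \<psi> d else 0)"
      unfolding ip_def \<chi>_def by (rule sum.cong) auto
    also have "\<dots> = (\<Sum>d\<in>cell I c. \<psi> d)"
      by (subst sum.inter_filter[OF finite_flags, symmetric]) (auto simp: cell_def intro: sum.cong)
    finally show ?thesis by (simp add: E_def)
  qed
  have "depends_on I \<chi>"
    unfolding depends_on_def \<chi>_def cell_def by auto
  then have "depends_on J \<chi>" using assms(1) depends_on_mono by blast
  then have "ip (E J \<phi>) \<chi> = ip \<phi> \<chi>"
    unfolding E_selfadjoint by (intro ip_cong) (auto simp: E_of_depends_on)
  then show ?thesis by (simp add: E)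
qed

lemma E_tower': "I \<subseteq> J \<Longrightarrow> c \<in> \<Omega> \<Longrightarrow> E J (E I \<phi>) c = E I \<phi> c"
  by (rule E_of_depends_on[OF depends_on_mono[OF depends_on_E]])

lemma ip_E_E: "ip (E I \<phi>) (E I \<phi>) = ip \<phi> (E I \<phi>)"
  unfolding E_selfadjoint by (rule ip_cong) (auto simp: E_tower)

lemma E_contraction: "nrm (E I \<phi>) \<le> nrm \<phi>"
proof -
  have "0 \<le> (nrm (\<lambda>c. \<phi> c - E I \<phi> c))\<^sup>2" by simp
  also have "\<dots> = (nrm \<phi>)\<^sup>2 - (nrm (E I \<phi>))\<^sup>2"
    unfolding nrm_eq_ip ip_diff_left ip_diff_right using ip_E_E[of I \<phi>]
    by (simp add: E_selfadjoint ip_commute)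
  finally have "(nrm (E I \<phi>))\<^sup>2 \<le> (nrm \<phi>)\<^sup>2" by simp
  then show ?thesis by (rule power2_le_imp_le) simp
qed

section \<open>Approximate equality of operators\<close>

text \<open>Distance in operator norm on \<open>L\<^sup>2(\<Omega>)\<close>; values outside \<open>\<Omega>\<close> are ignored.\<close>

definition close :: "real \<Rightarrow> (('v set \<Rightarrow> real) \<Rightarrow> 'v set \<Rightarrow> real) \<Rightarrow> (('v set \<Rightarrow> real) \<Rightarrow> 'v set \<Rightarrow> real) \<Rightarrow> bool" where
  "close \<epsilon> T S \<longleftrightarrow> (\<forall>\<phi>. nrm (\<lambda>c. T \<phi> c - S \<phi> c) \<le> \<epsilon> * nrm \<phi>)"

lemma close_exact: "(\<And>\<phi> c. c \<in> \<Omega> \<Longrightarrow> T \<phi> c = S \<phi> c) \<Longrightarrow> close 0 T S"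
  unfolding close_def by (subst nrm_cong[where \<psi>="\<lambda>c. 0"]) auto

lemma close_trans:
  assumes "close \<delta> T S" "close \<epsilon> S R"
  shows "close (\<delta> + \<epsilon>) T R"
  unfolding close_def
proof
  fix \<phi>
  have "nrm (\<lambda>c. T \<phi> c - R \<phi> c) \<le> nrm (\<lambda>c. T \<phi> c - S \<phi> c) + nrm (\<lambda>c. S \<phi> c - R \<phi> c)"
    by (rule nrm_diff_triangle)
  also have "\<dots> \<le> \<delta> * nrm \<phi> + \<epsilon> * nrm \<phi>"
    using assms by (intro add_mono) (simp_all add: close_def)
  finally show "nrm (\<lambda>c. T \<phi> c - R \<phi> c) \<le> (\<delta> + \<epsilon>) * nrm \<phi>"
    by (simp add: distrib_right)
qed

lemma close_sym: "close \<epsilon> T S \<Longrightarrow> close \<epsilon> S T"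
  using nrm_scale[of "-1"] unfolding close_def by (metis (no_types, lifting) abs_minus abs_one
    minus_diff_eq mult_1 mult_minus1 nrm_cong)

lemma close_weaken:
  assumes "close \<delta> T S" "\<delta> \<le> \<epsilon>"
  shows "close \<epsilon> T S"
  unfolding close_def
proof
  fix \<phi>
  have "nrm (\<lambda>c. T \<phi> c - S \<phi> c) \<le> \<delta> * nrm \<phi>" using assms(1) by (simp add: close_def)
  also have "\<dots> \<le> \<epsilon> * nrm \<phi>" using assms(2) by (simp add: mult_right_mono)
  finally show "nrm (\<lambda>c. T \<phi> c - S \<phi> c) \<le> \<epsilon> * nrm \<phi>" .
qed

lemma close_E_comp:
  assumes "close \<epsilon> T S"
  shows "close \<epsilon> (\<lambda>\<phi>. E I (T \<phi>)) (\<lambda>\<phi>. E I (S \<phi>))"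
  unfolding close_def E_diff[symmetric]
proof
  fix \<phi>
  show "nrm (E I (\<lambda>c. T \<phi> c - S \<phi> c)) \<le> \<epsilon> * nrm \<phi>"
    by (rule order.trans[OF E_contraction]) (use assms in \<open>simp add: close_def\<close>)
qed

lemma close_comp_E:
  assumes "0 \<le> \<epsilon>" "close \<epsilon> T S"
  shows "close \<epsilon> (\<lambda>\<phi>. T (E I \<phi>)) (\<lambda>\<phi>. S (E I \<phi>))"
  unfolding close_def
proof
  fix \<phi>
  have "nrm (\<lambda>c. T (E I \<phi>) c - S (E I \<phi>) c) \<le> \<epsilon> * nrm (E I \<phi>)"
    using assms(2) by (simp add: close_def)
  also have "\<dots> \<le> \<epsilon> * nrm \<phi>" by (rule mult_left_mono[OF E_contraction assms(1)])
  finally show "nrm (\<lambda>c. T (E I \<phi>) c - S (E I \<phi>) c) \<le> \<epsilon> * nrm \<phi>" .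
qed

lemma close_adjoint:
  assumes "close \<epsilon> T S" "0 \<le> \<epsilon>" "\<And>\<phi> \<psi>. ip (T \<phi>) \<psi> = ip \<phi> (T' \<psi>)" "\<And>\<phi> \<psi>. ip (S \<phi>) \<psi> = ip \<phi> (S' \<psi>)"
  shows "close \<epsilon> T' S'"
  unfolding close_def
proof
  fix \<phi>
  let ?\<psi> = "\<lambda>c. T' \<phi> c - S' \<phi> c"
  have "(nrm ?\<psi>)\<^sup>2 = ip (\<lambda>c. T ?\<psi> c - S ?\<psi> c) \<phi>"
    unfolding nrm_eq_ip ip_diff_left[of "T _" "S _"] assms(3,4) by (simp add: ip_diff_right)
  also have "\<dots> \<le> \<epsilon> * nrm ?\<psi> * nrm \<phi>"
  proof -
    have "ip (\<lambda>c. T ?\<psi> c - S ?\<psi> c) \<phi> \<le> nrm (\<lambda>c. T ?\<psi> c - S ?\<psi> c) * nrm \<phi>"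
      by (rule order.trans[OF abs_ge_self ip_Cauchy_Schwarz])
    also have "\<dots> \<le> \<epsilon> * nrm ?\<psi> * nrm \<phi>"
      by (rule mult_right_mono) (use assms(1) in \<open>simp_all add: close_def\<close>)
    finally show ?thesis .
  qed
  finally show "nrm ?\<psi> \<le> \<epsilon> * nrm \<phi>"
    by (cases "nrm ?\<psi> = 0") (use assms(2) nrm_nonneg[of ?\<psi>] in \<open>auto simp: power2_eq_square
      mult.commute mult.left_commute dest: mult_left_le_imp_le\<close>)
qed

end

section \<open>Averaging operators almost commute\<close>

text \<open>The properties of a building that the estimate uses. By \<open>thick\<close>, a member of a flag can be replaced in
  many ways. By \<open>join\<close>, if two flags differ at level \<open>a\<close>, then the flags that allow to replace one member by
  the other are those with a prescribed member at level \<open>a + 1\<close>: in the building it is the span.\<close>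

locale building_flags = flags +
  fixes q :: nat
  assumes q_pos: "0 < q"
    and card_cell_uniform: "I \<subseteq> {1..m} \<Longrightarrow> c \<in> \<Omega> \<Longrightarrow> d \<in> \<Omega> \<Longrightarrow> card (cell I c) = card (cell I d)"
    and thick: "a \<in> {1..m} \<Longrightarrow> c \<in> \<Omega> \<Longrightarrow> q \<le> card (cell ({1..m} - {a}) c)"
    and join: "a \<in> {1..m} \<Longrightarrow> a < m \<Longrightarrow> {1..a} \<subseteq> I \<Longrightarrow> I \<subseteq> {1..m} \<Longrightarrow> c \<in> \<Omega> \<Longrightarrow> d \<in> \<Omega> \<Longrightarrow>
      part (I - {a}) c = part (I - {a}) d \<Longrightarrow> part I c \<noteq> part I d \<Longrightarrow>
      \<exists>e\<in>\<Omega>. part I e = part I c \<and>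
        (\<forall>x\<in>\<Omega>. part I x = part I c \<longrightarrow>
          ((\<exists>y\<in>\<Omega>. adjacent a x y \<and> part I y = part I d) \<longleftrightarrow>
           part {a + 1} x = part {a + 1} e))"
begin

lemma part_insert_eq_iff:
  "part (insert a I) c = part (insert a I) d \<longleftrightarrow> part {a} c = part {a} d \<and> part I c = part I d"
proof
  assume "part (insert a I) c = part (insert a I) d"
  then show "part {a} c = part {a} d \<and> part I c = part I d"
    using part_eq_mono by blast
next
  have "part (insert a I) c = part {a} c \<union> part I c" for c by (auto simp: part_def)
  then show "part {a} c = part {a} d \<and> part I c = part I d \<Longrightarrow> part (insert a I) c = part (insert a I) d"
    by simp
qed

lemma flag_eqI:
  assumes "a \<in> {1..m}" "c \<in> \<Omega>" "d \<in> \<Omega>" "part {a} c = part {a} d" "part ({1..m} - {a}) c = part ({1..m} - {a}) d"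
  shows "c = d"
  using assms part_insert_eq_iff[of a "{1..m} - {a}" c d] part_full by (simp add: insert_absorb)

lemma pairs_card:
  assumes a: "a \<in> {1..m}" "a \<in> I" "I \<subseteq> {1..m}" and c: "c \<in> \<Omega>"
  shows "card (pairs a I c d) = card (sources a I c d)"
    (is "card ?P = card ?X")
proof -
  have "inj_on fst ?P"
  proof (rule inj_onI)
    fix p p' assume p: "p \<in> ?P" "p' \<in> ?P" "fst p = fst p'"
    obtain x y y' where eq: "p = (x, y)" "p' = (x, y')" using p(3) by (metis prod.collapse)
    have y: "y \<in> \<Omega>" "y' \<in> \<Omega>" "part I y = part I d" "part I y' = part I d"
      "adjacent a x y" "adjacent a x y'"
      using p(1,2) unfolding eq mem_Collect_eq case_prod_conv by simp_all
    have "part {a} y = part {a} y'" using y(3,4) a(2) part_eq_mono[of I y y' "{a}"] by simp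
    then have "y = y'" using flag_eqI[OF a(1) y(1,2)] y(5,6) by simp
    then show "p = p'" by (simp add: eq)
  qed
  moreover have "fst ` ?P = ?X"
  proof (intro equalityI subsetI)
    fix x assume "x \<in> fst ` ?P"
    then obtain p where p: "p \<in> ?P" "x = fst p" by (rule imageE)
    obtain x' y where eq: "p = (x', y)" by (cases p)
    have "x' = x" using p(2) by (simp only: eq fst_conv)
    with p(1) have "x \<in> \<Omega> \<and> y \<in> \<Omega> \<and> part I x = part I c \<and>
            adjacent a x y \<and> part I y = part I d"
      unfolding eq mem_Collect_eq case_prod_conv by (simp only:)
    then show "x \<in> ?X" unfolding mem_Collect_eq by (elim conjE, intro conjI bexI[of _ y])
  next
    fix x assume "x \<in> ?X"
    then obtain y where "x \<in> \<Omega> \<and> y \<in> \<Omega> \<and> part I x = part I c \<and>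
            adjacent a x y \<and> part I y = part I d"
      unfolding mem_Collect_eq by (elim conjE bexE) (rule that, intro conjI)
    then have "(x, y) \<in> ?P" unfolding mem_Collect_eq case_prod_conv .
    then show "x \<in> fst ` ?P" by (rule image_eqI[rotated]) (rule fst_conv[symmetric])
  qed
  ultimately show ?thesis using card_image[of fst ?P] by metis
qed

lemma pairs_card_same:
  assumes a: "a \<in> {1..m}" "a \<in> I" "I \<subseteq> {1..m}" and c: "c \<in> \<Omega>" "part I d = part I c"
  shows "card (pairs a I c d) = card (cell I c)"
proof -
  have "sources a I c d = cell I c"
    unfolding cell_def c(2) by (rule Collect_cong) metis
  then show ?thesis using pairs_card[OF a c(1), of d] by (simp only:)
qed

lemma pairs_card_other:
  assumes a: "a \<in> {1..m}" "a < m" "{1..a} \<subseteq> I" "I \<subseteq> {1..m}" and c: "c \<in> \<Omega>" "d \<in> \<Omega>"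
    "part (I - {a}) c = part (I - {a}) d" "part I c \<noteq> part I d"
  shows "card (pairs a I c d) = card (cell (insert (a + 1) I) c)"
proof -
  have "a \<in> I" using a by auto
  from join[OF a c] obtain e where e: "e \<in> \<Omega>" "part I e = part I c \<and>
    (\<forall>x\<in>\<Omega>. part I x = part I c \<longrightarrow>
       ((\<exists>y\<in>\<Omega>. adjacent a x y \<and> part I y = part I d) \<longleftrightarrow>
        part {a + 1} x = part {a + 1} e))" by (rule bexE)
  have "sources a I c d
      = cell (insert (a + 1) I) e"
    unfolding cell_def part_insert_eq_iff[of "a + 1" I]
    using conjunct1[OF e(2)] conjunct2[OF e(2), rule_format] by (intro Collect_cong) metis
  moreover have "card (cell (insert (a + 1) I) e) = card (cell (insert (a + 1) I) c)"
    using a c e(1) by (intro card_cell_uniform) auto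
  ultimately show ?thesis using pairs_card[OF a(1) \<open>a \<in> I\<close> a(4) c(1)] by simp
qed

text \<open>This is the count in a block design. Expand the double sum into terms \<open>u z\<close> with multiplicity the number
  of pairs ending in the cell of \<open>z\<close>. The multiplicity takes one value on the cell of \<open>c\<close>, another on
  the other cells that agree with \<open>c\<close> on \<open>I - {a}\<close>, and is zero elsewhere. The second value contributes a
  multiple of a sum of \<open>u\<close> that vanishes by the assumption on the mean.\<close>

lemma sum_over_neighbours:
  assumes a: "a \<in> {1..m}" "a < m" "{1..a} \<subseteq> I" "I \<subseteq> {1..m}" and c: "c \<in> \<Omega>"
    and u: "depends_on I u" "E (I - {a}) u c = 0"
  shows "(\<Sum>x\<in>cell I c. \<Sum>y\<in>cell ({1..m} - {a}) x. u y) =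
    (real (card (cell I c)) - real (card (cell (insert (a + 1) I) c))) * u c"
proof -
  define w where "w = real (card (cell I c))"
  define w' where "w' = real (card (cell (insert (a + 1) I) c))"
  define P where "P z = pairs a I c z" for z
  define R where "R = {(x, y). x \<in> \<Omega> \<and> y \<in> \<Omega> \<and> part I x = part I c \<and>
            adjacent a x y}"
  have aI: "a \<in> I" using a by auto
  have fin: "finite R" by (rule finite_subset[of _ "\<Omega> \<times> \<Omega>"]) (auto simp: R_def finite_flags)
  have w0: "w \<noteq> 0" using card_cell_pos[OF c] by (auto simp: w_def card_gt_0_iff)
  have cellsum: "(\<Sum>z\<in>cell I y. u z) = w * u y" if "y \<in> \<Omega>" for y
  proof -
    have "(\<Sum>z\<in>cell I y. u z) = E I u y * card (cell I y)"
      using card_cell_pos[OF that, of I] by (auto simp: E_def card_gt_0_iff)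
    then show ?thesis
      using E_of_depends_on[OF u(1) that] card_cell_uniform[OF a(4) that c] by (simp add: w_def)
  qed
  have N: "real (card (P z)) = (if part I z = part I c then w else
      if part (I - {a}) z = part (I - {a}) c then w' else 0)" if z: "z \<in> \<Omega>" for z
  proof -
    have "P z = {}" if "part (I - {a}) z \<noteq> part (I - {a}) c"
    proof (rule ccontr)
      assume "P z \<noteq> {}"
      then obtain x y where xy: "part I x = part I c" "part I y = part I z"
          "adjacent a x y" by (auto simp: P_def)
      have "part (I - {a}) y = part (I - {a}) x"
        using xy(3) a(4) part_eq_mono[of "{1..m} - {a}" y x "I - {a}"] by blast
      then show False using that xy(1,2) part_eq_mono[of I _ _ "I - {a}"] by (metis Diff_subset)
    qed
    moreover have "card (P z) = card (cell I c)" if "part I z = part I c"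
      unfolding P_def by (rule pairs_card_same[OF a(1) aI a(4) c that])
    moreover have "card (P z) = card (cell (insert (a + 1) I) c)"
      if "part I z \<noteq> part I c" "part (I - {a}) z = part (I - {a}) c"
      unfolding P_def by (rule pairs_card_other[OF a c z]) (use that in auto)
    ultimately show ?thesis unfolding w_def w'_def by (simp split: if_split)
  qed
  have "w * (\<Sum>x\<in>cell I c. \<Sum>y\<in>cell ({1..m} - {a}) x. u y)
      = (\<Sum>(x, y)\<in>R. w * u y)"
  proof -
    have R: "R = Sigma (cell I c) (\<lambda>x. cell ({1..m} - {a}) x)"
      by (auto simp: R_def cell_def)
    show ?thesis unfolding R sum_distrib_left
      by (subst sum.Sigma) auto
  qed
  also have "\<dots> = (\<Sum>(x, y)\<in>R. \<Sum>z\<in>\<Omega>. if part I z = part I y then u z else 0)"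
  proof (rule sum.cong[OF refl], clarify)
    fix x y assume "(x, y) \<in> R"
    then have "y \<in> \<Omega>" by (simp add: R_def)
    have "(\<Sum>z\<in>\<Omega>. if part I z = part I y then u z else 0) = (\<Sum>z\<in>cell I y. u z)"
      unfolding cell_def by (rule sum.inter_filter[OF finite_flags, symmetric])
    then show "w * u y = (\<Sum>z\<in>\<Omega>. if part I z = part I y then u z else 0)"
      using cellsum[OF \<open>y \<in> \<Omega>\<close>] by simp
  qed
  also have "\<dots> = (\<Sum>z\<in>\<Omega>. \<Sum>p\<in>R. if part I z = part I (snd p) then u z else 0)"
    unfolding case_prod_unfold by (rule sum.swap)
  also have "\<dots> = (\<Sum>z\<in>\<Omega>. u z * card (P z))"
  proof (rule sum.cong[OF refl])
    fix z
    have "P z = {p \<in> R. part I z = part I (snd p)}" by (auto simp: P_def R_def)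
    then have "u z * card (P z) = (\<Sum>p\<in>{p \<in> R. part I z = part I (snd p)}. u z)" by simp
    also have "\<dots> = (\<Sum>p\<in>R. if part I z = part I (snd p) then u z else 0)"
      by (rule sum.inter_filter[OF fin])
    finally show "(\<Sum>p\<in>R. if part I z = part I (snd p) then u z else 0) = u z * card (P z)" by simp
  qed
  also have "\<dots> = (\<Sum>z\<in>\<Omega>. (if part I z = part I c then (w - w') * u z else 0) +
      (if part (I - {a}) z = part (I - {a}) c then w' * u z else 0))"
  proof (rule sum.cong[OF refl])
    fix z assume "z \<in> \<Omega>"
    moreover have "part (I - {a}) z = part (I - {a}) c" if "part I z = part I c"
      using that part_eq_mono by blast
    ultimately show "u z * card (P z) = (if part I z = part I c then (w - w') * u z else 0) +
      (if part (I - {a}) z = part (I - {a}) c then w' * u z else 0)"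
      by (auto simp: N algebra_simps)
  qed
  also have "\<dots> = (\<Sum>z\<in>cell I c. (w - w') * u z) + (\<Sum>z\<in>cell (I - {a}) c. w' * u z)"
    unfolding sum.distrib cell_def by (simp only: sum.inter_filter[OF finite_flags])
  also have "\<dots> = (w - w') * (w * u c)"
  proof -
    have "(\<Sum>z\<in>cell (I - {a}) c. u z) = 0"
      using u(2) card_cell_pos[OF c, of "I - {a}"] by (auto simp: E_def card_gt_0_iff)
    then show ?thesis by (simp add: sum_distrib_left[symmetric] cellsum[OF c])
  qed
  finally show ?thesis using w0 by (simp add: w_def w'_def)
qed

text \<open>By self-adjointness the squared norm on the left is \<open>\<langle>u, E I (E ({1..m} - {a}) u)\<rangle>\<close>, and the operator
  applied to \<open>u\<close> there is multiplication by a number of size at most \<open>1/q\<close> on functions of mean zero.\<close>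

lemma nrm_E_neighbours_le:
  assumes a: "a \<in> {1..m}" "a < m" "{1..a} \<subseteq> I" "I \<subseteq> {1..m}"
    and u: "depends_on I u" "\<And>c. c \<in> \<Omega> \<Longrightarrow> E (I - {a}) u c = 0"
  shows "q * (nrm (E ({1..m} - {a}) u))\<^sup>2 \<le> (nrm u)\<^sup>2"
proof -
  let ?F = "E ({1..m} - {a})"
  obtain c0 where c0: "c0 \<in> \<Omega>" using flags_nonempty by blast
  define k where "k = card (cell ({1..m} - {a}) c0)"
  have k: "card (cell ({1..m} - {a}) c) = k" if "c \<in> \<Omega>" for c
    unfolding k_def using that c0 by (intro card_cell_uniform) auto
  have qk: "q \<le> k" unfolding k_def by (rule thick[OF a(1) c0])
  then have k0: "real k \<noteq> 0" using q_pos by simp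
  have EE: "k * (u c * E I (?F u) c) \<le> u c * u c" if c: "c \<in> \<Omega>" for c
  proof -
    have "E I (?F u) c = (\<Sum>x\<in>cell I c. (\<Sum>y\<in>cell ({1..m} - {a}) x. u y) / k) / card (cell I c)"
      unfolding E_def[of I]
    proof (rule arg_cong[where f="\<lambda>x. x / _"], rule sum.cong[OF refl])
      fix x assume "x \<in> cell I c"
      then have "x \<in> \<Omega>" by (simp add: cell_def)
      then show "?F u x = (\<Sum>y\<in>cell ({1..m} - {a}) x. u y) / k" unfolding E_def by (simp only: k)
    qed
    also have "\<dots> = (\<Sum>x\<in>cell I c. \<Sum>y\<in>cell ({1..m} - {a}) x. u y) / k / card (cell I c)"
      by (simp add: sum_divide_distrib)
    also have "\<dots> = (real (card (cell I c)) - real (card (cell (insert (a + 1) I) c))) * u c / k / card (cell I c)"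
      by (simp only: sum_over_neighbours[OF a c u(1) u(2)[OF c]])
    finally have "k * (u c * E I (?F u) c) =
       ((real (card (cell I c)) - real (card (cell (insert (a + 1) I) c))) / card (cell I c)) * (u c * u c)"
      using k0 by simp
    also have "\<dots> \<le> 1 * (u c * u c)"
      by (intro mult_right_mono) (auto simp: divide_le_eq_1)
    finally show ?thesis by simp
  qed
  have "(nrm (?F u))\<^sup>2 = ip u (?F u)" unfolding nrm_eq_ip by (rule ip_E_E)
  also have "\<dots> = ip (E I u) (?F u)" by (rule ip_cong) (auto simp: E_of_depends_on[OF u(1)])
  also have "\<dots> = ip u (E I (?F u))" by (rule E_selfadjoint)
  finally have "k * (nrm (?F u))\<^sup>2 = (\<Sum>c\<in>\<Omega>. k * (u c * E I (?F u) c))"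
    by (simp add: ip_def sum_distrib_left)
  also have "\<dots> \<le> (\<Sum>c\<in>\<Omega>. u c * u c)" by (rule sum_mono[OF EE])
  also have "\<dots> = (nrm u)\<^sup>2" by (simp add: nrm_eq_ip ip_def)
  finally have "k * (nrm (?F u))\<^sup>2 \<le> (nrm u)\<^sup>2" .
  moreover have "q * (nrm (?F u))\<^sup>2 \<le> k * (nrm (?F u))\<^sup>2" using qk by (simp add: mult_right_mono)
  ultimately show ?thesis by linarith
qed

text \<open>The error in the basic estimate; its square is the bound \<open>1/q\<close> for the return probability.\<close>

definition \<eta> :: real where "\<eta> = 1 / sqrt q"

lemma eta_pos: "\<eta> > 0"
  using q_pos by (simp add: \<eta>_def)

text \<open>Subtracting the mean \<open>E (I - {a})\<close>, which both operators preserve, leaves a function of mean zero. At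
  the top level \<open>a = m\<close> there is no level \<open>a + 1\<close>, but then \<open>I\<close> is everything and equality is exact.\<close>

lemma close_base:
  assumes a: "a \<in> {1..m}" "{1..a} \<subseteq> I" "I \<subseteq> {1..m}"
  shows "close \<eta> (\<lambda>\<phi>. E ({1..m} - {a}) (E I \<phi>)) (E (I - {a}))"
proof (cases "a < m")
  case False
  then have I: "I = {1..m}" using a by auto
  have "close 0 (\<lambda>\<phi>. E ({1..m} - {a}) (E I \<phi>)) (E (I - {a}))"
    by (rule close_exact) (simp add: I E_tower)
  then show ?thesis using eta_pos close_weaken by fastforce
next
  case True
  let ?F = "E ({1..m} - {a})"
  show ?thesis unfolding close_def
  proof
    fix \<phi>
    define u where "u c = E I \<phi> c - E (I - {a}) \<phi> c" for c
    have dep: "depends_on I u" unfolding u_def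
      using depends_on_E[of I \<phi>] depends_on_mono[OF depends_on_E[of "I - {a}" \<phi>], of I]
      unfolding depends_on_def by (metis Diff_subset)
    have mean: "E (I - {a}) u c = 0" if "c \<in> \<Omega>" for c
    proof -
      have "E (I - {a}) (E I \<phi>) c = E (I - {a}) \<phi> c" by (rule E_tower) (use that in auto)
      moreover have "E (I - {a}) (E (I - {a}) \<phi>) c = E (I - {a}) \<phi> c" by (rule E_tower) (use that in auto)
      ultimately show ?thesis unfolding u_def E_diff by simp
    qed
    have "(nrm u)\<^sup>2 = ip (E I \<phi>) (E I \<phi>) - ip (E (I - {a}) \<phi>) (E (I - {a}) \<phi>)"
    proof -
      have "ip (E I \<phi>) (E (I - {a}) \<phi>) = ip \<phi> (E (I - {a}) \<phi>)"
        unfolding E_selfadjoint by (rule ip_cong) (auto simp: E_tower')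
      then have "ip (E I \<phi>) (E (I - {a}) \<phi>) = ip (E (I - {a}) \<phi>) (E (I - {a}) \<phi>)"
        by (simp add: ip_E_E)
      then show ?thesis
        unfolding nrm_eq_ip u_def ip_diff_left ip_diff_right by (simp add: ip_commute)
    qed
    then have "(nrm u)\<^sup>2 \<le> (nrm (E I \<phi>))\<^sup>2" unfolding nrm_eq_ip[symmetric] by simp
    then have "nrm u \<le> nrm (E I \<phi>)" by (rule power2_le_imp_le) simp
    then have u_le: "nrm u \<le> nrm \<phi>" by (rule order.trans[OF _ E_contraction])
    have "real q * (nrm (?F u))\<^sup>2 \<le> (nrm u)\<^sup>2"
      by (rule nrm_E_neighbours_le[OF a(1) True a(2,3) dep mean])
    also have "\<dots> \<le> (nrm \<phi>)\<^sup>2" using u_le by (simp add: power_mono)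
    finally have "(nrm (?F u))\<^sup>2 \<le> (\<eta> * nrm \<phi>)\<^sup>2"
      using q_pos by (simp add: \<eta>_def power_mult_distrib power_divide field_simps)
    then have "nrm (?F u) \<le> \<eta> * nrm \<phi>"
      by (rule power2_le_imp_le) (use eta_pos in simp)
    moreover have "nrm (?F u) = nrm (\<lambda>c. ?F (E I \<phi>) c - E (I - {a}) \<phi> c)"
    proof (rule nrm_cong)
      fix c assume "c \<in> \<Omega>"
      then have "?F (E (I - {a}) \<phi>) c = E (I - {a}) \<phi> c"
        by (intro E_tower') (use a in auto)
      then show "?F u c = ?F (E I \<phi>) c - E (I - {a}) \<phi> c" unfolding u_def E_diff by simp
    qed
    ultimately show "nrm (\<lambda>c. ?F (E I \<phi>) c - E (I - {a}) \<phi> c) \<le> \<eta> * nrm \<phi>" by simp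
  qed
qed

text \<open>Indexed by the levels that are averaged out, so that composition corresponds to union.\<close>

definition forget :: "nat set \<Rightarrow> ('a set \<Rightarrow> real) \<Rightarrow> 'a set \<Rightarrow> real" where
  "forget S = E ({1..m} - S)"

lemma forget_base:
  assumes "a \<in> {1..m}" "S \<subseteq> {1..m}" "\<And>s. s \<in> S \<Longrightarrow> a < s"
  shows "close \<eta> (\<lambda>\<phi>. forget {a} (forget S \<phi>)) (forget (insert a S))"
proof -
  have "{1..m} - insert a S = ({1..m} - S) - {a}" by auto
  moreover have "{1..a} \<subseteq> {1..m} - S" using assms by fastforce
  ultimately show ?thesis using close_base[of a "{1..m} - S"] assms(1) by (simp add: forget_def)
qed

lemma forget_comp: "close \<epsilon> T S \<Longrightarrow> close \<epsilon> (\<lambda>\<phi>. forget X (T \<phi>)) (\<lambda>\<phi>. forget X (S \<phi>))"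
  unfolding forget_def by (rule close_E_comp)

lemma comp_forget: "0 \<le> \<epsilon> \<Longrightarrow> close \<epsilon> T S \<Longrightarrow> close \<epsilon> (\<lambda>\<phi>. T (forget X \<phi>)) (\<lambda>\<phi>. S (forget X \<phi>))"
  unfolding forget_def by (rule close_comp_E)

text \<open>For \<open>s < t\<close> the basic estimate identifies one product with \<open>forget {s, t}\<close>; passing to adjoints
  identifies the other product with the same operator.\<close>

lemma forget_commute:
  assumes "s \<in> {1..m}" "t \<in> {1..m}"
  shows "close (2 * \<eta>) (\<lambda>\<phi>. forget {s} (forget {t} \<phi>)) (\<lambda>\<phi>. forget {t} (forget {s} \<phi>))"
proof -
  have less: "close (2 * \<eta>) (\<lambda>\<phi>. forget {s} (forget {t} \<phi>)) (\<lambda>\<phi>. forget {t} (forget {s} \<phi>))"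
    if "s \<in> {1..m}" "t \<in> {1..m}" "s < t" for s t
  proof -
    have 1: "close \<eta> (\<lambda>\<phi>. forget {s} (forget {t} \<phi>)) (forget {s, t})" using that by (intro forget_base) auto
    have 2: "close \<eta> (\<lambda>\<phi>. forget {t} (forget {s} \<phi>)) (forget {s, t})"
      by (rule close_adjoint[OF 1]) (use eta_pos in \<open>auto simp: forget_def E_selfadjoint\<close>)
    show ?thesis using close_trans[OF 1 close_sym[OF 2]] by simp
  qed
  show ?thesis
  proof (cases s t rule: linorder_cases)
    case equal
    then show ?thesis
      using close_weaken[OF close_exact[of "\<lambda>\<phi>. forget {s} (forget {t} \<phi>)" "\<lambda>\<phi>. forget {t} (forget {s} \<phi>)"]] eta_pos by simp
  next
    case greater
    then show ?thesis using close_sym[OF less] assms by blast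
  qed (use less assms in blast)
qed

text \<open>Induction on \<open>S\<close> by adding a new smallest level \<open>s\<close>: the basic estimate peels off \<open>s\<close>, and if \<open>a > s\<close> the
  operator \<open>forget {a}\<close> is moved past \<open>forget {s}\<close>.\<close>

lemma forget_singleton_forget:
  assumes "S \<subseteq> {1..m}" "a \<in> {1..m}"
  shows "close (4 * card S * \<eta>) (\<lambda>\<phi>. forget {a} (forget S \<phi>)) (forget (insert a S))"
proof -
  have "finite S" using assms(1) finite_subset by blast
  then show ?thesis using assms(1)
  proof (induction rule: finite_linorder_min_induct)
    case empty
    show ?case using assms(2) close_exact by (auto simp: forget_def E_tower)
  next
    case (insert s S)
    have fin: "finite S" and nin: "s \<notin> S" using insert.hyps by auto
    have "1 \<le> card (insert s S)" using fin by (simp add: card_gt_0_iff Suc_le_eq)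
    then have card1: "1 \<le> real (card (insert s S))" by simp
    have eta: "\<eta> \<le> 4 * card (insert s S) * \<eta>" "0 \<le> 4 * card (insert s S) * \<eta>"
      using eta_pos card1 by simp_all
    show ?case
    proof (cases a s rule: linorder_cases)
      case less
      then have "close \<eta> (\<lambda>\<phi>. forget {a} (forget (insert s S) \<phi>)) (forget (insert a (insert s S)))"
        using assms(2) insert.prems insert.hyps by (intro forget_base) fastforce+
      then show ?thesis using eta(1) close_weaken by blast
    next
      case equal
      then have "close 0 (\<lambda>\<phi>. forget {a} (forget (insert s S) \<phi>)) (forget (insert a (insert s S)))"
        by (intro close_exact) (auto simp: forget_def intro!: E_tower')
      then show ?thesis using eta(2) close_weaken by blast
    next
      case greater
      have S: "S \<subseteq> {1..m}" "s \<in> {1..m}" using insert.prems by auto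
      have b: "close \<eta> (\<lambda>\<phi>. forget {s} (forget S \<phi>)) (forget (insert s S))"
        using S insert.hyps by (intro forget_base) auto
      have 1: "close \<eta> (\<lambda>\<phi>. forget {a} (forget (insert s S) \<phi>)) (\<lambda>\<phi>. forget {a} (forget {s} (forget S \<phi>)))"
        by (rule forget_comp[OF close_sym[OF b]])
      have 2: "close (2 * \<eta>) (\<lambda>\<phi>. forget {a} (forget {s} (forget S \<phi>))) (\<lambda>\<phi>. forget {s} (forget {a} (forget S \<phi>)))"
        using comp_forget[OF _ forget_commute[OF assms(2) S(2)]] eta_pos by simp
      have 3: "close (4 * card S * \<eta>) (\<lambda>\<phi>. forget {s} (forget {a} (forget S \<phi>))) (\<lambda>\<phi>. forget {s} (forget (insert a S) \<phi>))"
        by (rule forget_comp[OF insert.IH[OF S(1)]])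
      have 4: "close \<eta> (\<lambda>\<phi>. forget {s} (forget (insert a S) \<phi>)) (forget (insert s (insert a S)))"
        using S insert.hyps greater assms(2) by (intro forget_base) auto
      have "close (\<eta> + 2 * \<eta> + 4 * card S * \<eta> + \<eta>) (\<lambda>\<phi>. forget {a} (forget (insert s S) \<phi>)) (forget (insert s (insert a S)))"
        using close_trans[OF close_trans[OF close_trans[OF 1 2] 3] 4] .
      moreover have "\<eta> + 2 * \<eta> + 4 * card S * \<eta> + \<eta> = 4 * card (insert s S) * \<eta>"
        using fin nin by (simp add: algebra_simps)
      ultimately show ?thesis by (simp add: insert_commute)
    qed
  qed
qed

lemma forget_forget:
  assumes "S \<subseteq> {1..m}" "T \<subseteq> {1..m}"
  shows "close (card S * (4 * m + 1) * \<eta>) (\<lambda>\<phi>. forget S (forget T \<phi>)) (forget (S \<union> T))"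
proof -
  have "finite S" using assms(1) finite_subset by blast
  then show ?thesis using assms(1)
  proof (induction rule: finite_linorder_min_induct)
    case empty
    show ?case using assms(2) close_exact[of "\<lambda>\<phi>. forget {} (forget T \<phi>)" "forget T"] by (auto simp: forget_def E_tower')
  next
    case (insert s S)
    have S: "S \<subseteq> {1..m}" "s \<in> {1..m}" using insert.prems by auto
    have fin: "finite S" and nin: "s \<notin> S" using insert.hyps by auto
    have 1: "close \<eta> (\<lambda>\<phi>. forget (insert s S) (forget T \<phi>)) (\<lambda>\<phi>. forget {s} (forget S (forget T \<phi>)))"
      by (rule comp_forget[OF _ close_sym[OF forget_base]]) (use S insert.hyps eta_pos in auto)
    have 2: "close (card S * (4 * m + 1) * \<eta>) (\<lambda>\<phi>. forget {s} (forget S (forget T \<phi>))) (\<lambda>\<phi>. forget {s} (forget (S \<union> T) \<phi>))"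
      by (rule forget_comp[OF insert.IH[OF S(1)]])
    have "card (S \<union> T) \<le> card {1..m}" using S assms(2) by (intro card_mono) auto
    then have c: "4 * card (S \<union> T) * \<eta> \<le> 4 * m * \<eta>" using eta_pos by simp
    have 3: "close (4 * m * \<eta>) (\<lambda>\<phi>. forget {s} (forget (S \<union> T) \<phi>)) (forget (insert s (S \<union> T)))"
      by (rule close_weaken[OF forget_singleton_forget c]) (use S assms(2) in auto)
    have "close (\<eta> + card S * (4 * m + 1) * \<eta> + 4 * m * \<eta>) (\<lambda>\<phi>. forget (insert s S) (forget T \<phi>)) (forget (insert s (S \<union> T)))"
      using close_trans[OF close_trans[OF 1 2] 3] .
    moreover have "\<eta> + card S * (4 * m + 1) * \<eta> + 4 * m * \<eta> = card (insert s S) * (4 * m + 1) * \<eta>"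
      using fin nin by (simp add: algebra_simps)
    ultimately show ?case by simp
  qed
qed

text \<open>The total error of a product of averages; for fixed \<open>m\<close> it is \<open>O(q\<^sup>-\<^sup>1\<^sup>/\<^sup>2)\<close>.\<close>

definition \<theta> :: real where "\<theta> = m * (4 * m + 1) * \<eta>"

lemma theta_nonneg: "0 \<le> \<theta>"
  using eta_pos by (simp add: \<theta>_def)

lemma E_E_close:
  assumes "I \<subseteq> {1..m}" "J \<subseteq> {1..m}"
  shows "close \<theta> (\<lambda>\<phi>. E I (E J \<phi>)) (E (I \<inter> J))"
proof -
  have *: "{1..m} - ({1..m} - I) = I" if "I \<subseteq> {1..m}" for I using that by auto
  have "{1..m} - (({1..m} - I) \<union> ({1..m} - J)) = I \<inter> J" using assms by auto
  then have "close (card ({1..m} - I) * (4 * m + 1) * \<eta>) (\<lambda>\<phi>. E I (E J \<phi>)) (E (I \<inter> J))"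
    using forget_forget[of "{1..m} - I" "{1..m} - J"] unfolding forget_def *[OF assms(1)] *[OF assms(2)] by simp
  moreover have "card ({1..m} - I) * (4 * m + 1) * \<eta> \<le> \<theta>"
  proof -
    have "card ({1..m} - I) \<le> m" using card_mono[of "{1..m}" "{1..m} - I"] by simp
    then have "card ({1..m} - I) * (4 * m + 1) \<le> m * (4 * m + 1)" by (rule mult_le_mono1)
    then have "real (card ({1..m} - I) * (4 * m + 1)) \<le> real (m * (4 * m + 1))"
      by (simp only: of_nat_le_iff)
    from mult_right_mono[OF this, of \<eta>] show ?thesis
      unfolding \<theta>_def using eta_pos by simp
  qed
  ultimately show ?thesis using close_weaken by blast
qed

end

section \<open>The up Laplacian of a full simplex\<close>

text \<open>The sign with which \<open>I\<close> occurs in the boundary of \<open>insert t I\<close>.\<close>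

definition incidence :: "nat \<Rightarrow> nat set \<Rightarrow> real" where
  "incidence t I = (-1) ^ card {u \<in> I. u < t}"

text \<open>The coboundary of the full simplex, restricted to faces that contain \<open>A\<close> (it never removes an element of
  \<open>A\<close>); \<open>d_down M\<close> is its adjoint.\<close>

definition d_up :: "nat set \<Rightarrow> (nat set \<Rightarrow> real) \<Rightarrow> nat set \<Rightarrow> real" where
  "d_up A x T = (\<Sum>t\<in>T - A. incidence t (T - {t}) * x (T - {t}))"

definition d_down :: "nat set \<Rightarrow> (nat set \<Rightarrow> real) \<Rightarrow> nat set \<Rightarrow> real" where
  "d_down M y I = (\<Sum>t\<in>M - I. incidence t I * y (insert t I))"

lemma d_up_cong:
  "(\<And>t. t \<in> T - A \<Longrightarrow> x (T - {t}) = y (T - {t})) \<Longrightarrow> d_up A x T = d_up A y T"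
  unfolding d_up_def by (rule sum.cong) auto

lemma d_down_cong:
  "(\<And>t. t \<in> M - I \<Longrightarrow> x (insert t I) = y (insert t I)) \<Longrightarrow> d_down M x I = d_down M y I"
  unfolding d_down_def by (rule sum.cong) auto

lemma incidence_square [simp]: "incidence t I * incidence t I = 1"
  by (simp add: incidence_def flip: power_add)

lemma abs_incidence [simp]: "\<bar>incidence t I\<bar> = 1"
  by (simp add: incidence_def power_abs)

lemma incidence_insert:
  assumes "finite I" "u \<notin> I"
  shows "incidence t (insert u I) = (if u < t then - incidence t I else incidence t I)"
proof (cases "u < t")
  case True
  then have "{v \<in> insert u I. v < t} = insert u {v \<in> I. v < t}" by auto
  then show ?thesis using True assms by (simp add: incidence_def)
next
  case False
  then have "{v \<in> insert u I. v < t} = {v \<in> I. v < t}" by auto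
  then show ?thesis using False by (simp add: incidence_def)
qed

lemma incidence_swap:
  assumes "finite B" "t \<notin> B" "u \<notin> B" "t \<noteq> u"
  shows "incidence t (insert u B) * incidence u B = - (incidence u (insert t B) * incidence t B)"
  using assms by (auto simp: incidence_insert)

lemma incidence_cross:
  assumes "finite B" "t \<notin> B" "u \<notin> B" "t \<noteq> u"
  shows "incidence t B * incidence u B = - (incidence u (insert t B) * incidence t (insert u B))"
  using assms by (auto simp: incidence_insert)

text \<open>The double sum is antisymmetric under exchange of the two removed elements.\<close>

lemma d_up_d_up:
  assumes S: "finite S"
  shows "d_up A (d_up A x) S = 0"
proof -
  define g where "g t u = (if t = u then 0 else
      incidence t (S - {t}) * incidence u (S - {t} - {u}) * x (S - {t} - {u}))" for t u
  have g: "g t u = - g u t" if "t \<in> S" "u \<in> S" for t u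
  proof (cases "t = u")
    case False
    define B where "B = S - {t} - {u}"
    have B: "S - {t} = insert u B" "S - {u} = insert t B" "insert t B - {t} = B" "insert u B - {u} = B"
      using that False by (auto simp: B_def)
    have "incidence t (insert u B) * incidence u B = - (incidence u (insert t B) * incidence t B)"
      using S False by (intro incidence_swap) (auto simp: B_def)
    then have "incidence t (insert u B) * incidence u B * x B = - (incidence u (insert t B) * incidence t B * x B)"
      by (metis mult_minus_left)
    then show ?thesis using False unfolding g_def B by simp
  qed (simp add: g_def)
  have "d_up A (d_up A x) S = (\<Sum>t\<in>S - A. \<Sum>u\<in>S - A. g t u)"
    unfolding d_up_def
  proof (rule sum.cong[OF refl])
    fix t assume t: "t \<in> S - A"
    then have "S - A = insert t (S - {t} - A)" by auto
    then have "(\<Sum>u\<in>S - A. g t u) = (\<Sum>u\<in>insert t (S - {t} - A). g t u)" by simp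
    also have "\<dots> = (\<Sum>u\<in>S - {t} - A. g t u)" using S by (subst sum.insert) (auto simp: g_def)
    also have "\<dots> = incidence t (S - {t}) * (\<Sum>u\<in>S - {t} - A. incidence u (S - {t} - {u}) * x (S - {t} - {u}))"
      unfolding sum_distrib_left by (rule sum.cong) (auto simp: g_def)
    finally show "incidence t (S - {t}) * (\<Sum>u\<in>S - {t} - A. incidence u (S - {t} - {u}) * x (S - {t} - {u}))
       = (\<Sum>u\<in>S - A. g t u)" by simp
  qed
  moreover have "(\<Sum>t\<in>S - A. \<Sum>u\<in>S - A. g t u) = - (\<Sum>t\<in>S - A. \<Sum>u\<in>S - A. g t u)"
  proof -
    have "(\<Sum>t\<in>S - A. \<Sum>u\<in>S - A. g t u) = (\<Sum>u\<in>S - A. \<Sum>t\<in>S - A. g t u)" by (rule sum.swap)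
    also have "\<dots> = (\<Sum>u\<in>S - A. \<Sum>t\<in>S - A. - g u t)" by (intro sum.cong refl g) auto
    finally show ?thesis by (simp add: sum_negf)
  qed
  ultimately show ?thesis by simp
qed

text \<open>Removing and adding the same element contributes \<open>|T - A|\<close> and \<open>|M - T|\<close> times \<open>y T\<close>; the terms that
  exchange an element for another one cancel by \<open>incidence_cross\<close>.\<close>

lemma d_up_d_down_homotopy:
  assumes M: "finite M" and AT: "A \<subseteq> T" "T \<subseteq> M"
  shows "d_up A (d_down M y) T + d_down M (d_up A y) T = (real (card M) - real (card A)) * y T"
proof -
  have fin: "finite T" "finite A" using assms finite_subset by metis+
  define h where "h t u = incidence t (T - {t}) * incidence u (T - {t}) * y (insert u (T - {t}))" for t u
  have "d_up A (d_down M y) T = (\<Sum>t\<in>T - A. y T + (\<Sum>u\<in>M - T. h t u))"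
    unfolding d_up_def
  proof (rule sum.cong[OF refl])
    fix t assume t: "t \<in> T - A"
    then have "M - (T - {t}) = insert t (M - T)" using AT by auto
    then have "d_down M y (T - {t}) = incidence t (T - {t}) * y (insert t (T - {t}))
        + (\<Sum>u\<in>M - T. incidence u (T - {t}) * y (insert u (T - {t})))"
      unfolding d_down_def using t M by simp
    moreover have "insert t (T - {t}) = T" using t by auto
    ultimately show "incidence t (T - {t}) * d_down M y (T - {t}) = y T + (\<Sum>u\<in>M - T. h t u)"
      by (simp only: distrib_left sum_distrib_left h_def mult.assoc[symmetric] incidence_square mult_1_left)
  qed
  moreover have "d_down M (d_up A y) T = (\<Sum>u\<in>M - T. y T + (\<Sum>t\<in>T - A. - h t u))"
    unfolding d_down_def
  proof (rule sum.cong[OF refl])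
    fix u assume u: "u \<in> M - T"
    then have "insert u T - A = insert u (T - A)" using AT by auto
    moreover have "insert u T - {u} = T" using u by auto
    ultimately have "d_up A y (insert u T) = incidence u T * y T
        + (\<Sum>t\<in>T - A. incidence t (insert u T - {t}) * y (insert u T - {t}))"
      unfolding d_up_def using u fin by simp
    moreover have "incidence u T * (incidence t (insert u T - {t}) * y (insert u T - {t})) = - h t u"
      if t: "t \<in> T - A" for t
    proof -
      have eq: "insert u T - {t} = insert u (T - {t})" "T = insert t (T - {t})" using t u by auto
      have "incidence t (T - {t}) * incidence u (T - {t})
          = - (incidence u (insert t (T - {t})) * incidence t (insert u (T - {t})))"
        using fin t u by (intro incidence_cross) auto
      then show ?thesis unfolding h_def eq(1) eq(2)[symmetric] by simp
    qed
    then have "(\<Sum>t\<in>T - A. incidence u T * (incidence t (insert u T - {t}) * y (insert u T - {t})))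
        = (\<Sum>t\<in>T - A. - h t u)" by (rule sum.cong[OF refl])
    ultimately show "incidence u T * d_up A y (insert u T) = y T + (\<Sum>t\<in>T - A. - h t u)"
      by (simp only: distrib_left sum_distrib_left mult.assoc[symmetric] incidence_square mult_1_left)
  qed
  moreover have "(\<Sum>u\<in>M - T. \<Sum>t\<in>T - A. h t u) = (\<Sum>t\<in>T - A. \<Sum>u\<in>M - T. h t u)"
    by (rule sum.swap)
  moreover have "real (card (T - A)) + real (card (M - T)) = real (card M) - real (card A)"
    using M fin AT by (simp add: card_Diff_subset card_mono of_nat_diff)
  ultimately show ?thesis
    by (simp add: sum.distrib sum_negf sum_subtractf flip: distrib_right)
qed

text \<open>On the image of \<open>d_up A\<close> the second summand of the homotopy identity vanishes.\<close>

lemma up_laplacian_square: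
  assumes M: "finite M" and AI: "A \<subseteq> I" "I \<subseteq> M"
  shows "d_down M (d_up A (d_down M (d_up A x))) I = (real (card M) - real (card A)) * d_down M (d_up A x) I"
  unfolding d_down_def[of M _ I] sum_distrib_left
proof (rule sum.cong[OF refl])
  fix t assume t: "t \<in> M - I"
  have fin: "finite (insert s (insert t I))" for s using assms finite_subset by auto
  have T: "A \<subseteq> insert t I" "insert t I \<subseteq> M" using AI t by auto
  have "d_down M (d_up A (d_up A x)) (insert t I) = 0"
    unfolding d_down_def using d_up_d_up[OF fin] by simp
  then have "d_up A (d_down M (d_up A x)) (insert t I) = (real (card M) - real (card A)) * d_up A x (insert t I)"
    using d_up_d_down_homotopy[OF M T, of "d_up A x"] by simp
  then show "incidence t I * d_up A (d_down M (d_up A x)) (insert t I)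
      = (real (card M) - real (card A)) * (incidence t I * d_up A x (insert t I))" by simp
qed

lemma d_up_mult: "d_up A (\<lambda>J. x J * b) T = d_up A x T * b"
  by (simp add: d_up_def sum_distrib_right mult.assoc)

lemma d_down_mult: "d_down M (\<lambda>J. x J * b) I = d_down M x I * b"
  by (simp add: d_down_def sum_distrib_right mult.assoc)

lemma abs_signed_sum_le:
  fixes B :: real
  assumes "\<And>t. t \<in> X \<Longrightarrow> \<bar>a t\<bar> \<le> B"
  shows "\<bar>\<Sum>t\<in>X. incidence t (J t) * a t\<bar> \<le> card X * B"
proof -
  have "\<bar>\<Sum>t\<in>X. incidence t (J t) * a t\<bar> \<le> (\<Sum>t\<in>X. \<bar>a t\<bar>)"
    by (rule order.trans[OF sum_abs]) (simp add: abs_mult)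
  also have "\<dots> \<le> card X * B" using assms by (rule sum_bounded_above)
  finally show ?thesis .
qed

lemma abs_d_up_le:
  fixes B :: real
  assumes "finite M" "T \<subseteq> M" "0 \<le> B" "\<And>t. t \<in> T - A \<Longrightarrow> \<bar>x (T - {t})\<bar> \<le> B"
  shows "\<bar>d_up A x T\<bar> \<le> card M * B"
proof -
  have "\<bar>d_up A x T\<bar> \<le> card (T - A) * B"
    unfolding d_up_def by (rule abs_signed_sum_le) (use assms in auto)
  also have "\<dots> \<le> card M * B" using assms card_mono[of M "T - A"] by (intro mult_right_mono) auto
  finally show ?thesis .
qed

lemma abs_d_down_le:
  fixes B :: real
  assumes "finite M" "0 \<le> B" "\<And>t. t \<in> M - I \<Longrightarrow> \<bar>y (insert t I)\<bar> \<le> B"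
  shows "\<bar>d_down M y I\<bar> \<le> card M * B"
proof -
  have "\<bar>d_down M y I\<bar> \<le> card (M - I) * B"
    unfolding d_down_def by (rule abs_signed_sum_le) (use assms in auto)
  also have "\<dots> \<le> card M * B" using assms card_mono[of M "M - I"] by (intro mult_right_mono) auto
  finally show ?thesis .
qed

lemma alternating_sum_zero:
  fixes g :: "'b set \<Rightarrow> real"
  assumes "finite A" "a \<in> A" "\<And>B. B \<subseteq> A \<Longrightarrow> g (insert a B) = g B"
  shows "(\<Sum>B\<in>Pow A. (-1) ^ card B * g B) = 0"
proof -
  define A' where "A' = A - {a}"
  have A': "A = insert a A'" "a \<notin> A'" "finite A'" using assms by (auto simp: A'_def)
  have inj: "inj_on (insert a) (Pow A')" using A' by (auto simp: inj_on_def)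
  have "(\<Sum>B\<in>Pow A. (-1) ^ card B * g B)
      = (\<Sum>B\<in>Pow A'. (-1) ^ card B * g B) + (\<Sum>B\<in>insert a ` Pow A'. (-1) ^ card B * g B)"
    unfolding A'(1) Pow_insert using A' by (intro sum.union_disjoint) auto
  also have "(\<Sum>B\<in>insert a ` Pow A'. (-1) ^ card B * g B) = (\<Sum>B\<in>Pow A'. - ((-1) ^ card B * g B))"
    unfolding sum.reindex[OF inj] o_def
  proof (rule sum.cong[OF refl])
    fix B assume "B \<in> Pow A'"
    then have "finite B" "a \<notin> B" "B \<subseteq> A" using A' finite_subset by auto
    then show "(-1) ^ card (insert a B) * g (insert a B) = - ((-1) ^ card B * g B)"
      by (simp add: assms(3))
  qed
  finally show ?thesis by (simp add: sum_negf)
qed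

lemma finite_argmax:
  fixes f :: "'b \<Rightarrow> real"
  assumes "finite X" "X \<noteq> {}"
  obtains x where "x \<in> X" "\<And>y. y \<in> X \<Longrightarrow> f y \<le> f x"
proof -
  have "Max (f ` X) \<in> f ` X" using assms by (intro Max_in) auto
  then obtain x where "x \<in> X" "Max (f ` X) = f x" by auto
  then show ?thesis using that[of x] assms(1) Max_ge[of "f ` X"] by auto
qed

lemma card_exchange:
  assumes "finite I" "t \<notin> I" "u \<in> insert t I"
  shows "card (insert t I - {u}) = card I"
  using assms by simp

context building_flags
begin

abbreviation M :: "nat set" where "M \<equiv> {1..m}"

section \<open>Approximate joint eigenspaces of the averaging operators\<close>

text \<open>The Moebius transform of the averages. For exactly commuting averages it would be the projection to the
  joint eigenspace \<open>V\<^sub>A\<close>.\<close>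

definition D :: "nat set \<Rightarrow> ('a set \<Rightarrow> real) \<Rightarrow> 'a set \<Rightarrow> real" where
  "D A \<phi> c = (-1) ^ card A * (\<Sum>B\<in>Pow A. (-1) ^ card B * E B \<phi> c)"

lemma D_cong: "(\<And>c. c \<in> \<Omega> \<Longrightarrow> \<phi> c = \<psi> c) \<Longrightarrow> D A \<phi> c = D A \<psi> c"
  unfolding D_def by (metis E_cong)

lemma D_scale: "D A (\<lambda>c. a * \<phi> c) c = a * D A \<phi> c"
  by (simp add: D_def E_scale sum_distrib_left algebra_simps)

lemma D_sum: "D A (\<lambda>c. \<Sum>t\<in>X. \<phi> t c) c = (\<Sum>t\<in>X. D A (\<phi> t) c)"
  unfolding D_def E_sum by (simp add: sum_distrib_left) (rule sum.swap)

lemma D_E: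
  assumes "A \<subseteq> I" "c \<in> \<Omega>"
  shows "D A (E I \<phi>) c = D A \<phi> c"
  unfolding D_def
  by (rule arg_cong[where f="\<lambda>x. _ * x"], rule sum.cong) (use assms in \<open>auto intro!: E_tower\<close>)

lemma sum_D:
  assumes "finite I"
  shows "(\<Sum>A\<in>Pow I. D A \<phi> c) = E I \<phi> c"
  unfolding D_def
  by (rule inclusion_exclusion_symmetric[OF refl assms, symmetric])

text \<open>Replacing \<open>E B \<phi>\<close> by \<open>E (B \<inter> I) \<phi>\<close> costs \<open>\<theta>\<close>; afterwards \<open>B\<close> and \<open>insert a B\<close> cancel for every
  \<open>a \<in> A - I\<close>.\<close>

lemma nrm_D_small:
  assumes "A \<subseteq> M" "I \<subseteq> M" "\<not> A \<subseteq> I" "depends_on I \<phi>"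
  shows "nrm (D A \<phi>) \<le> 2 ^ m * (\<theta> * nrm \<phi>)"
proof -
  have fin: "finite A" using assms(1) finite_subset by auto
  obtain a where a: "a \<in> A" "a \<notin> I" using assms(3) by blast
  have zero: "(\<Sum>B\<in>Pow A. (-1) ^ card B * E (B \<inter> I) \<phi> c) = 0" for c
    using fin a by (intro alternating_sum_zero[of A a]) auto
  have "nrm (D A \<phi>) = nrm (\<lambda>c. (-1) ^ card A * (\<Sum>B\<in>Pow A. (-1) ^ card B * (E B \<phi> c - E (B \<inter> I) \<phi> c)))"
    unfolding D_def by (simp add: right_diff_distrib sum_subtractf zero)
  also have "\<dots> = nrm (\<lambda>c. \<Sum>B\<in>Pow A. (-1) ^ card B * (E B \<phi> c - E (B \<inter> I) \<phi> c))"
    unfolding nrm_scale by (simp add: power_abs)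
  also have "\<dots> \<le> card (Pow A) * (\<theta> * nrm \<phi>)"
  proof (rule nrm_sum_le[where \<phi>="\<lambda>B c. E B \<phi> c - E (B \<inter> I) \<phi> c" and a="\<lambda>B. (-1) ^ card B"])
    fix B assume "B \<in> Pow A"
    then have "B \<subseteq> M" using assms(1) by auto
    have "nrm (\<lambda>c. E B \<phi> c - E (B \<inter> I) \<phi> c) = nrm (\<lambda>c. E B (E I \<phi>) c - E (B \<inter> I) \<phi> c)"
    proof (rule nrm_cong)
      fix c
      have "E B (E I \<phi>) c = E B \<phi> c" by (rule E_cong) (rule E_of_depends_on[OF assms(4)])
      then show "E B \<phi> c - E (B \<inter> I) \<phi> c = E B (E I \<phi>) c - E (B \<inter> I) \<phi> c" by simp
    qed
    also have "\<dots> \<le> \<theta> * nrm \<phi>"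
      using E_E_close[OF \<open>B \<subseteq> M\<close> assms(2)] unfolding close_def by blast
    finally show "nrm (\<lambda>c. E B \<phi> c - E (B \<inter> I) \<phi> c) \<le> \<theta> * nrm \<phi>" .
  qed (use fin in \<open>auto simp: power_abs\<close>)
  also have "\<dots> \<le> 2 ^ m * (\<theta> * nrm \<phi>)"
  proof (rule mult_right_mono)
    have "card A \<le> m" using card_mono[OF _ assms(1)] by simp
    then have "(2::real) ^ card A \<le> 2 ^ m" by (rule power_increasing) simp
    then show "real (card (Pow A)) \<le> 2 ^ m" using fin by (simp add: card_Pow)
  qed (simp add: theta_nonneg)
  finally show ?thesis .
qed

lemma nrm_d_down_le:
  fixes B :: real
  assumes "I \<subseteq> M" "0 \<le> B" "\<And>t. t \<in> M - I \<Longrightarrow> nrm (\<lambda>c. y c (insert t I)) \<le> B"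
  shows "nrm (\<lambda>c. d_down M (y c) I) \<le> m * B"
proof -
  have "nrm (\<lambda>c. d_down M (y c) I) \<le> card (M - I) * B"
    unfolding d_down_def using assms by (intro nrm_sum_le) auto
  also have "\<dots> \<le> m * B" using card_mono[of M "M - I"] assms(2) by (intro mult_right_mono) auto
  finally show ?thesis .
qed

lemma nrm_sum_removals_le:
  fixes B :: real
  assumes "T \<subseteq> M" "X \<subseteq> T" "0 \<le> B" "\<And>t. t \<in> X \<Longrightarrow> nrm (\<lambda>c. x c (T - {t})) \<le> B"
  shows "nrm (\<lambda>c. \<Sum>t\<in>X. incidence t (T - {t}) * x c (T - {t})) \<le> m * B"
proof -
  have X: "X \<subseteq> M" using assms by auto
  have "nrm (\<lambda>c. \<Sum>t\<in>X. incidence t (T - {t}) * x c (T - {t})) \<le> card X * B"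
    using assms finite_subset[OF X] by (intro nrm_sum_le) auto
  also have "\<dots> \<le> m * B" using card_mono[OF _ X] assms(3) by (intro mult_right_mono) auto
  finally show ?thesis .
qed

text \<open>Take the largest component \<open>f I\<close> of the eigenvector and the largest of its parts \<open>D A (f I)\<close>. The family
  \<open>x J = D A (f J)\<close> satisfies the eigenvalue equation of the walk, with \<open>E\<close> removed, at each flag
  separately. Dropping the small \<open>x J\<close> with \<open>\<not> A \<subseteq> J\<close> turns it into \<open>\<mu> x = L x + \<epsilon>\<close> for the up
  Laplacian \<open>L\<close>, and \<open>L\<^sup>2 = m' L\<close> with \<open>m' = m - |A|\<close> gives \<open>\<mu> (m' - \<mu>) x = (m' - \<mu>) \<epsilon> - L \<epsilon>\<close>.\<close>

lemma eigenvalue_near_integer: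
  fixes f :: "nat set \<Rightarrow> 'a set \<Rightarrow> real"
  assumes dep: "\<And>I. I \<subseteq> M \<Longrightarrow> card I = k \<Longrightarrow> depends_on I (f I)"
    and eq: "\<And>I c. I \<subseteq> M \<Longrightarrow> card I = k \<Longrightarrow> c \<in> \<Omega> \<Longrightarrow>
      E I (\<lambda>c. d_down M (d_up {} (\<lambda>J. f J c)) I) c = \<mu> * f I c"
    and nz: "I0 \<subseteq> M" "card I0 = k" "c0 \<in> \<Omega>" "f I0 c0 \<noteq> 0"
  shows "\<exists>j\<le>k. \<bar>\<mu>\<bar> * \<bar>real m - real j - \<mu>\<bar> \<le> 4 ^ m * m\<^sup>2 * \<theta> * (\<bar>real m - real j - \<mu>\<bar> + m\<^sup>2)"
proof -
  define X where "X = {I. I \<subseteq> M \<and> card I = k}"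
  have finX: "finite X" by (rule finite_subset[of _ "Pow M"]) (auto simp: X_def)
  have "X \<noteq> {}" using nz by (auto simp: X_def)
  obtain I where I: "I \<in> X" "\<And>J. J \<in> X \<Longrightarrow> nrm (f J) \<le> nrm (f I)"
    using finite_argmax[OF finX \<open>X \<noteq> {}\<close>, of "\<lambda>I. nrm (f I)"] by blast
  define R where "R = nrm (f I)"
  have "nrm (f I0) \<noteq> 0" using nz finite_flags by (auto simp: L2_set_eq_0_iff)
  then have "nrm (f I0) > 0" using nrm_nonneg[of "f I0"] by linarith
  moreover have "nrm (f I0) \<le> R" unfolding R_def using nz by (intro I(2)) (simp add: X_def)
  ultimately have R: "R > 0" by linarith
  have IM: "I \<subseteq> M" "card I = k" using I(1) by (auto simp: X_def)
  have finI: "finite I" using IM finite_subset by auto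
  obtain A where A: "A \<in> Pow I" "\<And>B. B \<in> Pow I \<Longrightarrow> nrm (D B (f I)) \<le> nrm (D A (f I))"
    using finite_argmax[of "Pow I" "\<lambda>B. nrm (D B (f I))"] finI by blast
  have R_le: "R \<le> 2 ^ m * nrm (D A (f I))"
  proof -
    have "R = nrm (\<lambda>c. \<Sum>B\<in>Pow I. 1 * D B (f I) c)"
      unfolding R_def by (rule nrm_cong) (simp add: sum_D[OF finI] E_of_depends_on[OF dep[OF IM]])
    also have "\<dots> \<le> card (Pow I) * nrm (D A (f I))"
      using A finI by (intro nrm_sum_le) auto
    also have "\<dots> \<le> 2 ^ m * nrm (D A (f I))"
    proof (rule mult_right_mono)
      have "card I \<le> m" using card_mono[OF _ IM(1)] by simp
      then have "(2::real) ^ card I \<le> 2 ^ m" by (rule power_increasing) simp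
      then show "real (card (Pow I)) \<le> 2 ^ m" using finI by (simp add: card_Pow)
    qed simp
    finally show ?thesis .
  qed
  have AI: "A \<subseteq> I" using A(1) by auto
  have AM: "A \<subseteq> M" using AI IM by auto
  have finA: "finite A" using AI finI finite_subset by auto
  define x where "x c J = D A (f J) c" for c J
  define e where "e c T = (\<Sum>t\<in>T \<inter> A. incidence t (T - {t}) * x c (T - {t}))" for c T
  define \<epsilon> where "\<epsilon> c J = d_down M (e c) J" for c J
  define m' where "m' = real m - real (card A)"
  have eqD: "\<mu> * x c J = d_down M (d_up {} (x c)) J" if J: "J \<in> X" "A \<subseteq> J" and c: "c \<in> \<Omega>" for J c
  proof -
    have JM: "J \<subseteq> M" "card J = k" using J by (auto simp: X_def)
    have "\<mu> * x c J = D A (\<lambda>c. \<mu> * f J c) c" by (simp add: x_def D_scale)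
    also have "\<dots> = D A (E J (\<lambda>c. d_down M (d_up {} (\<lambda>J. f J c)) J)) c"
      by (rule D_cong) (rule eq[OF JM, symmetric])
    also have "\<dots> = D A (\<lambda>c. d_down M (d_up {} (\<lambda>J. f J c)) J) c" by (rule D_E[OF J(2) c])
    also have "\<dots> = d_down M (d_up {} (x c)) J"
      unfolding d_down_def d_up_def by (simp only: D_sum D_scale x_def)
    finally show ?thesis .
  qed
  have split: "d_up {} (x c) T = d_up A (x c) T + e c T" if "T \<subseteq> M" for c T
  proof -
    have "finite T" using that finite_subset by auto
    then have "(\<Sum>t\<in>T. incidence t (T - {t}) * x c (T - {t})) =
        (\<Sum>t\<in>T - A. incidence t (T - {t}) * x c (T - {t})) + (\<Sum>t\<in>T \<inter> A. incidence t (T - {t}) * x c (T - {t}))"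
      using sum.Int_Diff[of T _ A] by (simp add: add.commute)
    then show ?thesis by (simp add: d_up_def e_def)
  qed
  have g: "d_down M (d_up A (x c)) J = \<mu> * x c J - \<epsilon> c J" if J: "J \<in> X" "A \<subseteq> J" and c: "c \<in> \<Omega>" for J c
  proof -
    have "d_down M (d_up {} (x c)) J = d_down M (d_up A (x c)) J + \<epsilon> c J"
      unfolding \<epsilon>_def d_down_def sum.distrib[symmetric] distrib_left[symmetric]
      by (intro sum.cong refl arg_cong2[where f="(*)"] split) (use J in \<open>auto simp: X_def\<close>)
    then show ?thesis using eqD[OF J c] by simp
  qed
  have key: "\<mu> * (m' - \<mu>) * x c I = (m' - \<mu>) * \<epsilon> c I - d_down M (d_up A (\<epsilon> c)) I" if c: "c \<in> \<Omega>" for c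
  proof -
    let ?g = "d_down M (d_up A (x c))"
    have "m' * ?g I = d_down M (d_up A ?g) I"
      using up_laplacian_square[of M A I "x c"] AI IM by (simp add: m'_def)
    also have "\<dots> = d_down M (d_up A (\<lambda>J. \<mu> * x c J - \<epsilon> c J)) I"
    proof (rule d_down_cong, rule d_up_cong, rule g[OF _ _ c])
      fix t u assume tu: "t \<in> M - I" "u \<in> insert t I - A"
      show "insert t I - {u} \<in> X" "A \<subseteq> insert t I - {u}"
        using tu IM AI card_exchange[OF finI, of t u] by (auto simp: X_def)
    qed
    also have "\<dots> = \<mu> * ?g I - d_down M (d_up A (\<epsilon> c)) I"
      unfolding d_down_def d_up_def
      by (simp add: sum_distrib_left sum_subtractf right_diff_distrib mult.left_commute)
    finally have "m' * ?g I = \<mu> * ?g I - d_down M (d_up A (\<epsilon> c)) I" .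
    then show ?thesis unfolding g[OF I(1) AI c] by (simp add: algebra_simps)
  qed
  define b where "b = 2 ^ m * (\<theta> * R)"
  have b0: "0 \<le> b" using theta_nonneg R by (simp add: b_def)
  have x_small: "nrm (\<lambda>c. x c J) \<le> b" if "J \<in> X" "\<not> A \<subseteq> J" for J
  proof -
    have "nrm (\<lambda>c. x c J) \<le> 2 ^ m * (\<theta> * nrm (f J))"
      unfolding x_def using that AM by (intro nrm_D_small[of A J] dep) (auto simp: X_def)
    also have "\<dots> \<le> b" unfolding b_def R_def
      using I(2)[OF that(1)] theta_nonneg by (intro mult_left_mono) auto
    finally show ?thesis .
  qed
  have eps: "nrm (\<lambda>c. \<epsilon> c J) \<le> m * (m * b)" if J: "J \<in> X" "A \<subseteq> J" for J
    unfolding \<epsilon>_def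
  proof (rule nrm_d_down_le)
    fix t assume t: "t \<in> M - J"
    have JM: "J \<subseteq> M" "card J = k" "finite J" using J finite_subset[of J M] by (auto simp: X_def)
    show "nrm (\<lambda>c. e c (insert t J)) \<le> m * b"
      unfolding e_def
    proof (rule nrm_sum_removals_le)
      fix u assume u: "u \<in> insert t J \<inter> A"
      show "nrm (\<lambda>c. x c (insert t J - {u})) \<le> b"
        using u t JM card_exchange[OF JM(3), of t u] by (intro x_small) (auto simp: X_def)
    qed (use t JM b0 in auto)
  qed (use J b0 in \<open>auto simp: X_def\<close>)
  have Leps: "nrm (\<lambda>c. d_down M (d_up A (\<epsilon> c)) I) \<le> m * (m * (m * (m * b)))"
  proof (rule nrm_d_down_le)
    fix t assume t: "t \<in> M - I"
    show "nrm (\<lambda>c. d_up A (\<epsilon> c) (insert t I)) \<le> m * (m * (m * b))"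
      unfolding d_up_def
    proof (rule nrm_sum_removals_le)
      fix u assume u: "u \<in> insert t I - A"
      show "nrm (\<lambda>c. \<epsilon> c (insert t I - {u})) \<le> m * (m * b)"
        using u t IM AI card_exchange[OF finI, of t u] by (intro eps) (auto simp: X_def)
    qed (use t IM b0 in auto)
  qed (use IM b0 in auto)
  have "\<bar>\<mu> * (m' - \<mu>)\<bar> * nrm (\<lambda>c. x c I) = nrm (\<lambda>c. (m' - \<mu>) * \<epsilon> c I + (-1) * d_down M (d_up A (\<epsilon> c)) I)"
    unfolding nrm_scale[symmetric] by (rule nrm_cong) (simp add: key)
  also have "\<dots> \<le> \<bar>m' - \<mu>\<bar> * nrm (\<lambda>c. \<epsilon> c I) + \<bar>-1\<bar> * nrm (\<lambda>c. d_down M (d_up A (\<epsilon> c)) I)"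
    unfolding nrm_scale[symmetric] by (rule nrm_add)
  also have "\<dots> \<le> \<bar>m' - \<mu>\<bar> * (m * (m * b)) + 1 * (m * (m * (m * (m * b))))"
    using eps[OF I(1) AI] Leps by (intro add_mono mult_mono) auto
  also have "\<dots> = (2 ^ m * m\<^sup>2 * \<theta> * (\<bar>m' - \<mu>\<bar> + m\<^sup>2)) * R"
    by (simp add: b_def algebra_simps power2_eq_square)
  finally have 1: "\<bar>\<mu> * (m' - \<mu>)\<bar> * nrm (\<lambda>c. x c I) \<le> (2 ^ m * m\<^sup>2 * \<theta> * (\<bar>m' - \<mu>\<bar> + m\<^sup>2)) * R" .
  have "(\<bar>\<mu>\<bar> * \<bar>m' - \<mu>\<bar>) * R \<le> (\<bar>\<mu>\<bar> * \<bar>m' - \<mu>\<bar>) * (2 ^ m * nrm (\<lambda>c. x c I))"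
    using R_le by (intro mult_left_mono) (auto simp: x_def)
  also have "\<dots> = 2 ^ m * (\<bar>\<mu> * (m' - \<mu>)\<bar> * nrm (\<lambda>c. x c I))" by (simp add: abs_mult)
  also have "\<dots> \<le> 2 ^ m * ((2 ^ m * m\<^sup>2 * \<theta> * (\<bar>m' - \<mu>\<bar> + m\<^sup>2)) * R)"
    using 1 by (intro mult_left_mono) auto
  also have "\<dots> = (4 ^ m * m\<^sup>2 * \<theta> * (\<bar>m' - \<mu>\<bar> + m\<^sup>2)) * R"
    using power_mult_distrib[of "2::real" 2 m] by (simp add: algebra_simps)
  finally have "\<bar>\<mu>\<bar> * \<bar>m' - \<mu>\<bar> \<le> 4 ^ m * m\<^sup>2 * \<theta> * (\<bar>m' - \<mu>\<bar> + m\<^sup>2)"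
    using R by (simp add: mult_le_cancel_right)
  moreover have "card A \<le> k" using card_mono[OF finI AI] IM by simp
  ultimately show ?thesis unfolding m'_def by blast
qed

text \<open>Averaging spreads the mass of the indicator over a cell that is at least \<open>q\<close> times larger, as already the
  replacement of the member at level \<open>a\<close> alone shows.\<close>

lemma indicator_thin:
  assumes A: "A \<subseteq> M" "a \<in> A" and c0: "c0 \<in> \<Omega>"
  defines "\<phi> \<equiv> \<lambda>c. of_bool (c \<in> cell A c0)"
  shows "nrm (E (A - {a}) \<phi>) \<le> \<eta> * nrm \<phi>"
proof -
  have aM: "a \<in> M" using A by auto
  have sub: "cell A c0 \<subseteq> cell (A - {a}) c0"
  proof
    fix c assume "c \<in> cell A c0"
    then have "c \<in> \<Omega>" "part A c = part A c0" by (simp_all add: cell_def)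
    then show "c \<in> cell (A - {a}) c0" using part_eq_mono[of A c c0 "A - {a}"] by (simp add: cell_def)
  qed
  define w where "w = real (card (cell A c0))"
  define w' where "w' = real (card (cell (A - {a}) c0))"
  have w: "w > 0" "w' > 0" using card_cell_pos[OF c0] by (auto simp: w_def w'_def)
  have "q * card (cell A c0) \<le> card (cell (A - {a}) c0)"
  proof -
    have disj: "cell (M - {a}) c \<inter> cell (M - {a}) d = {}"
      if cd: "c \<in> cell A c0" "d \<in> cell A c0" "c \<noteq> d" for c d
    proof (rule ccontr)
      assume "cell (M - {a}) c \<inter> cell (M - {a}) d \<noteq> {}"
      then obtain y where "y \<in> cell (M - {a}) c" "y \<in> cell (M - {a}) d" by blast
      then have 1: "part (M - {a}) c = part (M - {a}) d" by (simp add: cell_def)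
      have c: "c \<in> \<Omega>" "d \<in> \<Omega>" "part A c = part A d" using cd by (simp_all add: cell_def)
      have "part {a} c = part {a} d" using part_eq_mono[OF c(3), of "{a}"] A by simp
      then show False using flag_eqI[OF aM c(1,2) _ 1] cd(3) by simp
    qed
    have "(\<Sum>c\<in>cell A c0. q) \<le> (\<Sum>c\<in>cell A c0. card (cell (M - {a}) c))"
      by (rule sum_mono, rule thick[OF aM]) (simp add: cell_def)
    also have "\<dots> = card (\<Union>c\<in>cell A c0. cell (M - {a}) c)"
      using disj by (intro card_UN_disjoint[symmetric]) auto
    also have "\<dots> \<le> card (cell (A - {a}) c0)"
    proof (rule card_mono[OF finite_cell], rule UN_least, rule subsetI)
      fix c y assume "c \<in> cell A c0" "y \<in> cell (M - {a}) c"
      then have *: "y \<in> \<Omega>" "part (M - {a}) y = part (M - {a}) c" "part A c = part A c0"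
        by (simp_all add: cell_def)
      have "part (A - {a}) y = part (A - {a}) c" using part_eq_mono[OF *(2)] A by blast
      also have "\<dots> = part (A - {a}) c0" using part_eq_mono[OF *(3)] by blast
      finally show "y \<in> cell (A - {a}) c0" using * by (simp add: cell_def)
    qed
    finally show ?thesis by (simp add: mult.commute)
  qed
  then have qw: "q * w \<le> w'" unfolding w_def w'_def by (metis of_nat_le_iff of_nat_mult)
  have nphi: "ip \<phi> \<psi> = (\<Sum>c\<in>cell A c0. \<psi> c)" for \<psi>
  proof -
    have "ip \<phi> \<psi> = (\<Sum>c\<in>\<Omega>. if c \<in> cell A c0 then \<psi> c else 0)"
      unfolding ip_def \<phi>_def by (rule sum.cong) auto
    also have "\<dots> = (\<Sum>c\<in>{c \<in> \<Omega>. c \<in> cell A c0}. \<psi> c)" by (rule sum.inter_filter[OF finite_flags, symmetric])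
    also have "{c \<in> \<Omega>. c \<in> cell A c0} = cell A c0" by (auto simp: cell_def)
    finally show ?thesis .
  qed
  have Ephi: "E (A - {a}) \<phi> c = w / w'" if "c \<in> cell A c0" for c
  proof -
    have "part (A - {a}) c = part (A - {a}) c0" using sub that by (auto simp: cell_def)
    then have "cell (A - {a}) c = cell (A - {a}) c0" by (rule cell_eq)
    moreover have "(\<Sum>d\<in>cell (A - {a}) c0. \<phi> d) = w"
    proof -
      have "(\<Sum>d\<in>cell (A - {a}) c0. \<phi> d) = (\<Sum>d\<in>cell A c0. 1)"
        unfolding \<phi>_def by (rule sum.mono_neutral_cong_right) (use sub in auto)
      then show ?thesis by (simp add: w_def)
    qed
    ultimately show ?thesis by (simp add: E_def w'_def)
  qed
  have "(nrm (E (A - {a}) \<phi>))\<^sup>2 = w * (w / w')"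
    unfolding nrm_eq_ip ip_E_E nphi by (simp add: Ephi w_def)
  also have "\<dots> \<le> w * (1 / q)"
    using qw w q_pos by (intro mult_left_mono) (auto simp: field_simps)
  also have "\<dots> = (\<eta> * nrm \<phi>)\<^sup>2"
  proof -
    have "(nrm \<phi>)\<^sup>2 = w" unfolding nrm_eq_ip nphi by (simp add: w_def \<phi>_def)
    then show ?thesis unfolding power_mult_distrib by (simp add: \<eta>_def power_divide)
  qed
  finally show ?thesis by (rule power2_le_imp_le) (use eta_pos in simp)
qed

lemma nrm_E_indicator_le:
  assumes A: "A \<subseteq> M" and I: "I \<subseteq> M" "\<not> A \<subseteq> I" and c0: "c0 \<in> \<Omega>"
  defines "\<phi> \<equiv> \<lambda>c. of_bool (c \<in> cell A c0)"
  shows "nrm (E I \<phi>) \<le> (\<theta> + \<eta>) * nrm \<phi>"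
proof -
  obtain a where a: "a \<in> A" "a \<notin> I" using I by blast
  have dep: "depends_on A \<phi>" unfolding depends_on_def \<phi>_def cell_def by simp
  have "nrm (E I \<phi>) = nrm (\<lambda>c. (E I (E A \<phi>) c - E (I \<inter> A) \<phi> c) + E (I \<inter> A) \<phi> c)"
  proof (rule nrm_cong)
    fix c
    have "E I (E A \<phi>) c = E I \<phi> c" by (rule E_cong) (rule E_of_depends_on[OF dep])
    then show "E I \<phi> c = (E I (E A \<phi>) c - E (I \<inter> A) \<phi> c) + E (I \<inter> A) \<phi> c" by simp
  qed
  also have "\<dots> \<le> nrm (\<lambda>c. E I (E A \<phi>) c - E (I \<inter> A) \<phi> c) + nrm (E (I \<inter> A) \<phi>)" by (rule nrm_add)
  also have "nrm (\<lambda>c. E I (E A \<phi>) c - E (I \<inter> A) \<phi> c) \<le> \<theta> * nrm \<phi>"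
    using E_E_close[OF I(1) A] unfolding close_def by blast
  also have "nrm (E (I \<inter> A) \<phi>) = nrm (E (I \<inter> A) (E (A - {a}) \<phi>))"
    by (rule nrm_cong) (rule E_tower[symmetric], use a in auto)
  also have "\<dots> \<le> nrm (E (A - {a}) \<phi>)" by (rule E_contraction)
  also have "\<dots> \<le> \<eta> * nrm \<phi>" unfolding \<phi>_def by (rule indicator_thin[OF A a(1) c0])
  finally show ?thesis by (simp add: distrib_right)
qed

text \<open>With \<open>A = {1..j}\<close>, \<open>\<phi>\<close> the indicator of one flag of type \<open>A\<close> and \<open>a = L \<delta>\<close> for a point mass \<open>\<delta>\<close>, take
  \<open>f I = a I \<phi>\<close> for \<open>A \<subseteq> I\<close>. Since \<open>L a = (m - j) a\<close>, the eigenvalue equation is exact for these \<open>I\<close>.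
  For the others the walk produces a multiple of \<open>E I \<phi>\<close>, which is small.\<close>

lemma approximate_eigenvector:
  assumes jk: "j \<le> k" "k < m"
  shows "\<exists>(f :: nat set \<Rightarrow> 'a set \<Rightarrow> real) \<rho>.
    (\<forall>I. I \<subseteq> M \<and> card I = k \<longrightarrow> depends_on I (f I) \<and>
       nrm (\<lambda>c. E I (\<lambda>c. d_down M (d_up {} (\<lambda>J. f J c)) I) c - (real m - real j) * f I c)
         \<le> real m ^ 4 * (\<theta> + \<eta>) * \<rho>) \<and>
    \<rho> \<le> nrm (f {1..k}) \<and> 0 < \<rho>"
proof -
  obtain c0 where c0: "c0 \<in> \<Omega>" using flags_nonempty by blast
  define A where "A = {1..j}"
  define \<phi> :: "'a set \<Rightarrow> real" where "\<phi> c = of_bool (c \<in> cell A c0)" for c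
  have phi_eq: "\<phi> = (\<lambda>c. of_bool (c \<in> cell A c0))" by (auto simp: \<phi>_def)
  define \<delta> :: "nat set \<Rightarrow> real" where "\<delta> J = of_bool (J = {1..k})" for J
  define a where "a I = d_down M (d_up A \<delta>) I" for I
  define f where "f I c = (if A \<subseteq> I then a I * \<phi> c else 0)" for I c
  have A: "A \<subseteq> M" "A \<subseteq> {1..k}" "card A = j" using jk by (auto simp: A_def)
  have k: "{1..k} \<subseteq> M" "card {1..k} = k" using jk by auto
  have phi_dep: "depends_on A \<phi>" unfolding depends_on_def phi_eq cell_def by simp
  have phi_pos: "nrm \<phi> > 0"
  proof -
    have "\<phi> c0 = 1" using self_in_cell[OF c0] by (simp add: \<phi>_def)
    then have "nrm \<phi> \<noteq> 0" using c0 finite_flags by (force simp: L2_set_eq_0_iff)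
    then show ?thesis using nrm_nonneg[of \<phi>] by linarith
  qed
  have a_le: "\<bar>a I\<bar> \<le> m * m" if "I \<subseteq> M" for I
  proof -
    have "\<bar>a I\<bar> \<le> card M * (card M * (1::real))"
      unfolding a_def
    proof (rule abs_d_down_le)
      fix t assume "t \<in> M - I"
      then show "\<bar>d_up A \<delta> (insert t I)\<bar> \<le> card M * (1::real)"
        using that by (intro abs_d_up_le) (auto simp: \<delta>_def)
    qed auto
    then show ?thesis by simp
  qed
  \<comment> \<open>The diagonal entry of the up Laplacian is \<open>m - k\<close>; so the component at \<open>{1..k}\<close> does not vanish.\<close>
  have a_k: "a {1..k} \<ge> 1"
  proof -
    have "d_up A \<delta> (insert t {1..k}) = incidence t {1..k}" if t: "t \<in> M - {1..k}" for t
    proof -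
      have t': "t \<notin> {1..k}" "t \<in> insert t {1..k} - A" using t A by auto
      define K where "K = {1..k}"
      have K: "insert t K - {u} = K \<longleftrightarrow> u = t" if "u \<in> insert t K" for u
        using that t'(1) unfolding K_def[symmetric] by blast
      have "d_up A \<delta> (insert t K) = (\<Sum>u\<in>insert t K - A. if u = t then incidence t K else 0)"
        unfolding d_up_def
      proof (rule sum.cong[OF refl])
        fix u assume "u \<in> insert t K - A"
        then have "insert t K - {u} = K \<longleftrightarrow> u = t" using K by blast
        then show "incidence u (insert t K - {u}) * \<delta> (insert t K - {u}) = (if u = t then incidence t K else 0)"
          unfolding \<delta>_def K_def[symmetric] by (cases "u = t") simp_all
      qed
      also have "\<dots> = incidence t K"
        using t' unfolding K_def[symmetric] by (subst sum.delta) (auto simp: K_def)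
      finally show ?thesis unfolding K_def .
    qed
    then have "a {1..k} = (\<Sum>t\<in>M - {1..k}. 1)"
      unfolding a_def d_down_def by (intro sum.cong) simp_all
    also have "\<dots> = real (card (M - {1..k}))" by simp
    also have "card (M - {1..k}) = m - k" using card_Diff_subset[OF _ k(1)] by simp
    finally show ?thesis using jk by simp
  qed
  have dep: "depends_on I (f I)" for I
  proof (cases "A \<subseteq> I")
    case True
    then show ?thesis using depends_on_mono[OF phi_dep True] unfolding depends_on_def f_def by metis
  qed (simp add: depends_on_def f_def)
  have fin: "finite I" if "I \<subseteq> M" for I using that finite_subset by auto
  have good: "d_down M (d_up {} (\<lambda>J. f J c)) I = (real m - real j) * f I c" if I: "I \<subseteq> M" "A \<subseteq> I" for I c
  proof -
    have "d_down M (d_up {} (\<lambda>J. f J c)) I = d_down M (d_up A (\<lambda>J. a J * \<phi> c)) I"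
    proof (rule d_down_cong)
      fix t assume t: "t \<in> M - I"
      have "d_up {} (\<lambda>J. f J c) (insert t I)
          = (\<Sum>u\<in>insert t I - A. incidence u (insert t I - {u}) * f (insert t I - {u}) c)"
        unfolding d_up_def using fin[OF I(1)] by (intro sum.mono_neutral_right) (auto simp: f_def)
      also have "\<dots> = d_up A (\<lambda>J. a J * \<phi> c) (insert t I)"
        unfolding d_up_def using I by (intro sum.cong refl) (auto simp: f_def)
      finally show "d_up {} (\<lambda>J. f J c) (insert t I) = d_up A (\<lambda>J. a J * \<phi> c) (insert t I)" .
    qed
    also have "\<dots> = d_down M (d_up A a) I * \<phi> c"
      unfolding d_up_mult by (rule d_down_mult)
    also have "d_down M (d_up A a) I = (real m - real j) * a I"
      unfolding a_def using up_laplacian_square[OF _ I(2,1), of \<delta>] A(3) by simp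
    finally show ?thesis using I by (simp add: f_def)
  qed
  have bad: "nrm (\<lambda>c. E I (\<lambda>c. d_down M (d_up {} (\<lambda>J. f J c)) I) c) \<le> m ^ 4 * (\<theta> + \<eta>) * nrm \<phi>"
    if I: "I \<subseteq> M" "\<not> A \<subseteq> I" for I
  proof -
    define b where "b J = (if A \<subseteq> J then a J else 0)" for J
    have f: "f J c = b J * \<phi> c" for J c by (simp add: f_def b_def)
    have b_le: "\<bar>b J\<bar> \<le> m * m" if "J \<subseteq> M" for J using a_le[OF that] by (simp add: b_def)
    have "\<bar>d_down M (d_up {} b) I\<bar> \<le> card M * (card M * (real m * real m))"
    proof (rule abs_d_down_le)
      fix t assume "t \<in> M - I"
      then have T: "insert t I \<subseteq> M" using I by auto
      show "\<bar>d_up {} b (insert t I)\<bar> \<le> card M * (real m * real m)"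
      proof (rule abs_d_up_le[OF _ T])
        fix u
        show "\<bar>b (insert t I - {u})\<bar> \<le> real m * real m"
          using b_le[OF subset_trans[OF Diff_subset T]] by simp
      qed auto
    qed auto
    then have c_le: "\<bar>d_down M (d_up {} b) I\<bar> \<le> m ^ 4" by (simp add: power4_eq_xxxx ac_simps)
    have "nrm (\<lambda>c. E I (\<lambda>c. d_down M (d_up {} (\<lambda>J. f J c)) I) c) = nrm (\<lambda>c. d_down M (d_up {} b) I * E I \<phi> c)"
      unfolding f d_up_mult d_down_mult E_scale ..
    also have "\<dots> = \<bar>d_down M (d_up {} b) I\<bar> * nrm (E I \<phi>)" by (rule nrm_scale)
    also have "\<dots> \<le> m ^ 4 * ((\<theta> + \<eta>) * nrm \<phi>)"
      using c_le nrm_E_indicator_le[OF A(1) I c0] unfolding phi_eq by (intro mult_mono) auto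
    finally show ?thesis by (simp add: mult.assoc)
  qed
  show ?thesis
  proof (intro exI[of _ f] exI[of _ "nrm \<phi>"] conjI allI impI)
    have "nrm \<phi> \<le> \<bar>a {1..k}\<bar> * nrm \<phi>" using a_k phi_pos by (simp add: mult_le_cancel_right1)
    also have "\<dots> = nrm (f {1..k})" unfolding nrm_scale[symmetric] f_def using A(2) by simp
    finally show "nrm \<phi> \<le> nrm (f {1..k})" .
  next
    fix I
    show "depends_on I (f I)" by (rule dep)
    assume "I \<subseteq> M \<and> card I = k"
    then have I: "I \<subseteq> M" by blast
    show "nrm (\<lambda>c. E I (\<lambda>c. d_down M (d_up {} (\<lambda>J. f J c)) I) c - (real m - real j) * f I c)
        \<le> real m ^ 4 * (\<theta> + \<eta>) * nrm \<phi>"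
    proof (cases "A \<subseteq> I")
      case True
      have "nrm (\<lambda>c. E I (\<lambda>c. d_down M (d_up {} (\<lambda>J. f J c)) I) c - (real m - real j) * f I c) = nrm (\<lambda>c. 0)"
        unfolding good[OF I True] E_scale
        by (rule nrm_cong) (simp add: E_of_depends_on[OF dep])
      then show ?thesis using theta_nonneg eta_pos by simp
    next
      case False
      then show ?thesis using bad[OF I False] by (simp add: f_def)
    qed
  qed (rule phi_pos)
qed

end

section \<open>Counting subspaces over a finite field\<close>

text \<open>This turns all later statements about dimension into statements about cardinality.\<close>

lemma (in vectorspace) card_eq_power_dim:
  assumes "finite (carrier K)" "finite (carrier V)"
  shows "card (carrier V) = card (carrier K) ^ dim"
proof -
  have "span (carrier V) = carrier V"
  proof (intro equalityI subsetI)
    fix v assume "v \<in> span (carrier V)"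
    then show "v \<in> carrier V" by (rule span_closed[OF order_refl])
  next
    fix v assume "v \<in> carrier V"
    then show "v \<in> span (carrier V)" by (rule span_mem[OF order_refl])
  qed
  then have "fin_dim" unfolding fin_dim_def using assms(2) by (intro exI[of _ "carrier V"]) simp
  from finite_basis_exists[OF this] obtain B where B: "finite B" "basis B" by blast
  have BV: "B \<subseteq> carrier V" using B(2) by (simp add: basis_def)
  have "bij_betw (\<lambda>a. lincomb a B) (B \<rightarrow>\<^sub>E carrier K) (carrier V)"
  proof -
    have ex1: "\<exists>!a. a \<in> B \<rightarrow>\<^sub>E carrier K \<and> lincomb a B = v" if "v \<in> carrier V" for v
      using basis_criterion[OF B(1) BV] B(2) that by blast
    have in_V: "lincomb a B \<in> carrier V" if "a \<in> B \<rightarrow>\<^sub>E carrier K" for a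
      using that by (intro lincomb_closed BV) (simp add: PiE_def)
    show ?thesis
    proof (rule bij_betwI')
      fix a b assume ab: "a \<in> B \<rightarrow>\<^sub>E carrier K" "b \<in> B \<rightarrow>\<^sub>E carrier K"
      show "(lincomb a B = lincomb b B) = (a = b)" using ex1[OF in_V[OF ab(1)]] ab by metis
    qed (use ex1 in_V in blast)+
  qed
  then have "card (carrier V) = card (B \<rightarrow>\<^sub>E carrier K)" by (metis bij_betw_same_card)
  then show ?thesis using dim_basis[OF B] B(1) by (simp add: card_funcsetE)
qed

context vectorspace
begin

definition adjoin :: "'c set \<Rightarrow> 'c \<Rightarrow> 'c set" where
  "adjoin U v = (\<lambda>(c, u). u \<oplus>\<^bsub>V\<^esub> c \<odot>\<^bsub>V\<^esub> v) ` (carrier K \<times> U)"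

lemma subspaceD:
  assumes "subspace K U V"
  shows "U \<subseteq> carrier V" "\<zero>\<^bsub>V\<^esub> \<in> U" "u \<in> U \<Longrightarrow> u' \<in> U \<Longrightarrow> u \<oplus>\<^bsub>V\<^esub> u' \<in> U"
    "c \<in> carrier K \<Longrightarrow> u \<in> U \<Longrightarrow> c \<odot>\<^bsub>V\<^esub> u \<in> U"
  using assms by (auto simp: subspace_def submodule_def)

lemma subspaceI:
  assumes "U \<subseteq> carrier V" "\<zero>\<^bsub>V\<^esub> \<in> U" "\<And>u u'. u \<in> U \<Longrightarrow> u' \<in> U \<Longrightarrow> u \<oplus>\<^bsub>V\<^esub> u' \<in> U"
    "\<And>c u. c \<in> carrier K \<Longrightarrow> u \<in> U \<Longrightarrow> c \<odot>\<^bsub>V\<^esub> u \<in> U"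
  shows "subspace K U V"
  unfolding subspace_def submodule_def using assms module_axioms vectorspace_axioms by simp

lemma adjoin_subset:
  assumes "subspace K W V" "U \<subseteq> W" "v \<in> W"
  shows "adjoin U v \<subseteq> W"
  using assms subspaceD[OF assms(1)] by (auto simp: adjoin_def)

lemma subset_adjoin:
  assumes "subspace K U V" "v \<in> carrier V"
  shows "U \<subseteq> adjoin U v" "v \<in> adjoin U v"
proof -
  note U = subspaceD[OF assms(1)]
  show "U \<subseteq> adjoin U v"
  proof
    fix u assume "u \<in> U"
    moreover have "u = u \<oplus>\<^bsub>V\<^esub> \<zero>\<^bsub>K\<^esub> \<odot>\<^bsub>V\<^esub> v" using \<open>u \<in> U\<close> U(1) assms(2) by auto
    ultimately show "u \<in> adjoin U v" unfolding adjoin_def by force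
  qed
  have "v = \<zero>\<^bsub>V\<^esub> \<oplus>\<^bsub>V\<^esub> \<one>\<^bsub>K\<^esub> \<odot>\<^bsub>V\<^esub> v" using assms(2) by simp
  then show "v \<in> adjoin U v" using U(2) unfolding adjoin_def by force
qed

lemma subspace_adjoin:
  assumes "subspace K U V" and v: "v \<in> carrier V"
  shows "subspace K (adjoin U v) V"
proof (rule subspaceI)
  note U = subspaceD[OF assms(1)]
  have UV: "u \<in> carrier V" if "u \<in> U" for u using that U(1) by blast
  show "adjoin U v \<subseteq> carrier V" using v UV by (auto simp: adjoin_def)
  show "\<zero>\<^bsub>V\<^esub> \<in> adjoin U v" using subset_adjoin[OF assms] U(2) by auto
next
  note U = subspaceD[OF assms(1)]
  have UV: "u \<in> carrier V" if "u \<in> U" for u using that U(1) by blast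
  fix x y assume "x \<in> adjoin U v" "y \<in> adjoin U v"
  then obtain c u d t where x: "x = u \<oplus>\<^bsub>V\<^esub> c \<odot>\<^bsub>V\<^esub> v" "y = t \<oplus>\<^bsub>V\<^esub> d \<odot>\<^bsub>V\<^esub> v"
    and c: "c \<in> carrier K" "d \<in> carrier K" "u \<in> U" "t \<in> U" by (auto simp: adjoin_def)
  have "x \<oplus>\<^bsub>V\<^esub> y = (u \<oplus>\<^bsub>V\<^esub> t) \<oplus>\<^bsub>V\<^esub> (c \<oplus>\<^bsub>K\<^esub> d) \<odot>\<^bsub>V\<^esub> v"
    using x c v UV by (simp add: smult_l_distr M.a_ac)
  then show "x \<oplus>\<^bsub>V\<^esub> y \<in> adjoin U v" using c U(3)[OF c(3,4)] unfolding adjoin_def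
    by (intro image_eqI[of _ _ "(c \<oplus>\<^bsub>K\<^esub> d, u \<oplus>\<^bsub>V\<^esub> t)"]) auto
next
  note U = subspaceD[OF assms(1)]
  have UV: "u \<in> carrier V" if "u \<in> U" for u using that U(1) by blast
  fix a x assume a: "a \<in> carrier K" and "x \<in> adjoin U v"
  then obtain c u where x: "x = u \<oplus>\<^bsub>V\<^esub> c \<odot>\<^bsub>V\<^esub> v" and c: "c \<in> carrier K" "u \<in> U" by (auto simp: adjoin_def)
  have "a \<odot>\<^bsub>V\<^esub> x = a \<odot>\<^bsub>V\<^esub> u \<oplus>\<^bsub>V\<^esub> (a \<otimes>\<^bsub>K\<^esub> c) \<odot>\<^bsub>V\<^esub> v"
    using x c v UV a by (simp add: smult_r_distr smult_assoc1)
  then show "a \<odot>\<^bsub>V\<^esub> x \<in> adjoin U v" using a c U(4)[OF a c(2)] unfolding adjoin_def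
    by (intro image_eqI[of _ _ "(a \<otimes>\<^bsub>K\<^esub> c, a \<odot>\<^bsub>V\<^esub> u)"]) auto
qed

lemma card_adjoin:
  assumes "subspace K U V" and v: "v \<in> carrier V" "v \<notin> U"
  shows "card (adjoin U v) = card (carrier K) * card U"
proof -
  note U = subspaceD[OF assms(1)]
  have UV: "u \<in> carrier V" if "u \<in> U" for u using that U(1) by blast
  have "inj_on (\<lambda>(c, u). u \<oplus>\<^bsub>V\<^esub> c \<odot>\<^bsub>V\<^esub> v) (carrier K \<times> U)"
  proof (rule inj_onI, clarify)
    fix c u d t assume c: "c \<in> carrier K" "d \<in> carrier K" and u: "u \<in> U" "t \<in> U"
      and eq: "u \<oplus>\<^bsub>V\<^esub> c \<odot>\<^bsub>V\<^esub> v = t \<oplus>\<^bsub>V\<^esub> d \<odot>\<^bsub>V\<^esub> v"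
    note V = UV[OF u(1)] UV[OF u(2)] v(1)
    have diff: "(c \<ominus>\<^bsub>K\<^esub> d) \<odot>\<^bsub>V\<^esub> v = t \<oplus>\<^bsub>V\<^esub> (\<ominus>\<^bsub>K\<^esub> \<one>\<^bsub>K\<^esub>) \<odot>\<^bsub>V\<^esub> u"
    proof -
      have m1: "(\<ominus>\<^bsub>K\<^esub> \<one>\<^bsub>K\<^esub>) \<odot>\<^bsub>V\<^esub> u = \<ominus>\<^bsub>V\<^esub> u" using V by (simp add: smult_l_minus)
      have "c \<odot>\<^bsub>V\<^esub> v = (u \<oplus>\<^bsub>V\<^esub> c \<odot>\<^bsub>V\<^esub> v) \<oplus>\<^bsub>V\<^esub> \<ominus>\<^bsub>V\<^esub> u" using V c
        by (metis M.a_comm M.minus_closed M.r_neg1 abelian_group.a_inv_closed M.abelian_group_axioms M.a_closed smult_closed M.a_assoc M.r_neg M.r_zero)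
      also have "\<dots> = (t \<oplus>\<^bsub>V\<^esub> \<ominus>\<^bsub>V\<^esub> u) \<oplus>\<^bsub>V\<^esub> d \<odot>\<^bsub>V\<^esub> v" unfolding eq using V c by (simp add: M.a_ac)
      finally have "c \<odot>\<^bsub>V\<^esub> v \<oplus>\<^bsub>V\<^esub> \<ominus>\<^bsub>V\<^esub> (d \<odot>\<^bsub>V\<^esub> v) = t \<oplus>\<^bsub>V\<^esub> \<ominus>\<^bsub>V\<^esub> u"
        using V c by (simp add: M.a_assoc M.r_neg)
      moreover have "(c \<ominus>\<^bsub>K\<^esub> d) \<odot>\<^bsub>V\<^esub> v = c \<odot>\<^bsub>V\<^esub> v \<oplus>\<^bsub>V\<^esub> \<ominus>\<^bsub>V\<^esub> (d \<odot>\<^bsub>V\<^esub> v)"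
        using V c by (simp add: a_minus_def smult_l_distr smult_l_minus)
      ultimately show ?thesis using m1 by simp
    qed
    have "c = d"
    proof (rule ccontr)
      assume "c \<noteq> d"
      then have nz: "c \<ominus>\<^bsub>K\<^esub> d \<noteq> \<zero>\<^bsub>K\<^esub>" "c \<ominus>\<^bsub>K\<^esub> d \<in> carrier K" using c by auto
      then have un: "inv\<^bsub>K\<^esub> (c \<ominus>\<^bsub>K\<^esub> d) \<in> carrier K" "inv\<^bsub>K\<^esub> (c \<ominus>\<^bsub>K\<^esub> d) \<otimes>\<^bsub>K\<^esub> (c \<ominus>\<^bsub>K\<^esub> d) = \<one>\<^bsub>K\<^esub>"
        using field_Units by (auto intro: Units_inv_closed Units_l_inv)
      have "(c \<ominus>\<^bsub>K\<^esub> d) \<odot>\<^bsub>V\<^esub> v \<in> U" unfolding diff by (intro U(3,4) u) auto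
      then have "inv\<^bsub>K\<^esub> (c \<ominus>\<^bsub>K\<^esub> d) \<odot>\<^bsub>V\<^esub> ((c \<ominus>\<^bsub>K\<^esub> d) \<odot>\<^bsub>V\<^esub> v) \<in> U" by (rule U(4)[OF un(1)])
      then have "v \<in> U" using un nz v(1) by (simp add: smult_assoc1[symmetric])
      then show False using v by simp
    qed
    then show "c = d \<and> u = t" using eq V c by (simp add: M.add.right_cancel)
  qed
  then have "card (adjoin U v) = card (carrier K \<times> U)" unfolding adjoin_def by (rule card_image)
  then show ?thesis by (simp add: card_cartesian_product)
qed

text \<open>Each vector of \<open>W - U\<close> lies in exactly one such \<open>X\<close>, the subspace obtained by adjoining it to \<open>U\<close>.\<close>

lemma count_subspaces_above:
  assumes fin: "finite (carrier K)" "finite (carrier V)"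
    and U: "subspace K U V" and W: "subspace K W V" "U \<subseteq> W"
  shows "card {X. subspace K X V \<and> U \<subseteq> X \<and> X \<subseteq> W \<and> card X = card (carrier K) * card U}
      * (card (carrier K) * card U - card U) = card W - card U"
proof -
  let ?q = "card (carrier K)"
  define P where "P = {X. subspace K X V \<and> U \<subseteq> X \<and> X \<subseteq> W \<and> card X = ?q * card U}"
  have finW: "finite W" using fin(2) subspaceD(1)[OF W(1)] finite_subset by blast
  have finU: "finite U" using finW W(2) finite_subset by blast
  have finP: "finite P" by (rule finite_subset[of _ "Pow W"]) (auto simp: P_def finW)
  have "W - U = (\<Union>X\<in>P. X - U)"
  proof (intro equalityI subsetI)
    fix v assume v: "v \<in> W - U"
    then have vV: "v \<in> carrier V" using subspaceD(1)[OF W(1)] by blast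
    have "adjoin U v \<in> P" using v subspace_adjoin[OF U vV] subset_adjoin[OF U vV] card_adjoin[OF U vV]
      adjoin_subset[OF W(1,2)] by (auto simp: P_def)
    then show "v \<in> (\<Union>X\<in>P. X - U)" using subset_adjoin(2)[OF U vV] v by blast
  qed (auto simp: P_def)
  then have "card W - card U = card (\<Union>X\<in>P. X - U)"
    using card_Diff_subset[OF finU W(2)] by simp
  also have "\<dots> = (\<Sum>X\<in>P. card (X - U))"
  proof (rule card_UN_disjoint[OF finP])
    show "\<forall>X\<in>P. finite (X - U)" using finW finite_subset by (auto simp: P_def)
    show "\<forall>X\<in>P. \<forall>Y\<in>P. X \<noteq> Y \<longrightarrow> (X - U) \<inter> (Y - U) = {}"
    proof (intro ballI impI, rule ccontr)
      fix X Y assume XY: "X \<in> P" "Y \<in> P" "X \<noteq> Y" "(X - U) \<inter> (Y - U) \<noteq> {}"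
      then obtain v where v: "v \<in> X" "v \<in> Y" "v \<notin> U" by blast
      then have vV: "v \<in> carrier V" using XY(1) subspaceD(1)[OF W(1)] by (auto simp: P_def)
      have "adjoin U v = Z" if "Z \<in> P" "v \<in> Z" for Z
      proof (rule card_subset_eq)
        show "finite Z" using that finW finite_subset by (auto simp: P_def)
        show "adjoin U v \<subseteq> Z" using that by (intro adjoin_subset) (auto simp: P_def)
        show "card (adjoin U v) = card Z" using that card_adjoin[OF U vV v(3)] by (simp add: P_def)
      qed
      then show False using XY v by blast
    qed
  qed
  also have "\<dots> = (\<Sum>X\<in>P. ?q * card U - card U)"
    by (intro sum.cong refl) (use finU in \<open>auto simp: P_def card_Diff_subset\<close>)
  finally show ?thesis by (simp add: P_def)
qed

end

section \<open>Flags of subspaces\<close>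

locale finite_coordinate_space =
  fixes K :: "('a, 'b) ring_scheme" and n :: nat
  assumes field_K: "field K" and finite_K: "finite (carrier K)" and n_ge_2: "2 \<le> n"
begin

abbreviation "CS \<equiv> coord_space K n"
abbreviation "q \<equiv> card (carrier K)"
abbreviation "sub W \<equiv> subspace K W CS"
abbreviation "dm W \<equiv> subspace_dim K n W"
abbreviation "Vert \<equiv> building_vertices K n"
abbreviation "Flags \<equiv> building_simplices K n (n - 2)"
abbreviation "m \<equiv> n - 1"

lemma vs_CS: "vectorspace K CS"
proof -
  interpret field K by (rule field_K)
  show ?thesis unfolding vectorspace_def using func_space_is_module field_K by blast
qed

sublocale CS: vectorspace K CS by (rule vs_CS)

lemma carrier_CS: "carrier CS = {..<n} \<rightarrow>\<^sub>E carrier K"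
  by (simp add: CS.func_space_def)

lemma finite_CS: "finite (carrier CS)"
  unfolding carrier_CS using finite_K by (intro finite_PiE) auto

lemma card_CS: "card (carrier CS) = q ^ n"
  unfolding carrier_CS by (simp add: card_funcsetE)

lemma q_ge_2: "2 \<le> q"
proof -
  have "\<zero>\<^bsub>K\<^esub> \<noteq> \<one>\<^bsub>K\<^esub>" by simp
  then have "card {\<zero>\<^bsub>K\<^esub>, \<one>\<^bsub>K\<^esub>} = 2" by simp
  then show ?thesis using card_mono[OF finite_K, of "{\<zero>\<^bsub>K\<^esub>, \<one>\<^bsub>K\<^esub>}"] by simp
qed

lemma pow_inj: "q ^ a = q ^ b \<longleftrightarrow> a = b"
  using q_ge_2 by (intro power_inject_exp) simp

lemma pow_less: "q ^ a < q ^ b \<longleftrightarrow> a < b"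
  using q_ge_2 by (intro power_strict_increasing_iff) simp

lemma pow_le: "q ^ a \<le> q ^ b \<longleftrightarrow> a \<le> b"
  using q_ge_2 by (intro power_increasing_iff) simp

lemma sub_finite: "sub W \<Longrightarrow> finite W"
  using CS.subspaceD(1) finite_CS finite_subset by blast

lemma card_sub: "sub W \<Longrightarrow> card W = q ^ dm W"
proof -
  assume W: "sub W"
  interpret W: vectorspace K "CS\<lparr>carrier := W\<rparr>" by (rule CS.subspace_is_vs[OF W])
  show ?thesis
    using W.card_eq_power_dim[OF finite_K] sub_finite[OF W] by (simp add: subspace_dim_def)
qed

lemma dm_eqI: "sub W \<Longrightarrow> card W = q ^ k \<Longrightarrow> dm W = k"
  using card_sub pow_inj by simp

lemma sub_mono: "sub U \<Longrightarrow> sub W \<Longrightarrow> U \<subseteq> W \<Longrightarrow> dm U \<le> dm W"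
  using card_mono[OF sub_finite, of W U] by (simp add: card_sub pow_le)

lemma sub_eq: "sub U \<Longrightarrow> sub W \<Longrightarrow> U \<subseteq> W \<Longrightarrow> dm U = dm W \<Longrightarrow> U = W"
  by (rule card_subset_eq[OF sub_finite]) (simp_all add: card_sub)

lemma sub_zero: "sub {\<zero>\<^bsub>CS\<^esub>}" "dm {\<zero>\<^bsub>CS\<^esub>} = 0"
proof -
  show *: "sub {\<zero>\<^bsub>CS\<^esub>}" by (rule CS.subspaceI) auto
  show "dm {\<zero>\<^bsub>CS\<^esub>} = 0" by (rule dm_eqI[OF *]) simp
qed

lemma sub_carrier: "sub (carrier CS)" "dm (carrier CS) = n"
proof -
  show *: "sub (carrier CS)" by (rule CS.subspaceI) auto
  show "dm (carrier CS) = n" by (rule dm_eqI[OF *]) (rule card_CS)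
qed

lemma Vert_iff: "W \<in> Vert \<longleftrightarrow> sub W \<and> dm W \<in> {1..m}"
proof -
  have "W \<noteq> {\<zero>\<^bsub>CS\<^esub>} \<longleftrightarrow> dm W \<noteq> 0" "W \<noteq> carrier CS \<longleftrightarrow> dm W \<noteq> n" if W: "sub W"
    using sub_eq[OF sub_zero(1) W] sub_eq[OF W sub_carrier(1)] sub_zero(2) sub_carrier(2)
      CS.subspaceD(1,2)[OF W] by auto
  moreover have "dm W \<le> n" if W: "sub W"
    using sub_mono[OF W sub_carrier(1)] CS.subspaceD(1)[OF W] sub_carrier(2) by simp
  ultimately show ?thesis unfolding building_vertices_def by fastforce
qed

definition chain :: "(nat \<Rightarrow> 'a) set set \<Rightarrow> bool" where
  "chain s \<longleftrightarrow> s \<subseteq> Vert \<and> (\<forall>U\<in>s. \<forall>W\<in>s. U \<subseteq> W \<or> W \<subseteq> U)"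

lemma finite_Vert: "finite Vert"
proof (rule finite_subset)
  show "Vert \<subseteq> Pow (carrier CS)" using CS.subspaceD(1) unfolding Vert_iff subset_iff by blast
qed (simp add: finite_CS)

lemma chain_finite: "chain s \<Longrightarrow> finite s"
  using finite_Vert finite_subset by (auto simp: chain_def)

lemma simplices_iff: "s \<in> building_simplices K n i \<longleftrightarrow> chain s \<and> card s = i + 1"
  unfolding building_simplices_def mem_Collect_eq using chain_finite[of s] unfolding chain_def by metis

lemma chain_Vert: "chain s \<Longrightarrow> x \<in> s \<Longrightarrow> x \<in> Vert"
  unfolding chain_def by (elim conjE) (erule subsetD)

lemma chain_sub: "chain s \<Longrightarrow> x \<in> s \<Longrightarrow> sub x"
  using chain_Vert[of s x] unfolding Vert_iff by simp

lemma chain_dm: "chain s \<Longrightarrow> x \<in> s \<Longrightarrow> dm x \<in> {1..m}"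
  using chain_Vert[of s x] unfolding Vert_iff by simp

lemma chain_le:
  assumes "chain s" "x \<in> s" "y \<in> s"
  shows "x \<subseteq> y \<longleftrightarrow> dm x \<le> dm y"
proof
  assume "x \<subseteq> y"
  then show "dm x \<le> dm y" using assms chain_sub sub_mono by blast
next
  assume le: "dm x \<le> dm y"
  have "x \<subseteq> y \<or> y \<subseteq> x" using assms unfolding chain_def by blast
  then show "x \<subseteq> y"
  proof
    assume "y \<subseteq> x"
    then have "dm y \<le> dm x" using assms chain_sub sub_mono by blast
    then show ?thesis using sub_eq[OF chain_sub chain_sub \<open>y \<subseteq> x\<close>] assms le by force
  qed
qed

lemma chain_inj: "chain s \<Longrightarrow> inj_on dm s"
  by (rule inj_onI) (metis chain_le order_refl subset_antisym)

lemma chain_mono: "chain s \<Longrightarrow> t \<subseteq> s \<Longrightarrow> chain t"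
  unfolding chain_def by blast

lemma card_chain: "chain s \<Longrightarrow> card (dm ` s) = card s"
  by (rule card_image[OF chain_inj])

lemma chain_dm_subset: "chain s \<Longrightarrow> dm ` s \<subseteq> {1..m}"
  using chain_dm by blast

lemma chain_insert:
  assumes "chain s" "X \<in> Vert" "\<And>x. x \<in> s \<Longrightarrow> x \<subseteq> X \<or> X \<subseteq> x"
  shows "chain (insert X s)"
  using assms unfolding chain_def by blast

lemma Flags_iff: "c \<in> Flags \<longleftrightarrow> chain c \<and> dm ` c = {1..m}"
proof
  assume "c \<in> Flags"
  then have c: "chain c" "card c = m" using n_ge_2 by (auto simp: simplices_iff)
  then have "dm ` c = {1..m}" using chain_dm_subset[OF c(1)] card_chain[OF c(1)]
    by (intro card_subset_eq) auto
  then show "chain c \<and> dm ` c = {1..m}" using c by simp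
next
  assume "chain c \<and> dm ` c = {1..m}"
  then show "c \<in> Flags" using card_chain[of c] n_ge_2 by (simp add: simplices_iff)
qed

lemma finite_Flags: "finite Flags"
  by (rule finite_subset[of _ "Pow Vert"]) (auto simp: Flags_iff chain_def finite_Vert)

definition fill :: "(nat \<Rightarrow> 'a) set set \<Rightarrow> nat \<Rightarrow> (nat \<Rightarrow> 'a) set set" where
  "fill s t = {X. X \<in> Vert \<and> dm X = t \<and> chain (insert X s)}"

lemma chain_least_above:
  assumes s: "chain s" and t: "t < n"
  obtains W where "sub W" "t < dm W" "\<And>x. x \<in> s \<Longrightarrow> t < dm x \<Longrightarrow> W \<subseteq> x" "W \<in> insert (carrier CS) s"
    "dm W = Min {d \<in> insert n (dm ` s). t < d}"
proof -
  define D where "D = {d \<in> insert n (dm ` s). t < d}"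
  have D: "finite D" "n \<in> D" using chain_finite[OF s] t by (auto simp: D_def)
  have min: "Min D \<in> D" using D by (intro Min_in) auto
  have le: "Min D \<le> dm x" if "x \<in> s" "t < dm x" for x
    using that D(1) by (intro Min_le) (auto simp: D_def)
  show ?thesis
  proof (cases "Min D \<in> dm ` s")
    case True
    then obtain W where W: "W \<in> s" "dm W = Min D" by auto
    show ?thesis
      by (rule that[of W]) (use W min le chain_sub[OF s] chain_le[OF s] in \<open>auto simp: D_def\<close>)
  next
    case False
    then have 0: "Min D = n" using min by (auto simp: D_def)
    have "\<not> t < dm x" if "x \<in> s" for x using le[OF that] 0 chain_dm[OF s that] n_ge_2 by auto
    then show ?thesis
      by (intro that[of "carrier CS"]) (use 0 t sub_carrier in \<open>auto simp: D_def\<close>)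
  qed
qed

text \<open>The candidates lie between the neighbours of dimension \<open>t - 1\<close> and of the next dimension present in the
  flag (zero and the whole space serve as neighbours at the ends), so the count depends on dimensions only.\<close>

lemma card_fill:
  assumes s: "chain s" and t: "t \<in> {1..m}" "t \<notin> dm ` s" "{1..<t} \<subseteq> dm ` s"
  shows "card (fill s t) * (q ^ t - q ^ (t - 1)) = q ^ Min {d \<in> insert n (dm ` s). t < d} - q ^ (t - 1)"
proof -
  have "\<exists>U. sub U \<and> dm U = t - 1 \<and> U \<in> insert {\<zero>\<^bsub>CS\<^esub>} s"
  proof (cases "t = 1")
    case False
    then have "t - 1 \<in> dm ` s" using t by auto
    then show ?thesis using chain_sub[OF s] by fastforce
  qed (use sub_zero in auto)
  then obtain U where U: "sub U" "dm U = t - 1" "U \<in> insert {\<zero>\<^bsub>CS\<^esub>} s" by blast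
  have below: "x \<subseteq> U" if x: "x \<in> s" "dm x < t" for x
  proof -
    have "U \<in> s" using U(2,3) x chain_dm[OF s x(1)] sub_zero(2) by auto
    then show ?thesis using chain_le[OF s x(1)] U(2) x(2) by simp
  qed
  obtain W where W: "sub W" "t < dm W" "\<And>x. x \<in> s \<Longrightarrow> t < dm x \<Longrightarrow> W \<subseteq> x" "W \<in> insert (carrier CS) s"
    "dm W = Min {d \<in> insert n (dm ` s). t < d}"
    by (rule chain_least_above[OF s, of t]) (use t n_ge_2 in auto)
  have dU: "dm U < t" using U(2) t(1) by simp
  have UW: "U \<subseteq> W"
  proof (cases "U \<in> s \<and> W \<in> s")
    case True
    then show ?thesis using chain_le[OF s, of U W] dU W(2) by simp
  next
    case False
    then show ?thesis using U(3) W(4) CS.subspaceD(1)[OF U(1)] CS.subspaceD(2)[OF W(1)] by auto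
  qed
  have tpow: "q * q ^ (t - 1) = q ^ t" using t(1) by (cases t) auto
  have "fill s t = {X. sub X \<and> U \<subseteq> X \<and> X \<subseteq> W \<and> card X = q * card U}"
  proof (intro equalityI subsetI)
    fix X assume "X \<in> fill s t"
    then have X: "X \<in> Vert" "dm X = t" "chain (insert X s)" by (auto simp: fill_def)
    have sX: "sub X" using X(1) by (simp add: Vert_iff)
    have "U \<subseteq> X"
    proof (cases "U \<in> s")
      case True
      then show ?thesis using chain_le[OF X(3), of U X] dU X(2) by simp
    next
      case False
      then show ?thesis using U(3) CS.subspaceD(2)[OF sX] by auto
    qed
    moreover have "X \<subseteq> W"
    proof (cases "W \<in> s")
      case True
      then show ?thesis using chain_le[OF X(3), of X W] W(2) X(2) by simp
    next
      case False
      then show ?thesis using W(4) CS.subspaceD(1)[OF sX] by auto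
    qed
    ultimately show "X \<in> {X. sub X \<and> U \<subseteq> X \<and> X \<subseteq> W \<and> card X = q * card U}"
      using sX X(2) tpow by (simp add: card_sub U(1,2))
  next
    fix X assume "X \<in> {X. sub X \<and> U \<subseteq> X \<and> X \<subseteq> W \<and> card X = q * card U}"
    then have X: "sub X" "U \<subseteq> X" "X \<subseteq> W" "card X = q * card U" by auto
    have dX: "dm X = t" by (rule dm_eqI[OF X(1)]) (use X(4) tpow in \<open>simp add: card_sub U(1,2)\<close>)
    have XV: "X \<in> Vert" using X(1) dX t(1) by (simp add: Vert_iff)
    have "chain (insert X s)"
    proof (rule chain_insert[OF s XV])
      fix x assume x: "x \<in> s"
      then have "dm x \<noteq> t" using t(2) by auto
      then show "x \<subseteq> X \<or> X \<subseteq> x" using below[OF x] W(3)[OF x] X(2,3) by (cases "dm x < t") auto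
    qed
    then show "X \<in> fill s t" using XV dX by (simp add: fill_def)
  qed
  then show ?thesis
    using CS.count_subspaces_above[OF finite_K finite_CS U(1) W(1) UW]
    unfolding card_sub[OF U(1)] card_sub[OF W(1)] U(2) tpow W(5) by (simp only:)
qed

definition wt :: "(nat \<Rightarrow> 'a) set set \<Rightarrow> nat" where
  "wt s = card {c \<in> Flags. s \<subseteq> c}"

lemma weight_eq: "weight K n s = wt s"
  by (simp add: weight_def wt_def)

lemma wt_full:
  assumes "chain s" "dm ` s = {1..m}"
  shows "wt s = 1"
proof -
  have "{c \<in> Flags. s \<subseteq> c} = {s}"
  proof (intro equalityI subsetI)
    fix c assume "c \<in> {c \<in> Flags. s \<subseteq> c}"
    then have c: "chain c" "dm ` c = {1..m}" "s \<subseteq> c" by (auto simp: Flags_iff)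
    have "s = c" using c card_chain[OF c(1)] card_chain[OF assms(1)] assms(2) chain_finite[OF c(1)]
      by (intro card_subset_eq) auto
    then show "c \<in> {s}" by simp
  qed (use assms in \<open>auto simp: Flags_iff\<close>)
  then show ?thesis by (simp add: wt_def)
qed

lemma wt_fill:
  assumes s: "chain s" and t: "t \<in> {1..m}"
  shows "wt s = (\<Sum>X\<in>fill s t. wt (insert X s))"
proof -
  have fin: "finite (fill s t)" by (rule finite_subset[OF _ finite_Vert]) (auto simp: fill_def)
  have "{c \<in> Flags. s \<subseteq> c} = (\<Union>X\<in>fill s t. {c \<in> Flags. insert X s \<subseteq> c})"
  proof (intro equalityI subsetI)
    fix c assume "c \<in> {c \<in> Flags. s \<subseteq> c}"
    then have c: "c \<in> Flags" "chain c" "dm ` c = {1..m}" "s \<subseteq> c" by (auto simp: Flags_iff)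
    then obtain X where X: "X \<in> c" "dm X = t" using t by (metis imageE)
    have "X \<in> fill s t" unfolding fill_def
      using X c(2) chain_mono[OF c(2), of "insert X s"] c(4) by (auto simp: chain_def)
    then show "c \<in> (\<Union>X\<in>fill s t. {c \<in> Flags. insert X s \<subseteq> c})" using X c by auto
  qed auto
  then have "wt s = card (\<Union>X\<in>fill s t. {c \<in> Flags. insert X s \<subseteq> c})" by (simp add: wt_def)
  also have "\<dots> = (\<Sum>X\<in>fill s t. card {c \<in> Flags. insert X s \<subseteq> c})"
  proof (rule card_UN_disjoint[OF fin])
    show "\<forall>X\<in>fill s t. \<forall>Y\<in>fill s t. X \<noteq> Y \<longrightarrow> {c \<in> Flags. insert X s \<subseteq> c} \<inter> {c \<in> Flags. insert Y s \<subseteq> c} = {}"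
    proof (intro ballI impI, rule ccontr)
      fix X Y assume XY: "X \<in> fill s t" "Y \<in> fill s t" "X \<noteq> Y"
        "{c \<in> Flags. insert X s \<subseteq> c} \<inter> {c \<in> Flags. insert Y s \<subseteq> c} \<noteq> {}"
      then obtain c where "c \<in> Flags" "X \<in> c" "Y \<in> c" by blast
      then show False using XY chain_inj[of c] by (auto simp: fill_def Flags_iff inj_on_def)
    qed
  qed (use finite_Flags in auto)
  finally show ?thesis by (simp add: wt_def)
qed

lemma card_fill_pos:
  assumes s: "chain s" and t: "t \<in> {1..m}" "t \<notin> dm ` s" "{1..<t} \<subseteq> dm ` s"
  shows "card (fill s t) > 0"
proof -
  have "Min {d \<in> insert n (dm ` s). t < d} \<in> {d \<in> insert n (dm ` s). t < d}"
    using chain_finite[OF s] t(1) n_ge_2 by (intro Min_in) auto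
  then have "t - 1 < Min {d \<in> insert n (dm ` s). t < d}" by auto
  then have "q ^ (t - 1) < q ^ Min {d \<in> insert n (dm ` s). t < d}" by (simp only: pow_less)
  then have "card (fill s t) * (q ^ t - q ^ (t - 1)) > 0" unfolding card_fill[OF assms] by simp
  then show ?thesis by (metis mult_is_0 not_gr_zero)
qed

text \<open>Fill the smallest missing dimension first: the number of choices depends on the type of the flag only.\<close>

lemma wt_pos_uniform:
  "chain s \<Longrightarrow> chain s' \<Longrightarrow> dm ` s = dm ` s' \<Longrightarrow> wt s > 0 \<and> wt s = wt s'"
proof (induction "card ({1..m} - dm ` s)" arbitrary: s s' rule: less_induct)
  case less
  note s = less.prems
  show ?case
  proof (cases "{1..m} \<subseteq> dm ` s")
    case True
    then have "dm ` s = {1..m}" using chain_dm_subset[OF s(1)] by blast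
    then show ?thesis using wt_full s by simp
  next
    case False
    define t where "t = Min ({1..m} - dm ` s)"
    have ne: "finite ({1..m} - dm ` s)" "{1..m} - dm ` s \<noteq> {}" using False by auto
    have "t \<in> {1..m} - dm ` s" unfolding t_def using ne by (rule Min_in)
    then have t: "t \<in> {1..m}" "t \<notin> dm ` s" by auto
    have "{1..<t} \<subseteq> dm ` s"
    proof
      fix u assume u: "u \<in> {1..<t}"
      show "u \<in> dm ` s"
      proof (rule ccontr)
        assume "u \<notin> dm ` s"
        then have "t \<le> u" unfolding t_def using u t(1) ne(1) by (intro Min_le) auto
        then show False using u by simp
      qed
    qed
    note t = t this
    have IH: "wt (insert X s) > 0 \<and> wt (insert X s) = wt (insert Y s'')"
      if "X \<in> fill s t" "Y \<in> fill s'' t" "dm ` s'' = dm ` s" for X Y s''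
    proof (rule less.hyps)
      have "{1..m} - dm ` insert X s \<subset> {1..m} - dm ` s" using that(1) t by (auto simp: fill_def)
      then show "card ({1..m} - dm ` insert X s) < card ({1..m} - dm ` s)"
        by (intro psubset_card_mono) auto
    qed (use that in \<open>auto simp: fill_def\<close>)
    have pos: "card (fill s t) > 0" by (rule card_fill_pos[OF s(1) t])
    then obtain X0 where X0: "X0 \<in> fill s t" by (auto simp: card_gt_0_iff)
    have 1: "wt s = card (fill s t) * wt (insert X0 s)"
    proof -
      have "wt s = (\<Sum>X\<in>fill s t. wt (insert X s))" by (rule wt_fill[OF s(1) t(1)])
      also have "\<dots> = (\<Sum>X\<in>fill s t. wt (insert X0 s))"
        by (rule sum.cong[OF refl]) (use IH[OF _ X0] in auto)
      finally show ?thesis by simp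
    qed
    have 2: "wt s' = card (fill s' t) * wt (insert X0 s)"
    proof -
      have "wt s' = (\<Sum>X\<in>fill s' t. wt (insert X s'))" by (rule wt_fill[OF s(2) t(1)])
      also have "\<dots> = (\<Sum>X\<in>fill s' t. wt (insert X0 s))"
        by (rule sum.cong[OF refl]) (use IH[OF X0] s(3) in auto)
      finally show ?thesis by simp
    qed
    have "card (fill s t) = card (fill s' t)"
    proof -
      have "card (fill s t) * (q ^ t - q ^ (t - 1)) = card (fill s' t) * (q ^ t - q ^ (t - 1))"
        using card_fill[OF s(1) t] card_fill[OF s(2), of t] t s(3) by simp
      moreover have "q ^ (t - 1) < q ^ t" using t(1) unfolding pow_less by simp
      ultimately show ?thesis by simp
    qed
    then show ?thesis using 1 2 pos IH[OF X0 X0 refl] by simp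
  qed
qed

lemma wt_pos: "chain s \<Longrightarrow> wt s > 0"
  using wt_pos_uniform by blast

lemma chain_extend: "chain s \<Longrightarrow> \<exists>c\<in>Flags. s \<subseteq> c"
  using wt_pos[of s] unfolding wt_def by (auto simp: card_gt_0_iff)

sublocale F: flags Flags dm m
proof
  show "finite Flags" by (rule finite_Flags)
  have "chain {}" by (simp add: chain_def)
  then show "Flags \<noteq> {}" using chain_extend by blast
  show "bij_betw dm c {1..m}" if "c \<in> Flags" for c
    using that chain_inj unfolding Flags_iff bij_betw_def by blast
qed

lemma Flags_chain: "c \<in> Flags \<Longrightarrow> chain c"
  by (simp add: Flags_iff)

lemma part_subset: "F.part I c \<subseteq> c"
  by (auto simp: F.part_def)

lemma chain_part: "c \<in> Flags \<Longrightarrow> chain (F.part I c)"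
  by (rule chain_mono[OF Flags_chain part_subset])

lemma Flags_element:
  assumes "c \<in> Flags" "a \<in> {1..m}"
  obtains x where "x \<in> c" "dm x = a"
proof -
  have "a \<in> dm ` c" using assms by (simp add: Flags_iff)
  then show ?thesis using that by blast
qed

lemma dm_part:
  assumes "c \<in> Flags" "I \<subseteq> {1..m}"
  shows "dm ` F.part I c = I"
proof (intro equalityI subsetI)
  fix a assume "a \<in> I"
  moreover then obtain x where "x \<in> c" "dm x = a" using Flags_element[OF assms(1)] assms(2) by blast
  ultimately show "a \<in> dm ` F.part I c" by (force simp: F.part_def)
qed (auto simp: F.part_def)

lemma part_eq_iff_subset:
  assumes "c \<in> Flags" "d \<in> Flags" "I \<subseteq> {1..m}"
  shows "F.part I d = F.part I c \<longleftrightarrow> F.part I c \<subseteq> d"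
proof
  assume "F.part I d = F.part I c"
  then show "F.part I c \<subseteq> d" using part_subset by metis
next
  assume "F.part I c \<subseteq> d"
  then have sub: "F.part I c \<subseteq> F.part I d" by (auto simp: F.part_def)
  have "card (F.part I c) = card (F.part I d)"
    using card_chain[OF chain_part[OF assms(1)], of I] card_chain[OF chain_part[OF assms(2)], of I]
      dm_part[OF assms(1,3)] dm_part[OF assms(2,3)] by simp
  then show "F.part I d = F.part I c"
    using card_subset_eq[OF chain_finite[OF chain_part[OF assms(2)]] sub] by simp
qed

lemma card_cell_eq_wt:
  assumes "c \<in> Flags" "I \<subseteq> {1..m}"
  shows "card (F.cell I c) = wt (F.part I c)"
proof -
  have "F.cell I c = {d \<in> Flags. F.part I c \<subseteq> d}"
    unfolding F.cell_def using part_eq_iff_subset[OF assms(1) _ assms(2)] by (intro Collect_cong) metis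
  then show ?thesis by (simp only: wt_def)
qed

lemma thick_flags:
  assumes a: "a \<in> {1..m}" and c: "c \<in> Flags"
  shows "q \<le> card (F.cell ({1..m} - {a}) c)"
proof -
  define s where "s = F.part ({1..m} - {a}) c"
  have s: "chain s" "dm ` s = {1..m} - {a}"
    unfolding s_def using chain_part[OF c] dm_part[OF c, of "{1..m} - {a}"] by auto
  have "card (F.cell ({1..m} - {a}) c) = wt s" unfolding s_def by (rule card_cell_eq_wt[OF c]) auto
  also have "\<dots> = (\<Sum>X\<in>fill s a. wt (insert X s))" by (rule wt_fill[OF s(1) a])
  also have "\<dots> = (\<Sum>X\<in>fill s a. 1)"
  proof (rule sum.cong[OF refl], rule wt_full)
    fix X assume "X \<in> fill s a"
    then have "chain (insert X s)" "dm X = a" unfolding fill_def by simp_all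
    then show "chain (insert X s)" "dm ` insert X s = {1..m}"
      using a unfolding image_insert s(2) by (simp_all only: insert_Diff)
  qed
  finally have card: "card (F.cell ({1..m} - {a}) c) = card (fill s a)" by simp
  have min: "Min {d \<in> insert n (dm ` s). a < d} = a + 1"
  proof (rule Min_eqI)
    show "finite {d \<in> insert n (dm ` s). a < d}" unfolding s(2) by simp
    show "a + 1 \<in> {d \<in> insert n (dm ` s). a < d}" unfolding s(2) using a n_ge_2 by auto
  qed auto
  define Q where "Q = q ^ (a - 1)"
  obtain a' where a': "a = Suc a'" using a by (cases a) auto
  have "card (fill s a) * (q * Q - Q) = q * (q * Q) - Q"
    using card_fill[OF s(1) a] s(2) a min unfolding Q_def a' by force
  moreover have "q * (q * Q - Q) \<le> q * (q * Q) - Q"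
    unfolding diff_mult_distrib2 using q_ge_2 by (intro diff_le_mono2) simp
  ultimately have "q * (q * Q - Q) \<le> card (fill s a) * (q * Q - Q)" by simp
  moreover have "0 < q * Q - Q" using q_ge_2 by (simp add: Q_def)
  ultimately show ?thesis unfolding card by (simp only: mult_le_cancel2)
qed

lemma part_memD: "x \<in> F.part I c \<Longrightarrow> x \<in> c \<and> dm x \<in> I"
  by (simp add: F.part_def)

lemma part_memI: "x \<in> c \<Longrightarrow> dm x \<in> I \<Longrightarrow> x \<in> F.part I c"
  by (simp add: F.part_def)

lemma dm_unique: "c \<in> Flags \<Longrightarrow> x \<in> c \<Longrightarrow> y \<in> c \<Longrightarrow> dm x = dm y \<Longrightarrow> x = y"
  using chain_inj[OF Flags_chain] by (auto dest: inj_onD)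

lemma part_singleton: "c \<in> Flags \<Longrightarrow> x \<in> c \<Longrightarrow> F.part {dm x} c = {x}"
  using dm_unique by (auto simp: F.part_def)

text \<open>The two subspaces share their \<open>(a - 1)\<close>-dimensional neighbour \<open>U\<close>, so a vector \<open>v\<close> of the second that is
  outside the first one generates the second over \<open>U\<close>. Adjoining \<open>v\<close> to the first gives the span.\<close>

lemma span_of_two:
  assumes a: "a \<in> {1..m}" "{1..a} \<subseteq> I" "I \<subseteq> {1..m}" and c: "c \<in> Flags" "d \<in> Flags"
    and eq: "F.part (I - {a}) c = F.part (I - {a}) d"
    and V: "V \<in> c" "dm V = a" and V': "V' \<in> d" "dm V' = a" and ne: "V \<noteq> V'"
  obtains L where "sub L" "dm L = a + 1" "V \<subseteq> L" "V' \<subseteq> L" "\<And>Z. sub Z \<Longrightarrow> V \<subseteq> Z \<Longrightarrow> V' \<subseteq> Z \<Longrightarrow> L \<subseteq> Z"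
proof -
  have sV: "sub V" "sub V'" using V V' c Flags_chain chain_sub by blast+
  have "\<not> V' \<subseteq> V" using sub_eq[OF sV(2,1)] V V' ne by auto
  then obtain v where v: "v \<in> V'" "v \<notin> V" by blast
  have vCS: "v \<in> carrier CS" using CS.subspaceD(1)[OF sV(2)] v by blast
  have "\<exists>U. sub U \<and> dm U = a - 1 \<and> U \<subseteq> V \<and> U \<subseteq> V'"
  proof (cases "a = 1")
    case True
    then show ?thesis using sub_zero CS.subspaceD(2)[OF sV(1)] CS.subspaceD(2)[OF sV(2)]
      by (intro exI[of _ "{\<zero>\<^bsub>CS\<^esub>}"]) auto
  next
    case False
    then have a1: "a - 1 \<in> {1..m}" "a - 1 \<in> I - {a}" using a by auto
    obtain U where U: "U \<in> c" "dm U = a - 1" by (rule Flags_element[OF c(1) a1(1)])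
    have "U \<in> F.part (I - {a}) c" by (rule part_memI) (use U a1 in auto)
    then have Ud: "U \<in> d" unfolding eq using part_memD by blast
    have "U \<subseteq> V" using chain_le[OF Flags_chain[OF c(1)] U(1) V(1)] U V by simp
    moreover have "U \<subseteq> V'" using chain_le[OF Flags_chain[OF c(2)] Ud V'(1)] U V' by simp
    ultimately show ?thesis using U chain_sub[OF Flags_chain[OF c(1)]] by blast
  qed
  then obtain U where U: "sub U" "dm U = a - 1" "U \<subseteq> V" "U \<subseteq> V'" by blast
  obtain a' where a': "a = Suc a'" using a by (cases a) auto
  have "CS.adjoin U v = V'"
  proof (rule card_subset_eq[OF sub_finite[OF sV(2)]])
    show "CS.adjoin U v \<subseteq> V'" by (rule CS.adjoin_subset[OF sV(2) U(4) v(1)])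
    have "v \<notin> U" using v U by blast
    then show "card (CS.adjoin U v) = card V'"
      using CS.card_adjoin[OF U(1) vCS] by (simp add: card_sub U(1,2) sV V' a')
  qed
  define L where "L = CS.adjoin V v"
  have L: "sub L" "V \<subseteq> L" "v \<in> L"
    unfolding L_def using CS.subspace_adjoin[OF sV(1) vCS] CS.subset_adjoin[OF sV(1) vCS] by auto
  have dL: "dm L = a + 1"
    by (rule dm_eqI[OF L(1)]) (use CS.card_adjoin[OF sV(1) vCS v(2)] in \<open>simp add: L_def card_sub sV V\<close>)
  have "V' \<subseteq> L" unfolding \<open>CS.adjoin U v = V'\<close>[symmetric]
    by (rule CS.adjoin_subset[OF L(1) _ L(3)]) (use U L in blast)
  moreover have "L \<subseteq> Z" if "sub Z" "V \<subseteq> Z" "V' \<subseteq> Z" for Z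
    unfolding L_def by (rule CS.adjoin_subset[OF that(1,2)]) (use that v in blast)
  ultimately show ?thesis using that L dL by blast
qed

text \<open>The member at level \<open>a + 1\<close> is the span \<open>L\<close> of the two differing members \<open>V\<close> and \<open>V'\<close>. A flag that remains
  a flag when \<open>V'\<close> replaces \<open>V\<close> has a member of dimension \<open>a + 1\<close> above both, which must be \<open>L\<close>; conversely
  the replacement is possible below \<open>L\<close>.\<close>

lemma join_flags:
  assumes a: "a \<in> {1..m}" "a < m" "{1..a} \<subseteq> I" "I \<subseteq> {1..m}" and c: "c \<in> Flags" "d \<in> Flags"
    and eq: "F.part (I - {a}) c = F.part (I - {a}) d" and neq: "F.part I c \<noteq> F.part I d"
  shows "\<exists>e\<in>Flags. F.part I e = F.part I c \<and>
        (\<forall>x\<in>Flags. F.part I x = F.part I c \<longrightarrow>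
          ((\<exists>y\<in>Flags. F.adjacent a x y \<and> F.part I y = F.part I d) \<longleftrightarrow>
           F.part {a + 1} x = F.part {a + 1} e))"
proof -
  have aI: "a \<in> I" using a by auto
  obtain V where V: "V \<in> c" "dm V = a" by (rule Flags_element[OF c(1) a(1)])
  obtain V' where V': "V' \<in> d" "dm V' = a" by (rule Flags_element[OF c(2) a(1)])
  have part_I: "F.part I x = insert W (F.part (I - {a}) x)" if "x \<in> Flags" "W \<in> x" "dm W = a" for x W
    using aI that dm_unique[OF that(1)] by (auto simp: F.part_def)
  have ne: "V \<noteq> V'" using part_I[OF c(1) V] part_I[OF c(2) V'] eq neq by auto
  obtain L where L: "sub L" "dm L = a + 1" "V \<subseteq> L" "V' \<subseteq> L"
      "\<And>Z. sub Z \<Longrightarrow> V \<subseteq> Z \<Longrightarrow> V' \<subseteq> Z \<Longrightarrow> L \<subseteq> Z"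
    using span_of_two[OF a(1,3,4) c eq V V' ne] by blast
  have LV: "L \<in> Vert" using L a by (auto simp: Vert_iff)
  have "chain (insert L (F.part I c))"
  proof (rule chain_insert[OF chain_part[OF c(1)] LV])
    fix x assume x: "x \<in> F.part I c"
    then have xc: "x \<in> c" "dm x \<in> I" using part_memD by blast+
    show "x \<subseteq> L \<or> L \<subseteq> x"
    proof (cases "dm x \<le> a")
      case True
      then have "x \<subseteq> V" using chain_le[OF Flags_chain[OF c(1)] xc(1) V(1)] V by simp
      then show ?thesis using L by blast
    next
      case False
      then have "x \<in> F.part (I - {a}) c" using xc by (intro part_memI) auto
      then have xd: "x \<in> d" unfolding eq using part_memD by blast
      have "V \<subseteq> x" using chain_le[OF Flags_chain[OF c(1)] V(1) xc(1)] V False by simp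
      moreover have "V' \<subseteq> x" using chain_le[OF Flags_chain[OF c(2)] V'(1) xd] V' False by simp
      ultimately show ?thesis using L(5)[OF chain_sub[OF Flags_chain[OF c(1)] xc(1)]] by blast
    qed
  qed
  then obtain e where e: "e \<in> Flags" "insert L (F.part I c) \<subseteq> e" using chain_extend by blast
  have eI: "F.part I e = F.part I c" using part_eq_iff_subset[OF c(1) e(1) a(4)] e(2) by blast
  have eL: "F.part {a + 1} e = {L}" using part_singleton[OF e(1), of L] e(2) L(2) by simp
  have "(\<exists>y\<in>Flags. F.adjacent a x y \<and> F.part I y = F.part I d) \<longleftrightarrow>
           F.part {a + 1} x = {L}" (is "?ex \<longleftrightarrow> _")
    if x: "x \<in> Flags" "F.part I x = F.part I c" for x
  proof
    have Vx: "V \<in> x" using x(2) part_memI[OF V(1), of I] V(2) aI part_memD by blast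
    assume ?ex
    then obtain y where y: "y \<in> Flags" "F.adjacent a x y" "F.part I y = F.part I d"
      by blast
    have Vy: "V' \<in> y" using y(3) part_memI[OF V'(1), of I] V'(2) aI part_memD by blast
    obtain Z where Z: "Z \<in> x" "dm Z = a + 1" by (rule Flags_element[OF x(1), of "a + 1"]) (use a in auto)
    have "Z \<in> F.part ({1..m} - {a}) x" using Z a by (intro part_memI) auto
    then have Zy: "Z \<in> y" unfolding y(2)[symmetric] using part_memD by blast
    have sZ: "sub Z" by (rule chain_sub[OF Flags_chain[OF x(1)] Z(1)])
    have "V \<subseteq> Z" using chain_le[OF Flags_chain[OF x(1)] Vx Z(1)] V Z by simp
    moreover have "V' \<subseteq> Z" using chain_le[OF Flags_chain[OF y(1)] Vy Zy] V' Z by simp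
    ultimately have "L = Z" using L(2,5) sub_eq[OF L(1) sZ] sZ Z(2) by simp
    then show "F.part {a + 1} x = {L}" using part_singleton[OF x(1) Z(1)] Z(2) by simp
  next
    assume "F.part {a + 1} x = {L}"
    then have Lx: "L \<in> x" using part_memD by blast
    have Vx: "V \<in> x" using x(2) part_memI[OF V(1), of I] V(2) aI part_memD by blast
    have xIa: "F.part (I - {a}) x = F.part (I - {a}) c"
      by (rule F.part_eq_mono[OF x(2)]) auto
    define y where "y = insert V' (x - {V})"
    have chy: "chain y" unfolding y_def
    proof (rule chain_insert)
      show "chain (x - {V})" by (rule chain_mono[OF Flags_chain[OF x(1)]]) auto
      show "V' \<in> Vert" by (rule chain_Vert[OF Flags_chain[OF c(2)] V'(1)])
      fix u assume u: "u \<in> x - {V}"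
      then have ua: "dm u \<noteq> a" using dm_unique[OF x(1) _ Vx, of u] V(2) by auto
      show "u \<subseteq> V' \<or> V' \<subseteq> u"
      proof (cases "dm u < a")
        case True
        moreover have "dm u \<in> {1..m}" using chain_dm[OF Flags_chain[OF x(1)], of u] u by simp
        ultimately have "dm u \<in> I - {a}" using a(3) by auto
        then have "u \<in> F.part (I - {a}) x" using u by (intro part_memI) auto
        then have "u \<in> d" unfolding xIa eq using part_memD by blast
        then show ?thesis using chain_le[OF Flags_chain[OF c(2)] _ V'(1), of u] True V'(2) by simp
      next
        case False
        then have "dm L \<le> dm u" using ua L(2) by simp
        then have "L \<subseteq> u" using chain_le[OF Flags_chain[OF x(1)] Lx, of u] u by simp
        then show ?thesis using L(4) by blast
      qed
    qed
    have "dm ` (x - {V}) = {1..m} - {a}"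
    proof -
      have "dm ` (x - {V}) = dm ` x - dm ` {V}"
        by (rule inj_on_image_set_diff[OF chain_inj[OF Flags_chain[OF x(1)]]]) (simp_all add: Vx)
      moreover have "dm ` x = {1..m}" using x(1) unfolding Flags_iff by simp
      ultimately show ?thesis using V(2) by simp
    qed
    then have "dm ` y = {1..m}" unfolding y_def image_insert V'(2) using a(1) by (simp only: insert_Diff)
    then have yF: "y \<in> Flags" using chy by (simp add: Flags_iff)
    have Vy: "V' \<in> y" by (simp add: y_def)
    have y1: "F.part J y = F.part J x" if "a \<notin> J" for J
    proof -
      have "u \<in> y \<and> dm u \<in> J \<longleftrightarrow> u \<in> x \<and> dm u \<in> J" for u
        using that V(2) V'(2) unfolding y_def by (cases "u = V"; cases "u = V'") simp_all
      then show ?thesis unfolding F.part_def by (intro Collect_cong)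
    qed
    have "F.part I y = insert V' (F.part (I - {a}) x)" using part_I[OF yF Vy V'(2)] y1[of "I - {a}"] by simp
    also have "\<dots> = F.part I d" unfolding xIa eq using part_I[OF c(2) V'] by simp
    finally have "F.part I y = F.part I d" .
    moreover have "F.adjacent a x y" by (rule y1) simp
    ultimately show ?ex using yF by blast
  qed
  then show ?thesis using e(1) eI eL by (intro bexI[of _ e]) auto
qed

sublocale B: building_flags Flags dm m q
proof
  show "0 < q" using q_ge_2 by simp
  show "card (F.cell I c) = card (F.cell I d)" if "I \<subseteq> {1..m}" "c \<in> Flags" "d \<in> Flags" for I c d
    using wt_pos_uniform[OF chain_part[OF that(2)] chain_part[OF that(3)], of I I] dm_part that
    by (simp add: card_cell_eq_wt)
qed (rule thick_flags join_flags; assumption)+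

end

section \<open>Eigenvalues near approximate eigenvalues\<close>

text \<open>Functions supported on a finite set \<open>X\<close>, with a weighted inner product. They are kept as functions on the
  whole type, so that the product topology supplies compactness.\<close>

locale weighted_functions =
  fixes X :: "'b set" and w :: "'b \<Rightarrow> real"
  assumes fin: "finite X" and w_pos: "s \<in> X \<Longrightarrow> 0 < w s"
begin

definition V :: "('b \<Rightarrow> real) set" where
  "V = {f. \<forall>s. s \<notin> X \<longrightarrow> f s = 0}"

definition wip :: "('b \<Rightarrow> real) \<Rightarrow> ('b \<Rightarrow> real) \<Rightarrow> real" where
  "wip f g = (\<Sum>s\<in>X. w s * f s * g s)"

lemma wip_commute: "wip f g = wip g f"
  by (simp add: wip_def ac_simps)

lemma wip_linear:
  "wip (\<lambda>s. f s + g s) h = wip f h + wip g h" "wip (\<lambda>s. f s - g s) h = wip f h - wip g h"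
  "wip (\<lambda>s. a * f s) h = a * wip f h" "wip h (\<lambda>s. f s + g s) = wip h f + wip h g"
  "wip h (\<lambda>s. f s - g s) = wip h f - wip h g" "wip h (\<lambda>s. a * f s) = a * wip h f"
  by (simp_all add: wip_def sum.distrib sum_subtractf sum_distrib_left algebra_simps)

lemma wip_nonneg: "0 \<le> wip f f"
  unfolding wip_def using w_pos by (intro sum_nonneg) (simp add: mult.assoc less_imp_le)

lemma wip_eq_0:
  assumes "f \<in> V" "wip f f = 0"
  shows "f = (\<lambda>_. 0)"
proof
  fix s
  show "f s = 0"
  proof (cases "s \<in> X")
    case True
    have "\<forall>s\<in>X. w s * f s * f s = 0"
      using assms(2) unfolding wip_def
      by (subst (asm) sum_nonneg_eq_0_iff) (use fin w_pos in \<open>simp_all add: mult.assoc less_imp_le\<close>)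
    then show ?thesis using True w_pos[OF True] by auto
  qed (use assms(1) in \<open>simp add: V_def\<close>)
qed

lemma wip_pos: "f \<in> V \<Longrightarrow> f \<noteq> (\<lambda>_. 0) \<Longrightarrow> 0 < wip f f"
  using wip_nonneg[of f] wip_eq_0[of f] by linarith

lemma V_closed:
  "f \<in> V \<Longrightarrow> g \<in> V \<Longrightarrow> (\<lambda>s. f s + g s) \<in> V"
  "f \<in> V \<Longrightarrow> g \<in> V \<Longrightarrow> (\<lambda>s. f s - g s) \<in> V"
  "f \<in> V \<Longrightarrow> (\<lambda>s. a * f s) \<in> V"
  by (auto simp: V_def)

text \<open>Tychonoff: a product of intervals, degenerate outside \<open>X\<close>.\<close>

lemma compact_box: "compact {f \<in> V. \<forall>s. \<bar>f s\<bar> \<le> b}"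
proof -
  have "compactin (product_topology (\<lambda>_::'b. euclidean) UNIV) (PiE UNIV (\<lambda>s. if s \<in> X then {-b..b::real} else {0}))"
    unfolding compactin_PiE by auto
  then have c: "compact (PiE UNIV (\<lambda>s. if s \<in> X then {-b..b::real} else {0}))"
    by (simp add: euclidean_product_topology)
  show ?thesis
  proof (cases "b < 0")
    case True
    then have "\<not> \<bar>f s\<bar> \<le> b" for f :: "'b \<Rightarrow> real" and s using abs_ge_zero[of "f s"] by linarith
    then have "{f \<in> V. \<forall>s. \<bar>f s\<bar> \<le> b} = {}" by blast
    then show ?thesis by (simp only: compact_empty)
  next
    case False
    have "{f \<in> V. \<forall>s. \<bar>f s\<bar> \<le> b} = PiE UNIV (\<lambda>s. if s \<in> X then {-b..b} else {0})"
    proof (intro equalityI subsetI)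
      fix f assume "f \<in> {f \<in> V. \<forall>s. \<bar>f s\<bar> \<le> b}"
      then show "f \<in> PiE UNIV (\<lambda>s. if s \<in> X then {-b..b} else {0})"
        by (auto simp: V_def PiE_iff abs_le_iff minus_le_iff)
    next
      fix f assume "f \<in> PiE UNIV (\<lambda>s. if s \<in> X then {-b..b} else {0})"
      then have f: "f s \<in> (if s \<in> X then {-b..b} else {0})" for s by blast
      have "f s = 0" if "s \<notin> X" for s using f[of s] that by simp
      moreover have "\<bar>f s\<bar> \<le> b" for s using f[of s] False by (auto split: if_splits)
      ultimately show "f \<in> {f \<in> V. \<forall>s. \<bar>f s\<bar> \<le> b}" by (simp add: V_def)
    qed
    then show ?thesis using c by simp
  qed
qed

lemma continuous_wip: "continuous_on S (\<lambda>f. wip f f)"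
  unfolding wip_def by (intro continuous_intros continuous_on_product_then_coordinatewise continuous_on_id)

lemma compact_unit_sphere: "compact {f \<in> V. wip f f = 1}"
proof (cases "X = {}")
  case True
  then have "{f \<in> V. wip f f = 1} = {}" unfolding wip_def by simp
  then show ?thesis by (simp only: compact_empty)
next
  case False
  \<comment> \<open>The sphere is closed, and bounded coordinatewise in terms of the smallest weight.\<close>
  define w0 where "w0 = Min (w ` X)"
  have "w0 \<in> w ` X" unfolding w0_def using fin False by (intro Min_in) auto
  then have w0: "w0 > 0" using w_pos by auto
  define b where "b = 1 + 1 / w0"
  have bd: "\<bar>f s\<bar> \<le> b" if f: "f \<in> V" "wip f f = 1" for f s
  proof (cases "s \<in> X")
    case True
    have "w0 * (f s)\<^sup>2 \<le> w s * (f s)\<^sup>2"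
      unfolding w0_def using fin True by (intro mult_right_mono Min_le) auto
    also have "\<dots> = w s * f s * f s" by (simp add: power2_eq_square)
    also have "\<dots> \<le> wip f f"
      unfolding wip_def using fin True w_pos by (intro member_le_sum) (simp_all add: mult.assoc less_imp_le)
    finally have "(f s)\<^sup>2 \<le> 1 / w0" using f w0 by (simp add: field_simps)
    moreover have "\<bar>f s\<bar> \<le> 1 + (f s)\<^sup>2"
    proof (cases "\<bar>f s\<bar> \<le> 1")
      case False
      then have "\<bar>f s\<bar> * 1 \<le> \<bar>f s\<bar> * \<bar>f s\<bar>" by (intro mult_left_mono) auto
      then show ?thesis by (simp add: power2_eq_square)
    qed (use zero_le_power2[of "f s"] in linarith)
    ultimately show ?thesis by (simp add: b_def)
  qed (use f w0 in \<open>simp add: V_def b_def\<close>)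
  have "{f \<in> V. wip f f = 1} = {f \<in> V. \<forall>s. \<bar>f s\<bar> \<le> b} \<inter> {f. wip f f = 1}"
    using bd by blast
  moreover have "closed {f. wip f f = 1}"
    by (intro closed_Collect_eq continuous_wip continuous_on_const)
  ultimately show ?thesis using compact_box by (simp add: compact_Int_closed)
qed

end

locale weighted_selfadjoint = weighted_functions X w
  for X :: "'b set" and w :: "'b \<Rightarrow> real" +
  fixes T :: "('b \<Rightarrow> real) \<Rightarrow> 'b \<Rightarrow> real"
  assumes T_V: "f \<in> V \<Longrightarrow> T f \<in> V"
    and T_add: "f \<in> V \<Longrightarrow> g \<in> V \<Longrightarrow> T (\<lambda>s. f s + g s) = (\<lambda>s. T f s + T g s)"
    and T_scale: "f \<in> V \<Longrightarrow> T (\<lambda>s. a * f s) = (\<lambda>s. a * T f s)"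
    and T_sym: "f \<in> V \<Longrightarrow> g \<in> V \<Longrightarrow> wip (T f) g = wip f (T g)"
begin

lemma T_sum:
  "finite Y \<Longrightarrow> (\<And>y. y \<in> Y \<Longrightarrow> g y \<in> V) \<Longrightarrow> T (\<lambda>s. \<Sum>y\<in>Y. a y * g y s) = (\<lambda>s. \<Sum>y\<in>Y. a y * T (g y) s)"
proof (induction Y rule: finite_induct)
  case empty
  have "(\<lambda>_. 0) \<in> V" by (simp add: V_def)
  from T_scale[OF this, of 0] show ?case by simp
next
  case (insert y Y)
  have "(\<lambda>s. a y * g y s) \<in> V" "(\<lambda>s. \<Sum>y\<in>Y. a y * g y s) \<in> V"
    using insert.prems by (auto simp: V_def)
  from T_add[OF this] insert show ?case by (simp add: T_scale)
qed

definition point :: "'b \<Rightarrow> 'b \<Rightarrow> real" where "point x s = of_bool (s = x)"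

lemma point_V: "x \<in> X \<Longrightarrow> point x \<in> V"
  by (auto simp: V_def point_def)

lemma T_coordinates:
  assumes "f \<in> V"
  shows "T f s = (\<Sum>x\<in>X. f x * T (point x) s)"
proof -
  have "f = (\<lambda>s. \<Sum>x\<in>X. f x * point x s)"
  proof
    fix s
    have "(\<Sum>x\<in>X. f x * point x s) = (\<Sum>x\<in>X. if s = x then f x else 0)"
      by (rule sum.cong) (auto simp: point_def)
    then show "f s = (\<Sum>x\<in>X. f x * point x s)"
      using assms fin by (auto simp: V_def)
  qed
  then have "T f = T (\<lambda>s. \<Sum>x\<in>X. f x * point x s)" by simp
  also have "\<dots> = (\<lambda>s. \<Sum>x\<in>X. f x * T (point x) s)" by (rule T_sum[OF fin point_V])
  finally show ?thesis by simp
qed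

text \<open>Let \<open>R = T - \<kappa>\<close>. A minimiser \<open>u\<close> of \<open>\<parallel>R u\<parallel>\<^sup>2\<close> on the unit sphere satisfies \<open>R\<^sup>2 u = \<rho> u\<close> with
  \<open>0 \<le> \<rho> \<le> \<epsilon>\<^sup>2\<close>, and factoring \<open>R\<^sup>2 - \<rho>\<close> produces an eigenvector of \<open>R\<close> for one of \<open>\<plusminus> \<surd>\<rho>\<close>.\<close>

lemma eigenvalue_near_approximate_eigenvalue:
  assumes f: "f \<in> V" "f \<noteq> (\<lambda>_. 0)" and \<epsilon>: "0 \<le> \<epsilon>"
    and approx: "wip (\<lambda>s. T f s - \<kappa> * f s) (\<lambda>s. T f s - \<kappa> * f s) \<le> \<epsilon>\<^sup>2 * wip f f"
  shows "\<exists>\<mu> g. g \<in> V \<and> g \<noteq> (\<lambda>_. 0) \<and> T g = (\<lambda>s. \<mu> * g s) \<and> \<bar>\<mu> - \<kappa>\<bar> \<le> \<epsilon>"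
proof -
  define R where "R f s = T f s - \<kappa> * f s" for f s
  have R_V: "R f \<in> V" if "f \<in> V" for f
    using T_V[OF that] that by (simp add: R_def V_def)
  have R_lin: "R (\<lambda>s. f s + a * g s) = (\<lambda>s. R f s + a * R g s)" if "f \<in> V" "g \<in> V" for f g a
    unfolding R_def T_add[OF that(1) V_closed(3)[OF that(2)]] T_scale[OF that(2)]
    by (simp add: algebra_simps)
  have R_scale: "R (\<lambda>s. a * g s) = (\<lambda>s. a * R g s)" if "g \<in> V" for g a
    unfolding R_def T_scale[OF that] by (simp add: algebra_simps)
  have R_sym: "wip (R f) g = wip f (R g)" if "f \<in> V" "g \<in> V" for f g
    using T_sym[OF that] by (simp add: R_def[abs_def] wip_linear)
  define Q where "Q f = wip (R f) (R f)" for f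
  define S where "S = {f \<in> V. wip f f = 1}"
  have normalize: "(\<lambda>s. 1 / sqrt (wip g g) * g s) \<in> S"
    "Q (\<lambda>s. 1 / sqrt (wip g g) * g s) = Q g / wip g g" if g: "g \<in> V" "g \<noteq> (\<lambda>_. 0)" for g
  proof -
    have pos: "wip g g > 0" by (rule wip_pos[OF g])
    define a where "a = 1 / sqrt (wip g g)"
    have sq: "a * (a * x) = x / wip g g" for x using pos by (simp add: a_def)
    show "(\<lambda>s. 1 / sqrt (wip g g) * g s) \<in> S"
      unfolding S_def mem_Collect_eq a_def[symmetric] wip_linear(3,6) sq
      using V_closed(3)[OF g(1)] pos by simp
    show "Q (\<lambda>s. 1 / sqrt (wip g g) * g s) = Q g / wip g g"
      unfolding Q_def a_def[symmetric] R_scale[OF g(1)] wip_linear(3,6) sq ..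
  qed
  have "continuous_on S Q"
  proof -
    have eq: "Q f = (\<Sum>s\<in>X. w s * ((\<Sum>x\<in>X. f x * T (point x) s) - \<kappa> * f s) * ((\<Sum>x\<in>X. f x * T (point x) s) - \<kappa> * f s))"
      if "f \<in> S" for f
    proof -
      have "f \<in> V" using that by (simp add: S_def)
      then show ?thesis unfolding Q_def wip_def R_def by (simp only: T_coordinates)
    qed
    have "continuous_on S (\<lambda>f. \<Sum>s\<in>X. w s * ((\<Sum>x\<in>X. f x * T (point x) s) - \<kappa> * f s) *
        ((\<Sum>x\<in>X. f x * T (point x) s) - \<kappa> * f s))"
      by (intro continuous_intros continuous_on_product_then_coordinatewise continuous_on_id)
    then show ?thesis by (subst continuous_on_cong[OF refl eq])
  qed
  moreover have "S \<noteq> {}" using normalize(1)[OF f] by blast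
  moreover have "compact S" unfolding S_def by (rule compact_unit_sphere)
  ultimately obtain u where u: "u \<in> S" "\<And>g. g \<in> S \<Longrightarrow> Q u \<le> Q g"
    using continuous_attains_inf[of S Q] by blast
  have uV: "u \<in> V" "wip u u = 1" using u by (auto simp: S_def)
  define \<rho> where "\<rho> = Q u"
  have rho0: "0 \<le> \<rho>" unfolding \<rho>_def Q_def by (rule wip_nonneg)
  have min: "\<rho> * wip g g \<le> Q g" if "g \<in> V" for g
  proof (cases "g = (\<lambda>_. 0)")
    case True
    then show ?thesis unfolding Q_def using wip_nonneg[of "R g"] by (simp add: wip_def)
  next
    case False
    show ?thesis
      using u(2)[OF normalize(1)[OF that False]] normalize(2)[OF that False] wip_pos[OF that False]
      by (simp add: \<rho>_def pos_le_divide_eq)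
  qed
  have rho_le: "\<rho> \<le> \<epsilon>\<^sup>2"
  proof -
    have "\<rho> * wip f f \<le> \<epsilon>\<^sup>2 * wip f f"
      using min[OF f(1)] approx unfolding Q_def R_def by linarith
    then show ?thesis using wip_pos[OF f] by (simp add: mult_le_cancel_right)
  qed
  define h where "h s = R (R u) s - \<rho> * u s" for s
  have hV: "h \<in> V" using R_V[OF R_V[OF uV(1)]] uV(1) by (simp add: h_def V_def)
  have "wip h h = 0"
  proof -
    define a where "a = wip h h"
    define b where "b = Q h - \<rho> * wip h h"
    have a_eq: "a = wip (R u) (R h) - \<rho> * wip u h"
    proof -
      have "wip h h = wip (\<lambda>s. R (R u) s - \<rho> * u s) h" by (simp add: h_def[abs_def])
      also have "\<dots> = wip (R (R u)) h - \<rho> * wip u h" by (simp only: wip_linear(2,3))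
      finally show ?thesis using R_sym[OF R_V[OF uV(1)] hV] by (simp add: a_def)
    qed
    \<comment> \<open>Stationarity: the minimality of \<open>\<rho>\<close> along the line \<open>u + t h\<close>.\<close>
    have quad: "0 \<le> 2 * t * a + t\<^sup>2 * b" for t
    proof -
      have V: "(\<lambda>s. u s + t * h s) \<in> V" using uV hV by (intro V_closed)
      have "wip (\<lambda>s. u s + t * h s) (\<lambda>s. u s + t * h s) = wip u u + 2 * t * wip u h + t\<^sup>2 * wip h h"
        unfolding wip_linear by (simp add: wip_commute[of h u] algebra_simps power2_eq_square)
      moreover have "Q (\<lambda>s. u s + t * h s) = Q u + 2 * t * wip (R u) (R h) + t\<^sup>2 * Q h"
        unfolding Q_def R_lin[OF uV(1) hV] wip_linear
        by (simp add: wip_commute[of "R h" "R u"] algebra_simps power2_eq_square)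
      ultimately have "\<rho> * (1 + 2 * t * wip u h + t\<^sup>2 * wip h h) \<le> \<rho> + 2 * t * wip (R u) (R h) + t\<^sup>2 * Q h"
        using min[OF V] uV(2) by (simp add: \<rho>_def)
      then show ?thesis by (simp add: a_eq b_def algebra_simps)
    qed
    have a0: "0 \<le> a" unfolding a_def by (rule wip_nonneg)
    have b0: "0 \<le> b" unfolding b_def using min[OF hV] by simp
    have "a = 0"
    proof (rule ccontr)
      assume "a \<noteq> 0"
      then have a: "a > 0" using a0 by simp
      \<comment> \<open>This \<open>t\<close> makes the quadratic \<open>2 t a + t\<^sup>2 b\<close> negative, and \<open>b + 1 > 0\<close> also when \<open>b = 0\<close>.\<close>
      define t where "t = - a / (b + 1)"
      have "t * (b + 1) = - a" using b0 by (simp add: t_def)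
      then have tb: "t * b = - a - t" by (simp add: distrib_left)
      have "t\<^sup>2 * b = t * (t * b)" by (simp add: power2_eq_square)
      also have "\<dots> = - (t * a) - t\<^sup>2" unfolding tb by (simp add: algebra_simps power2_eq_square)
      finally have "2 * t * a + t\<^sup>2 * b = t * a - t\<^sup>2" by simp
      moreover have "t < 0" using a b0 by (simp add: t_def divide_less_0_iff)
      then have "t * a < 0" using a by (simp add: mult_neg_pos)
      ultimately show False using quad[of t] zero_le_power2[of t] by linarith
    qed
    then show ?thesis by (simp add: a_def)
  qed
  from wip_eq_0[OF hV this] have RR: "R (R u) = (\<lambda>s. \<rho> * u s)"
    by (simp add: h_def[abs_def] fun_eq_iff)
  define r where "r = sqrt \<rho>"
  have r: "r * r = \<rho>" "0 \<le> r" "r \<le> \<epsilon>"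
    using rho0 rho_le \<epsilon> by (auto simp: r_def real_le_lsqrt)
  have unz: "u \<noteq> (\<lambda>_. 0)" using uV(2) by (auto simp: wip_def)
  \<comment> \<open>Factor \<open>R\<^sup>2 - \<rho>\<close> as \<open>(R - r)(R + r)\<close>: either \<open>(R + r) u\<close> vanishes or it is an
    eigenvector of \<open>R\<close> for \<open>r\<close>.\<close>
  define v where "v s = R u s + r * u s" for s
  have vV: "v \<in> V" using R_V[OF uV(1)] uV(1) by (simp add: v_def V_def)
  have Rv: "R v = (\<lambda>s. r * v s)"
  proof -
    have "R v = (\<lambda>s. R (R u) s + r * R u s)"
      unfolding v_def[abs_def] by (rule R_lin[OF R_V[OF uV(1)] uV(1)])
    then show ?thesis unfolding RR by (simp add: v_def algebra_simps r(1)[symmetric])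
  qed
  have T_R: "T g s = R g s + \<kappa> * g s" for g s by (simp add: R_def)
  show ?thesis
  proof (cases "v = (\<lambda>_. 0)")
    case True
    have "R u s = - r * u s" for s using fun_cong[OF True, of s] by (simp add: v_def)
    then have "T u = (\<lambda>s. (\<kappa> - r) * u s)" by (simp add: fun_eq_iff T_R algebra_simps)
    moreover have "\<bar>(\<kappa> - r) - \<kappa>\<bar> \<le> \<epsilon>" using r by simp
    ultimately show ?thesis using uV unz by blast
  next
    case False
    have "T v = (\<lambda>s. (\<kappa> + r) * v s)" unfolding fun_eq_iff T_R Rv by (simp add: algebra_simps)
    moreover have "\<bar>(\<kappa> + r) - \<kappa>\<bar> \<le> \<epsilon>" using r by simp
    ultimately show ?thesis using vV False by blast
  qed
qed

end

section \<open>The walk in terms of conditional expectations\<close>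

text \<open>Both sides sum over pairs of a set \<open>I\<close> of size \<open>k\<close> and an element outside of it.\<close>

lemma d_up_d_down_adjoint:
  assumes M: "finite M"
  shows "(\<Sum>T | T \<subseteq> M \<and> card T = k + 1. d_up {} x T * y T) = (\<Sum>I | I \<subseteq> M \<and> card I = k. x I * d_down M y I)"
proof -
  define P where "P j = {I. I \<subseteq> M \<and> card I = j}" for j
  have fin: "finite (P j)" for j by (rule finite_subset[of _ "Pow M"]) (auto simp: P_def M)
  have finI: "finite I" if "I \<in> P j" for I j using that M finite_subset by (auto simp: P_def)
  have "(\<Sum>T\<in>P (k + 1). d_up {} x T * y T)
      = (\<Sum>T\<in>P (k + 1). \<Sum>t\<in>T. incidence t (T - {t}) * x (T - {t}) * y T)"
    unfolding d_up_def by (simp add: sum_distrib_right)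
  also have "\<dots> = (\<Sum>(T, t)\<in>(SIGMA T:P (k + 1). T). incidence t (T - {t}) * x (T - {t}) * y T)"
    using fin finI by (intro sum.Sigma) auto
  also have "\<dots> = (\<Sum>(I, t)\<in>(SIGMA I:P k. M - I). x I * (incidence t I * y (insert t I)))"
  proof (rule sum.reindex_bij_witness[where i="\<lambda>(I, t). (insert t I, t)" and j="\<lambda>(T, t). (T - {t}, t)"], goal_cases)
    case (1 p)
    then show ?case by (cases p) (simp add: insert_absorb)
  next
    case (2 p)
    then obtain T t where p: "p = (T, t)" "T \<subseteq> M" "card T = k + 1" "t \<in> T" by (auto simp: P_def)
    then have "card (T - {t}) = k" by simp
    then show ?case using p by (auto simp: P_def)
  next
    case (3 p)
    then show ?case by (cases p) simp
  next
    case (4 p)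
    then obtain I t where p: "p = (I, t)" "I \<subseteq> M" "card I = k" "t \<in> M" "t \<notin> I" by (auto simp: P_def)
    then have "card (insert t I) = k + 1" using finite_subset[OF p(2) M] by simp
    then show ?case using p by (simp add: P_def)
  next
    case (5 p)
    then show ?case by (cases p) (simp add: insert_absorb mult.left_commute)
  qed
  also have "\<dots> = (\<Sum>I\<in>P k. \<Sum>t\<in>M - I. x I * (incidence t I * y (insert t I)))"
    using fin M by (intro sum.Sigma[symmetric]) auto
  also have "\<dots> = (\<Sum>I\<in>P k. x I * d_down M y I)"
    unfolding d_down_def by (simp add: sum_distrib_left)
  finally show ?thesis by (simp add: P_def)
qed

lemma hausdorff_distance_le:
  fixes A B :: "'m::metric_space set"
  assumes "A \<noteq> {}" "B \<noteq> {}" "\<And>a. a \<in> A \<Longrightarrow> \<exists>b\<in>B. dist a b \<le> \<delta>" "\<And>b. b \<in> B \<Longrightarrow> \<exists>a\<in>A. dist b a \<le> \<delta>"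
  shows "hausdorff_distance A B \<le> \<delta>"
proof -
  have "infdist a B \<le> \<delta>" if "a \<in> A" for a
    using assms(3)[OF that] infdist_le2 by blast
  moreover have "infdist b A \<le> \<delta>" if "b \<in> B" for b
    using assms(4)[OF that] infdist_le2 by blast
  ultimately show ?thesis
    unfolding hausdorff_distance_def using assms(1,2) by (intro max.boundedI cSUP_least) auto
qed

context finite_coordinate_space
begin

abbreviation "Simp \<equiv> building_simplices K n"
abbreviation "types j \<equiv> {I. I \<subseteq> {1..m} \<and> card I = j}"

lemma finite_Simp: "finite (Simp i)"
  by (rule finite_subset[of _ "Pow Vert"]) (auto simp: simplices_iff chain_def finite_Vert)

lemma card_part: "c \<in> Flags \<Longrightarrow> I \<subseteq> {1..m} \<Longrightarrow> card (F.part I c) = card I"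
  using card_chain[OF chain_part, of c I] dm_part[of c I] by simp

lemma part_Simp: "c \<in> Flags \<Longrightarrow> I \<subseteq> {1..m} \<Longrightarrow> card I = i + 1 \<Longrightarrow> F.part I c \<in> Simp i"
  unfolding simplices_iff[of "F.part I c"] using chain_part[of c I] card_part[of c I] by simp

lemma part_dm_image:
  assumes "c \<in> Flags" "s \<subseteq> c"
  shows "F.part (dm ` s) c = s"
proof (intro equalityI subsetI)
  fix x assume "x \<in> F.part (dm ` s) c"
  then obtain y where "x \<in> c" "y \<in> s" "dm x = dm y" by (auto simp: F.part_def)
  then show "x \<in> s" using dm_unique[OF assms(1), of x y] assms(2) by blast
qed (use assms in \<open>auto simp: F.part_def\<close>)

lemma Simp_dm:
  assumes "s \<in> Simp i"
  shows "dm ` s \<subseteq> {1..m}" "card (dm ` s) = i + 1" "chain s"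
  using assms chain_dm_subset[of s] card_chain[of s] by (auto simp: simplices_iff)

text \<open>The faces of a complete flag correspond to their sets of dimensions.\<close>

lemma sum_over_flags:
  "(\<Sum>s\<in>Simp i. \<Sum>c | c \<in> Flags \<and> s \<subseteq> c. H s c)
    = (\<Sum>c\<in>Flags. \<Sum>I\<in>types (i + 1). H (F.part I c) c)"
proof -
  have "(\<Sum>s\<in>Simp i. \<Sum>c | c \<in> Flags \<and> s \<subseteq> c. H s c) = (\<Sum>c\<in>Flags. \<Sum>s | s \<in> Simp i \<and> s \<subseteq> c. H s c)"
    by (rule sum.swap_restrict[OF finite_Simp finite_Flags])
  also have "\<dots> = (\<Sum>c\<in>Flags. \<Sum>I\<in>types (i + 1). H (F.part I c) c)"
  proof (rule sum.cong[OF refl])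
    fix c assume c: "c \<in> Flags"
    show "(\<Sum>s | s \<in> Simp i \<and> s \<subseteq> c. H s c) = (\<Sum>I\<in>types (i + 1). H (F.part I c) c)"
    proof (rule sum.reindex_bij_witness[where i="\<lambda>I. F.part I c" and j="\<lambda>s. dm ` s"], goal_cases)
      case (1 s) then show ?case using part_dm_image[OF c, of s] by simp
    next
      case (2 s) then show ?case using Simp_dm[of s i] by simp
    next
      case (3 I) then show ?case using dm_part[OF c, of I] by simp
    next
      case (4 I) then show ?case using part_Simp[OF c, of I i] part_subset[of I c] by simp
    next
      case (5 s) then show ?case using part_dm_image[OF c, of s] by simp
    qed
  qed
  finally show ?thesis .
qed

lemma weighted_sum_over_flags:
  "(\<Sum>s\<in>Simp i. real (weight K n s) * h s) = (\<Sum>c\<in>Flags. \<Sum>I\<in>types (i + 1). h (F.part I c))"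
proof -
  have "(\<Sum>s\<in>Simp i. real (weight K n s) * h s) = (\<Sum>s\<in>Simp i. \<Sum>c | c \<in> Flags \<and> s \<subseteq> c. h s)"
    by (simp add: weight_def)
  then show ?thesis by (simp only: sum_over_flags)
qed

sublocale W: weighted_functions "Simp i" "\<lambda>s. real (weight K n s)" for i
  by unfold_locales (use finite_Simp wt_pos in \<open>auto simp: weight_eq simplices_iff\<close>)

lemma V_eq: "W.V i = cochains K n i"
  unfolding W.V_def cochains_def ..

lemma wip_eq: "W.wip i = cochain_inner K n i"
  unfolding W.wip_def cochain_inner_def by (simp add: fun_eq_iff)

lemma cochain_inner_flags:
  "cochain_inner K n i f g = (\<Sum>c\<in>Flags. \<Sum>I\<in>types (i + 1). f (F.part I c) * g (F.part I c))"
  unfolding cochain_inner_def mult.assoc by (rule weighted_sum_over_flags)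

end

locale ordered_coordinate_space = finite_coordinate_space +
  fixes r :: "((nat \<Rightarrow> 'a) set \<times> (nat \<Rightarrow> 'a) set) set" and i :: nat
  assumes order: "dim_compatible_order K n r" and i_less: "i + 2 < n"
begin

abbreviation "cob \<equiv> coboundary K n r i"
abbreviation "k \<equiv> i + 1"

text \<open>Members of a flag have distinct dimensions, hence within a flag the order is the order of dimensions.\<close>

lemma order_iff:
  assumes "chain s" "x \<in> s" "y \<in> s"
  shows "y \<noteq> x \<and> (y, x) \<in> r \<longleftrightarrow> dm y < dm x"
proof -
  have V: "x \<in> Vert" "y \<in> Vert" using assms chain_Vert by blast+
  have lin: "antisym r" and less: "\<And>U W. U \<in> Vert \<Longrightarrow> W \<in> Vert \<Longrightarrow> dm U < dm W \<Longrightarrow> (U, W) \<in> r"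
    using order unfolding dim_compatible_order_def linear_order_on_def partial_order_on_def by blast+
  show ?thesis
  proof
    assume y: "y \<noteq> x \<and> (y, x) \<in> r"
    then have "dm y \<noteq> dm x" using chain_inj[OF assms(1)] assms(2,3) by (auto dest: inj_onD)
    moreover have "\<not> dm x < dm y" using less[OF V] y antisymD[OF lin] by blast
    ultimately show "dm y < dm x" by simp
  qed (use less[OF V(2,1)] in auto)
qed

lemma coboundary_part:
  assumes c: "c \<in> Flags" and T: "T \<subseteq> {1..m}" "card T = i + 2"
  shows "cob f (F.part T c) = d_up {} (\<lambda>J. f (F.part J c)) T"
proof -
  define s where "s = F.part T c"
  have s: "s \<in> Simp (i + 1)" unfolding s_def using part_Simp[OF c T(1)] T(2) by simp
  have ch: "chain s" and img: "dm ` s = T" unfolding s_def using chain_part[OF c] dm_part[OF c T(1)] by auto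
  have bij: "bij_betw dm s T" unfolding bij_betw_def using chain_inj[OF ch] img by simp
  have "cob f s = (\<Sum>x\<in>s. (-1) ^ card {y \<in> s. y \<noteq> x \<and> (y, x) \<in> r} * f (s - {x}))"
    using s by (simp add: coboundary_def)
  also have "\<dots> = (\<Sum>x\<in>s. incidence (dm x) (T - {dm x}) * f (F.part (T - {dm x}) c))"
  proof (rule sum.cong[OF refl])
    fix x assume x: "x \<in> s"
    have "{y \<in> s. y \<noteq> x \<and> (y, x) \<in> r} = {y \<in> s. dm y < dm x}"
      using order_iff[OF ch x] by blast
    moreover have "card {y \<in> s. dm y < dm x} = card {u \<in> T - {dm x}. u < dm x}"
    proof -
      have "dm ` {y \<in> s. dm y < dm x} = {u \<in> T - {dm x}. u < dm x}" unfolding img[symmetric] by auto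
      moreover have "inj_on dm {y \<in> s. dm y < dm x}" by (rule inj_on_subset[OF chain_inj[OF ch]]) auto
      note card_image[OF this]
      ultimately show ?thesis by (simp only:)
    qed
    moreover have "s - {x} = F.part (T - {dm x}) c"
    proof -
      have "u \<in> s - {x} \<longleftrightarrow> u \<in> F.part (T - {dm x}) c" for u
        using x dm_unique[OF c, of u x] unfolding s_def F.part_def by auto
      then show ?thesis by blast
    qed
    ultimately show "(-1) ^ card {y \<in> s. y \<noteq> x \<and> (y, x) \<in> r} * f (s - {x})
        = incidence (dm x) (T - {dm x}) * f (F.part (T - {dm x}) c)"
      by (simp add: incidence_def)
  qed
  also have "\<dots> = (\<Sum>t\<in>T. incidence t (T - {t}) * f (F.part (T - {t}) c))"
    by (rule sum.reindex_bij_betw[OF bij])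
  finally show ?thesis by (simp add: s_def d_up_def)
qed

text \<open>An explicit formula for the adjoint: average, over the complete flags through \<open>s\<close>, of the adjoint of the
  full simplex.\<close>

definition codiff :: "((nat \<Rightarrow> 'a) set set \<Rightarrow> real) \<Rightarrow> (nat \<Rightarrow> 'a) set set \<Rightarrow> real" where
  "codiff g s = (if s \<in> Simp i then
     (\<Sum>c | c \<in> Flags \<and> s \<subseteq> c. d_down {1..m} (\<lambda>T. g (F.part T c)) (dm ` s)) / weight K n s else 0)"

lemma codiff_cochain: "codiff g \<in> cochains K n i"
  by (simp add: codiff_def cochains_def)

lemma coboundary_codiff_adjoint:
  "cochain_inner K n (i + 1) (cob f) g = cochain_inner K n i f (codiff g)"
proof -
  have "cochain_inner K n (i + 1) (cob f) g
      = (\<Sum>c\<in>Flags. \<Sum>T\<in>types ((i + 1) + 1). d_up {} (\<lambda>J. f (F.part J c)) T * g (F.part T c))"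
    unfolding cochain_inner_flags by (intro sum.cong refl) (simp add: coboundary_part)
  also have "\<dots> = (\<Sum>c\<in>Flags. \<Sum>I\<in>types (i + 1). f (F.part I c) * d_down {1..m} (\<lambda>T. g (F.part T c)) I)"
    by (intro sum.cong refl d_up_d_down_adjoint) simp
  also have "\<dots> = (\<Sum>c\<in>Flags. \<Sum>I\<in>types (i + 1).
      f (F.part I c) * d_down {1..m} (\<lambda>T. g (F.part T c)) (dm ` F.part I c))"
    by (intro sum.cong refl) (simp add: dm_part)
  also have "\<dots> = (\<Sum>s\<in>Simp i. \<Sum>c | c \<in> Flags \<and> s \<subseteq> c. f s * d_down {1..m} (\<lambda>T. g (F.part T c)) (dm ` s))"
    by (rule sum_over_flags[symmetric])
  also have "\<dots> = cochain_inner K n i f (codiff g)"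
    unfolding cochain_inner_def
  proof (rule sum.cong[OF refl])
    fix s assume s: "s \<in> Simp i"
    then have "weight K n s > 0" using W.w_pos[OF s] by simp
    then show "(\<Sum>c | c \<in> Flags \<and> s \<subseteq> c. f s * d_down {1..m} (\<lambda>T. g (F.part T c)) (dm ` s))
        = real (weight K n s) * f s * codiff g s"
      using s by (simp add: codiff_def flip: sum_distrib_left)
  qed
  finally show ?thesis .
qed

lemma coboundary_adjoint_eq: "coboundary_adjoint K n r i g = codiff g"
  unfolding coboundary_adjoint_def
proof (rule the_equality)
  show "codiff g \<in> cochains K n i \<and> (\<forall>f\<in>cochains K n i.
      cochain_inner K n (i + 1) (cob f) g = cochain_inner K n i f (codiff g))"
    using codiff_cochain coboundary_codiff_adjoint by blast
  fix h assume h: "h \<in> cochains K n i \<and> (\<forall>f\<in>cochains K n i.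
      cochain_inner K n (i + 1) (cob f) g = cochain_inner K n i f h)"
  define u where "u s = h s - codiff g s" for s
  have u: "u \<in> W.V i" unfolding u_def by (rule W.V_closed) (use h codiff_cochain in \<open>auto simp: V_eq\<close>)
  have "W.wip i u h = W.wip i u (codiff g)"
    using h u coboundary_codiff_adjoint[of u g] by (simp add: wip_eq V_eq)
  then have "W.wip i u u = 0" unfolding u_def[of _, abs_def] by (simp add: W.wip_linear)
  then have "u = (\<lambda>_. 0)" by (rule W.wip_eq_0[OF u])
  then show "h = codiff g" by (simp add: u_def fun_eq_iff)
qed

abbreviation "walk \<equiv> signed_up_down_walk K n r i"

lemma walk_eq: "walk f = codiff (cob f)"
  by (simp add: signed_up_down_walk_def coboundary_adjoint_eq)

lemma walk_part:
  assumes c: "c \<in> Flags" and I: "I \<subseteq> {1..m}" "card I = k"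
  shows "walk f (F.part I c) = F.E I (\<lambda>c. d_down {1..m} (d_up {} (\<lambda>J. f (F.part J c))) I) c"
proof -
  define s where "s = F.part I c"
  have s: "s \<in> Simp i" unfolding s_def using part_Simp[OF c I] .
  have cell: "F.cell I c = {d \<in> Flags. s \<subseteq> d}"
    unfolding F.cell_def s_def using part_eq_iff_subset[OF c _ I(1)] by (intro Collect_cong) metis
  have "walk f s = (\<Sum>d\<in>F.cell I c. d_down {1..m} (\<lambda>T. cob f (F.part T d)) I) / weight K n s"
    using s dm_part[OF c I(1)] unfolding walk_eq codiff_def cell by (simp add: s_def)
  also have "(\<Sum>d\<in>F.cell I c. d_down {1..m} (\<lambda>T. cob f (F.part T d)) I)
      = (\<Sum>d\<in>F.cell I c. d_down {1..m} (d_up {} (\<lambda>J. f (F.part J d))) I)"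
  proof (rule sum.cong[OF refl], rule d_down_cong)
    fix d t assume "d \<in> F.cell I c" and t: "t \<in> {1..m} - I"
    then have d: "d \<in> Flags" by (simp add: F.cell_def)
    have "finite I" using I(1) finite_subset by blast
    then show "cob f (F.part (insert t I) d) = d_up {} (\<lambda>J. f (F.part J d)) (insert t I)"
      using t I by (intro coboundary_part[OF d]) auto
  qed
  also have "weight K n s = card (F.cell I c)" unfolding weight_eq cell wt_def ..
  finally show ?thesis unfolding s_def F.E_def .
qed

sublocale T: weighted_selfadjoint "Simp i" "\<lambda>s. real (weight K n s)" walk
proof
  have lin: "walk (\<lambda>s. f s + a * g s) s = walk f s + a * walk g s" for f g a s
  proof -
    have cob: "cob (\<lambda>s. f s + a * g s) = (\<lambda>s. cob f s + a * cob g s)"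
      by (auto simp: coboundary_def fun_eq_iff sum.distrib algebra_simps sum_distrib_left)
    have down: "d_down M (\<lambda>T. x T + a * y T) I = d_down M x I + a * d_down M y I" for M x y I
      by (simp add: d_down_def sum.distrib algebra_simps sum_distrib_left)
    show ?thesis unfolding walk_eq cob
      by (simp add: codiff_def down sum.distrib sum_distrib_left[symmetric] add_divide_distrib)
  qed
  show "walk f \<in> W.V i" for f unfolding V_eq walk_eq by (rule codiff_cochain)
  show "walk (\<lambda>s. f s + g s) = (\<lambda>s. walk f s + walk g s)" for f g
    using lin[of f 1 g] by (simp add: fun_eq_iff)
  show "walk (\<lambda>s. a * f s) = (\<lambda>s. a * walk f s)" for f a
  proof
    fix s
    have "walk (\<lambda>_. 0) s = 0" using lin[of "\<lambda>_. 0" "-1" "\<lambda>_. 0" s] by simp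
    then show "walk (\<lambda>s. a * f s) s = a * walk f s" using lin[of "\<lambda>_. 0" a f s] by simp
  qed
  have "W.wip i f (walk g) = cochain_inner K n (i + 1) (cob f) (cob g)" for f g
    unfolding wip_eq walk_eq coboundary_codiff_adjoint ..
  then show "W.wip i (walk f) g = W.wip i f (walk g)" for f g
    by (metis W.wip_commute wip_eq)
qed

abbreviation "Spec \<equiv> signed_up_down_spectrum K n r i"

lemma Spec_iff: "\<mu> \<in> Spec \<longleftrightarrow> (\<exists>f. f \<in> W.V i \<and> f \<noteq> (\<lambda>_. 0) \<and> walk f = (\<lambda>s. \<mu> * f s))"
  unfolding signed_up_down_spectrum_def V_eq by blast

lemma Spec_near_integer:
  assumes "\<mu> \<in> Spec"
  shows "\<exists>j\<le>k. \<bar>\<mu>\<bar> * \<bar>real m - real j - \<mu>\<bar> \<le> 4 ^ m * (real m)\<^sup>2 * B.\<theta> * (\<bar>real m - real j - \<mu>\<bar> + (real m)\<^sup>2)"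
proof -
  obtain f where f: "f \<in> W.V i" "f \<noteq> (\<lambda>_. 0)" "walk f = (\<lambda>s. \<mu> * f s)" using assms Spec_iff by blast
  then obtain s where s: "f s \<noteq> 0" by (auto simp: fun_eq_iff)
  then have sX: "s \<in> Simp i" using f(1) by (auto simp: W.V_def)
  obtain c0 where c0: "c0 \<in> Flags" "s \<subseteq> c0" using chain_extend Simp_dm(3)[OF sX] by blast
  have dep: "F.depends_on I (\<lambda>c. f (F.part I c))" for I
    unfolding F.depends_on_def by metis
  have eig: "F.E I (\<lambda>c. d_down {1..m} (d_up {} (\<lambda>J. f (F.part J c))) I) c = \<mu> * f (F.part I c)"
    if "I \<subseteq> {1..m}" "card I = k" "c \<in> Flags" for I c
    unfolding walk_part[OF that(3,1,2), symmetric] f(3) ..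
  have nz: "f (F.part (dm ` s) c0) \<noteq> 0" using part_dm_image[OF c0] s by simp
  from B.eigenvalue_near_integer[of k "\<lambda>I c. f (F.part I c)", OF dep eig Simp_dm(1,2)[OF sX] c0(1) nz]
  show ?thesis by (simp only: of_nat_mult of_nat_power of_nat_numeral)
qed

text \<open>A family of functions on complete flags descends to a cochain as soon as each component depends on its
  own levels only.\<close>

lemma cochain_of_family:
  assumes dep: "\<And>I. I \<subseteq> {1..m} \<Longrightarrow> card I = k \<Longrightarrow> F.depends_on I (\<phi> I)"
  obtains f where "f \<in> W.V i"
    "\<And>I c. I \<subseteq> {1..m} \<Longrightarrow> card I = k \<Longrightarrow> c \<in> Flags \<Longrightarrow> f (F.part I c) = \<phi> I c"
proof -
  define f where "f s = (if s \<in> Simp i then \<phi> (dm ` s) (SOME c. c \<in> Flags \<and> s \<subseteq> c) else 0)" for s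
  show ?thesis
  proof (rule that[of f])
    show "f \<in> W.V i" by (simp add: W.V_def f_def)
    fix I c assume I: "I \<subseteq> {1..m}" "card I = k" and c: "c \<in> Flags"
    define s where "s = F.part I c"
    define d where "d = (SOME c. c \<in> Flags \<and> s \<subseteq> c)"
    have "c \<in> Flags \<and> s \<subseteq> c" using c part_subset by (simp add: s_def)
    then have d: "d \<in> Flags \<and> s \<subseteq> d" unfolding d_def by (rule someI)
    then have "F.part I d = F.part I c" using part_eq_iff_subset[OF c _ I(1), of d] by (simp add: s_def)
    then have "\<phi> I d = \<phi> I c" using dep[OF I] c d unfolding F.depends_on_def by blast
    moreover have "f s = \<phi> I d"
      unfolding f_def d_def[symmetric] using part_Simp[OF c I] dm_part[OF c I(1)] by (simp add: s_def)
    ultimately show "f (F.part I c) = \<phi> I c" by (simp add: s_def)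
  qed
qed

lemma wip_nrm:
  assumes "\<And>I c. I \<subseteq> {1..m} \<Longrightarrow> card I = k \<Longrightarrow> c \<in> Flags \<Longrightarrow> f (F.part I c) = \<phi> I c"
  shows "W.wip i f f = (\<Sum>I\<in>types k. (L2_set (\<phi> I) Flags)\<^sup>2)"
proof -
  have "W.wip i f f = (\<Sum>c\<in>Flags. \<Sum>I\<in>types k. \<phi> I c * \<phi> I c)"
    unfolding wip_eq cochain_inner_flags by (intro sum.cong refl) (simp add: assms)
  also have "\<dots> = (\<Sum>I\<in>types k. \<Sum>c\<in>Flags. \<phi> I c * \<phi> I c)" by (rule sum.swap)
  finally show ?thesis by (simp add: F.nrm_eq_ip F.ip_def)
qed

text \<open>The approximate eigenvector on complete flags descends to a cochain with the same norms.\<close>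

lemma Spec_near:
  assumes "j \<le> k"
  shows "\<exists>\<mu>\<in>Spec. \<bar>\<mu> - (real m - real j)\<bar> \<le> 2 ^ m * (real m ^ 4 * (B.\<theta> + B.\<eta>))"
proof -
  have km: "k < m" using i_less by simp
  have k: "{1..k} \<subseteq> {1..m}" "card {1..k} = k" using km by auto
  obtain \<phi> \<rho> where *: "\<forall>I. I \<subseteq> {1..m} \<and> card I = k \<longrightarrow> F.depends_on I (\<phi> I) \<and>
       L2_set (\<lambda>c. F.E I (\<lambda>c. d_down {1..m} (d_up {} (\<lambda>J. \<phi> J c)) I) c - (real m - real j) * \<phi> I c) Flags
         \<le> real m ^ 4 * (B.\<theta> + B.\<eta>) * \<rho>"
    and \<rho>: "\<rho> \<le> L2_set (\<phi> {1..k}) Flags" "0 < \<rho>"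
    using B.approximate_eigenvector[OF assms km] by (elim exE conjE)
  have \<phi>: "F.depends_on I (\<phi> I)"
    "L2_set (\<lambda>c. F.E I (\<lambda>c. d_down {1..m} (d_up {} (\<lambda>J. \<phi> J c)) I) c - (real m - real j) * \<phi> I c) Flags
         \<le> real m ^ 4 * (B.\<theta> + B.\<eta>) * \<rho>" if "I \<subseteq> {1..m}" "card I = k" for I
    using *[rule_format, of I] that by blast+
  obtain f where f: "f \<in> W.V i" and f\<phi>: "\<And>I c. I \<subseteq> {1..m} \<Longrightarrow> card I = k \<Longrightarrow> c \<in> Flags \<Longrightarrow> f (F.part I c) = \<phi> I c"
    using cochain_of_family[OF \<phi>(1)] by blast
  define P where "P = {I. I \<subseteq> {1..m} \<and> card I = k}"
  have finP: "finite P" by (rule finite_subset[of _ "Pow {1..m}"]) (auto simp: P_def)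
  have cardP: "real (card P) \<le> 2 ^ m"
  proof -
    have "card P \<le> card (Pow {1..m})" by (rule card_mono) (auto simp: P_def)
    then have "card P \<le> 2 ^ m" by (simp add: card_Pow)
    then show ?thesis by (metis of_nat_le_iff of_nat_numeral of_nat_power)
  qed
  define C where "C = real m ^ 4 * (B.\<theta> + B.\<eta>)"
  have C0: "0 \<le> C" unfolding C_def using B.theta_nonneg B.eta_pos by simp
  define \<psi> where "\<psi> I c = F.E I (\<lambda>c. d_down {1..m} (d_up {} (\<lambda>J. \<phi> J c)) I) c - (real m - real j) * \<phi> I c" for I c
  have ff: "\<rho>\<^sup>2 \<le> W.wip i f f"
  proof -
    have "\<rho>\<^sup>2 \<le> (L2_set (\<phi> {1..k}) Flags)\<^sup>2" using \<rho> by (intro power_mono) auto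
    also have "\<dots> \<le> (\<Sum>I\<in>P. (L2_set (\<phi> I) Flags)\<^sup>2)"
      using finP k by (intro member_le_sum) (auto simp: P_def)
    also have "\<dots> = W.wip i f f" unfolding P_def by (rule wip_nrm[of f \<phi>, OF f\<phi>, symmetric])
    finally show ?thesis .
  qed
  have res: "walk f (F.part I c) - (real m - real j) * f (F.part I c) = \<psi> I c"
    if I: "I \<subseteq> {1..m}" "card I = k" and c: "c \<in> Flags" for I c
  proof -
    have "F.E I (\<lambda>c. d_down {1..m} (d_up {} (\<lambda>J. f (F.part J c))) I) c
        = F.E I (\<lambda>c. d_down {1..m} (d_up {} (\<lambda>J. \<phi> J c)) I) c"
    proof (rule F.E_cong, rule d_down_cong, rule d_up_cong)
      fix d t u assume d: "d \<in> Flags" and t: "t \<in> {1..m} - I" and u: "u \<in> insert t I - {}"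
      have "finite I" using I(1) finite_subset by blast
      then have "card (insert t I - {u}) = k" using card_exchange[of I t u] t u I(2) by simp
      then show "f (F.part (insert t I - {u}) d) = \<phi> (insert t I - {u}) d"
        using t I by (intro f\<phi> d) auto
    qed
    then show ?thesis unfolding walk_part[OF c I] \<psi>_def f\<phi>[OF I c] by simp
  qed
  have "W.wip i (\<lambda>s. walk f s - (real m - real j) * f s) (\<lambda>s. walk f s - (real m - real j) * f s)
      = (\<Sum>I\<in>P. (L2_set (\<psi> I) Flags)\<^sup>2)"
    unfolding P_def by (rule wip_nrm) (rule res)
  also have "\<dots> \<le> (\<Sum>I\<in>P. (C * \<rho>)\<^sup>2)"
  proof (rule sum_mono, rule power_mono)
    fix I assume "I \<in> P"
    then show "L2_set (\<psi> I) Flags \<le> C * \<rho>"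
      using \<phi>(2)[of I] unfolding \<psi>_def C_def P_def by simp
  qed simp
  also have "\<dots> = card P * (C * \<rho>)\<^sup>2" by simp
  also have "\<dots> \<le> 2 ^ m * (C * \<rho>)\<^sup>2" using cardP by (intro mult_right_mono) auto
  also have "\<dots> \<le> (2 ^ m)\<^sup>2 * (C * \<rho>)\<^sup>2"
    by (intro mult_right_mono) (auto simp: power2_eq_square)
  also have "\<dots> = (2 ^ m * C)\<^sup>2 * \<rho>\<^sup>2" by (simp add: power_mult_distrib)
  also have "\<dots> \<le> (2 ^ m * C)\<^sup>2 * W.wip i f f" using ff by (intro mult_left_mono) auto
  finally have approx: "W.wip i (\<lambda>s. walk f s - (real m - real j) * f s) (\<lambda>s. walk f s - (real m - real j) * f s)
      \<le> (2 ^ m * C)\<^sup>2 * W.wip i f f" .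
  have "f \<noteq> (\<lambda>_. 0)"
  proof
    assume "f = (\<lambda>_. 0)"
    then have "W.wip i f f = 0" by (simp add: W.wip_def)
    then show False using ff \<rho>(2) by simp
  qed
  from T.eigenvalue_near_approximate_eigenvalue[OF f this _ approx] C0
  show ?thesis unfolding Bex_def Spec_iff C_def by fastforce
qed

text \<open>The cochain \<open>d \<delta>\<close>, with \<open>\<delta>\<close> the indicator of the type \<open>{1..i}\<close>, is killed by \<open>d\<close>. For \<open>i = 0\<close> it is
  a constant function, the coboundary of the empty face.\<close>

lemma zero_in_Spec: "0 \<in> Spec"
proof -
  have km: "k < m" using i_less by simp
  define \<delta> :: "nat set \<Rightarrow> real" where "\<delta> J = of_bool (J = {1..i})" for J
  obtain f where f: "f \<in> W.V i"
    and fd: "\<And>I c. I \<subseteq> {1..m} \<Longrightarrow> card I = k \<Longrightarrow> c \<in> Flags \<Longrightarrow> f (F.part I c) = d_up {} \<delta> I"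
    using cochain_of_family[of "\<lambda>I c. d_up {} \<delta> I"] by (auto simp: F.depends_on_def)
  have walk0: "walk f = (\<lambda>s. 0 * f s)"
  proof
    fix s
    show "walk f s = 0 * f s"
    proof (cases "s \<in> Simp i")
      case True
      obtain c where c: "c \<in> Flags" "s \<subseteq> c" using chain_extend Simp_dm(3)[OF True] by blast
      define I where "I = dm ` s"
      have I: "I \<subseteq> {1..m}" "card I = k" "finite I"
        using Simp_dm[OF True] finite_subset[of I "{1..m}"] by (auto simp: I_def)
      have "d_down {1..m} (d_up {} (\<lambda>J. f (F.part J d))) I = 0" if d: "d \<in> Flags" for d
      proof -
        have "d_up {} (\<lambda>J. f (F.part J d)) (insert t I) = 0" if t: "t \<in> {1..m} - I" for t
        proof -
          have "d_up {} (\<lambda>J. f (F.part J d)) (insert t I) = d_up {} (d_up {} \<delta>) (insert t I)"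
          proof (rule d_up_cong)
            fix u assume u: "u \<in> insert t I - {}"
            have "card (insert t I - {u}) = k" using card_exchange[OF I(3), of t u] t u I(2) by simp
            then show "f (F.part (insert t I - {u}) d) = d_up {} \<delta> (insert t I - {u})"
              using t I by (intro fd d) auto
          qed
          also have "\<dots> = 0" using I by (intro d_up_d_up) auto
          finally show ?thesis .
        qed
        then show ?thesis unfolding d_down_def by (intro sum.neutral) simp
      qed
      then have "F.E I (\<lambda>d. d_down {1..m} (d_up {} (\<lambda>J. f (F.part J d))) I) c = 0"
        unfolding F.E_def by (simp add: F.cell_def)
      then have "walk f (F.part I c) = 0" unfolding walk_part[OF c(1) I(1,2)] .
      then show ?thesis unfolding I_def part_dm_image[OF c] by simp
    qed (simp add: walk_eq codiff_def)
  qed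
  have "f \<noteq> (\<lambda>_. 0)"
  proof
    assume f0: "f = (\<lambda>_. 0)"
    obtain c where c: "c \<in> Flags" using F.flags_nonempty by blast
    have "d_up {} \<delta> {1..k} = 0" using fd[of "{1..k}" c] c km f0 by simp
    moreover have "d_up {} \<delta> {1..k} = (\<Sum>t\<in>{1..k}. if t = k then incidence k {1..i} else 0)"
      unfolding d_up_def Diff_empty
    proof (rule sum.cong[OF refl])
      fix t assume t: "t \<in> {1..k}"
      show "incidence t ({1..k} - {t}) * \<delta> ({1..k} - {t}) = (if t = k then incidence k {1..i} else 0)"
      proof (cases "t = k")
        case True
        have "{1..k} - {k} = {1..i}" by auto
        then show ?thesis unfolding True \<delta>_def by simp
      next
        case False
        have "k \<in> {1..k} - {t}" "k \<notin> {1..i}" using False by auto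
        then have "\<delta> ({1..k} - {t}) = 0" unfolding \<delta>_def by (metis of_bool_eq(1))
        then show ?thesis using False by simp
      qed
    qed
    moreover have "(\<Sum>t\<in>{1..k}. if t = k then incidence k {1..i} else 0) = incidence k {1..i}"
      by (subst sum.delta) auto
    ultimately have "incidence k {1..i} = 0" by metis
    then show False using abs_incidence[of k "{1..i}"] by simp
  qed
  then show ?thesis unfolding Spec_iff using f walk0 by blast
qed

section \<open>Convergence of the spectrum\<close>

text \<open>The constraints on the error \<open>\<tau>\<close> are what the two halves need: an eigenvalue with \<open>\<bar>\<mu>\<bar> > \<delta>\<close> may be
  divided out of the inequality of \<open>Spec_near_integer\<close>, and eigenvalues below \<open>\<delta>\<close> are close to \<open>0\<close>.\<close>

lemma hausdorff_distance_Spec_le: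
  fixes \<delta> \<tau> :: real
  assumes \<delta>: "0 < \<delta>" and \<tau>: "B.\<theta> + B.\<eta> \<le> \<tau>"
    "4 ^ m * (real m)\<^sup>2 * \<tau> \<le> \<delta> / 2" "4 ^ m * (real m)\<^sup>2 * \<tau> * (real m)\<^sup>2 \<le> \<delta>\<^sup>2 / 2"
    "2 ^ m * real m ^ 4 * \<tau> \<le> \<delta>"
  shows "hausdorff_distance Spec (insert 0 (real ` {n - i - 2..n - 1})) \<le> \<delta>"
proof (rule hausdorff_distance_le)
  show "Spec \<noteq> {}" using zero_in_Spec by blast
next
  fix \<mu> assume \<mu>: "\<mu> \<in> Spec"
  show "\<exists>l\<in>insert 0 (real ` {n - i - 2..n - 1}). dist \<mu> l \<le> \<delta>"
  proof (cases "\<bar>\<mu>\<bar> \<le> \<delta>")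
    case True
    then show ?thesis by (intro bexI[of _ 0]) (auto simp: dist_real_def)
  next
    case False
    obtain j where j: "j \<le> k" "\<bar>\<mu>\<bar> * \<bar>real m - real j - \<mu>\<bar> \<le>
        4 ^ m * (real m)\<^sup>2 * B.\<theta> * (\<bar>real m - real j - \<mu>\<bar> + (real m)\<^sup>2)"
      using Spec_near_integer[OF \<mu>] by blast
    define y where "y = \<bar>real m - real j - \<mu>\<bar>"
    have "\<delta> * y \<le> \<bar>\<mu>\<bar> * y" using False by (intro mult_right_mono) (auto simp: y_def)
    also have "\<dots> \<le> 4 ^ m * (real m)\<^sup>2 * B.\<theta> * (y + (real m)\<^sup>2)" using j(2) by (simp add: y_def)
    also have "\<dots> \<le> 4 ^ m * (real m)\<^sup>2 * \<tau> * (y + (real m)\<^sup>2)"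
      using \<tau>(1) B.eta_pos by (intro mult_right_mono mult_left_mono) (auto simp: y_def)
    also have "\<dots> = 4 ^ m * (real m)\<^sup>2 * \<tau> * y + 4 ^ m * (real m)\<^sup>2 * \<tau> * (real m)\<^sup>2"
      by (simp add: distrib_left)
    also have "\<dots> \<le> \<delta> / 2 * y + \<delta>\<^sup>2 / 2"
      using \<tau>(2,3) by (intro add_mono mult_right_mono) (auto simp: y_def)
    finally have "\<delta> * y \<le> \<delta> * \<delta>" by (simp add: power2_eq_square)
    then have y: "y \<le> \<delta>" using \<delta> by simp
    have "m - j \<in> {n - i - 2..n - 1}" using j(1) i_less by auto
    moreover have "real m - real j = real (m - j)" using j(1) i_less by (simp add: of_nat_diff)
    then have "dist \<mu> (real (m - j)) \<le> \<delta>" using y by (simp add: y_def dist_real_def abs_minus_commute)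
    ultimately show ?thesis by blast
  qed
next
  fix l assume l: "l \<in> insert 0 (real ` {n - i - 2..n - 1})"
  show "\<exists>\<mu>\<in>Spec. dist l \<mu> \<le> \<delta>"
  proof (cases "l = 0")
    case True
    then show ?thesis using zero_in_Spec \<delta> by (intro bexI[of _ 0]) auto
  next
    case False
    then obtain t where t: "t \<in> {n - i - 2..n - 1}" "l = real t" using l by auto
    define j where "j = m - t"
    have j: "j \<le> k" "real m - real j = l" using t i_less by (auto simp: j_def of_nat_diff)
    obtain \<mu> where \<mu>: "\<mu> \<in> Spec" "\<bar>\<mu> - l\<bar> \<le> 2 ^ m * (real m ^ 4 * (B.\<theta> + B.\<eta>))"
      using Spec_near[OF j(1)] unfolding j(2) by blast
    note \<mu>(2)
    also have "2 ^ m * (real m ^ 4 * (B.\<theta> + B.\<eta>)) \<le> 2 ^ m * (real m ^ 4 * \<tau>)"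
      using \<tau>(1) by (intro mult_left_mono) auto
    also have "\<dots> \<le> \<delta>" using \<tau>(4) by (simp add: mult.assoc)
    finally show ?thesis using \<mu>(1) by (intro bexI[of _ \<mu>]) (auto simp: dist_real_def abs_minus_commute)
  qed
qed simp

end

theorem corollary3p23:
  fixes n i :: nat
  assumes "n \<ge> 3" and "i \<le> n - 3"
  shows "\<forall>\<epsilon>>0. \<exists>Q::nat. \<forall>q\<ge>Q. primepow q \<longrightarrow>
           (\<forall>(K :: 'a ring) r. field K \<and> card (carrier K) = q \<and> dim_compatible_order K n r \<longrightarrow>
              hausdorff_distance (signed_up_down_spectrum K n r i)
                (insert 0 (real ` {n - i - 2..n - 1})) < \<epsilon>)"
proof (intro allI impI)
  fix \<epsilon> :: real assume "\<epsilon> > 0"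
  define \<delta> where "\<delta> = \<epsilon> / 2"
  have \<delta>: "0 < \<delta>" "\<delta> < \<epsilon>" using \<open>\<epsilon> > 0\<close> by (auto simp: \<delta>_def)
  define m where "m = n - 1"
  have m: "0 < real m" using assms(1) by (simp add: m_def)
  define a where "a = 4 ^ m * (real m)\<^sup>2"
  define b where "b = 2 ^ m * real m ^ 4"
  have ab: "0 < a" "0 < b" using m by (auto simp: a_def b_def)
  define \<tau> where "\<tau> = min (\<delta> / 2 / a) (min (\<delta>\<^sup>2 / 2 / (a * (real m)\<^sup>2)) (\<delta> / b))"
  have \<tau>0: "0 < \<tau>" unfolding \<tau>_def using \<delta>(1) ab m by (intro min_less_iff_conj[THEN iffD2] conjI) auto
  have am: "0 < a * (real m)\<^sup>2" using ab m by simp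
  have "\<tau> * a \<le> \<delta> / 2" "\<tau> * (a * (real m)\<^sup>2) \<le> \<delta>\<^sup>2 / 2" "\<tau> * b \<le> \<delta>"
    unfolding pos_le_divide_eq[OF ab(1), symmetric] pos_le_divide_eq[OF ab(2), symmetric]
      pos_le_divide_eq[OF am, symmetric] by (simp_all add: \<tau>_def)
  then have \<tau>: "a * \<tau> \<le> \<delta> / 2" "a * \<tau> * (real m)\<^sup>2 \<le> \<delta>\<^sup>2 / 2" "b * \<tau> \<le> \<delta>"
    by (simp_all add: ac_simps)
  \<comment> \<open>By definition \<open>\<theta> + \<eta> = B / sqrt q\<close>, which is at most \<open>\<tau>\<close> for \<open>q \<ge> (B / \<tau>)\<^sup>2\<close>.\<close>
  define B where "B = real m * (4 * real m + 1) + 1"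
  have B: "0 < B" using m by (simp add: B_def add_pos_pos)
  show "\<exists>Q::nat. \<forall>q\<ge>Q. primepow q \<longrightarrow>
           (\<forall>(K :: 'a ring) r. field K \<and> card (carrier K) = q \<and> dim_compatible_order K n r \<longrightarrow>
              hausdorff_distance (signed_up_down_spectrum K n r i)
                (insert 0 (real ` {n - i - 2..n - 1})) < \<epsilon>)"
  proof (intro exI[of _ "nat \<lceil>(B / \<tau>)\<^sup>2\<rceil>"] allI impI)
    fix q :: nat and K :: "'a ring" and r
    assume q: "nat \<lceil>(B / \<tau>)\<^sup>2\<rceil> \<le> q" "primepow q"
      and K: "field K \<and> card (carrier K) = q \<and> dim_compatible_order K n r"
    have q0: "0 < q" using q(2) primepow_gt_0_nat by blast
    interpret ordered_coordinate_space K n r i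
    proof (intro ordered_coordinate_space.intro ordered_coordinate_space_axioms.intro finite_coordinate_space.intro)
      show "field K" "dim_compatible_order K n r" using K by auto
      show "finite (carrier K)" using K q0 by (metis card.infinite less_numeral_extra(3))
      show "2 \<le> n" "i + 2 < n" using assms by auto
    qed
    have "(B / \<tau>)\<^sup>2 \<le> q" using q(1) by linarith
    then have "B / \<tau> \<le> sqrt q" by (rule real_le_rsqrt)
    then have "B / sqrt q \<le> \<tau>" using \<tau>0 q0 by (simp add: field_simps)
    moreover have "B.\<theta> + B.\<eta> = B / sqrt q"
    proof -
      have "card (carrier K) = q" using K by blast
      then show ?thesis unfolding B.\<theta>_def B.\<eta>_def B_def m_def by (simp add: add_divide_distrib distrib_left)
    qed
    ultimately have "B.\<theta> + B.\<eta> \<le> \<tau>" by simp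
    then have "hausdorff_distance (signed_up_down_spectrum K n r i) (insert 0 (real ` {n - i - 2..n - 1})) \<le> \<delta>"
      using hausdorff_distance_Spec_le[OF \<delta>(1)] \<tau> unfolding a_def b_def m_def by blast
    then show "hausdorff_distance (signed_up_down_spectrum K n r i) (insert 0 (real ` {n - i - 2..n - 1})) < \<epsilon>"
      using \<delta>(2) by simp
  qed
qed

end
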